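(* Let $M$ be a Poisson manifold with a Hamiltonian action of a compact, connected Lie group $G$ with equivariant moment map $J:M\to\mathfrak g^*$, such that $Z:=J^{-1}(0)$ is first class. Then the Dirac reduced algebra $\mathcal C^\infty(Z)^{I_Z}$ is isomorphic, as a Poisson algebra, to the Poisson algebra $\mathcal C^\infty(M)^{\mathfrak g}/I_Z^{\mathfrak g}$ obtained by universal reduction.
   Context: $I_Z=\{f\in\mathcal C^\infty(M)\mid f|_Z=0\}$; $Z$ is first class if $\{I_Z,I_Z\}\subset I_Z$. $\mathcal C^\infty(Z)=\mathcal C^\infty(M)/I_Z$ with restriction map $\operatorname{res}$. Dirac reduced algebra: $h\in I_Z$ acts on $\mathcal C^\infty(Z)$ by $h.\operatorname{res}F=\operatorname{res}\{h,F\}$; the space of invariants $\mathcal C^\infty(Z)^{I_Z}$ carries the Poisson bracket $\{\operatorname{res}F,\operatorname{res}G\}=\operatorname{res}\{F,G\}$. Universal reduction: $\xi\in\mathfrak g$ acts on $\mathcal C^\infty(M)$ via $\{J(\xi),\cdot\}$; $\mathcal C^\infty(M)^{\mathfrak g}$ is the Poisson subalgebra of invariants, $I_Z^{\mathfrak g}=I_Z\cap\mathcal C^\infty(M)^{\mathfrak g}$ is a Poisson ideal in it, and the quotient has bracket $\{[f],[g]\}=[\{f,g\}]$. An action of $G$ on $M$ is Hamiltonian with moment map $J$ if the fundamental vector field of each $\xi\in\mathfrak g$ is the Hamiltonian vector field $\{J(\xi),\cdot\}$ and $J$ is equivariant for the coadjoint action. *)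

theory Defs
  imports "HOL-Analysis.Analysis" "HOL-Algebra.Algebra" "HOL-Algebra.Algebraic_Closure_Type"
begin

section \<open>Smooth manifolds\<close>

text \<open>
  Smoothness on an open set \<open>U\<close> of a finite-dimensional space: all iterated directional
  derivatives of the (everywhere existing) Frechet derivatives exist and are continuous.
\<close>

primrec Ck_on :: "nat \<Rightarrow> ('a::real_normed_vector \<Rightarrow> 'b::real_normed_vector) \<Rightarrow> 'a set \<Rightarrow> bool" where
  "Ck_on 0 f U \<longleftrightarrow> continuous_on U f"
| "Ck_on (Suc k) f U \<longleftrightarrow>
     (\<forall>x\<in>U. f differentiable (at x)) \<and>
     (\<forall>v. Ck_on k (\<lambda>x. frechet_derivative f (at x) v) U)"

definition smooth_on :: "'a::real_normed_vector set \<Rightarrow> ('a \<Rightarrow> 'b::real_normed_vector) \<Rightarrow> bool" where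
  "smooth_on U f \<longleftrightarrow> (\<forall>k. Ck_on k f U)"

type_synonym ('m, 'e) chart = "'m set \<times> ('m \<Rightarrow> 'e)"

definition is_chart :: "('m::topological_space, 'e::real_inner) chart \<Rightarrow> bool" where
  "is_chart = (\<lambda>(U, \<phi>). open U \<and> open (\<phi> ` U) \<and> homeomorphism U (\<phi> ` U) \<phi> (inv_into U \<phi>))"

text \<open>
  The underlying set of the manifold is the whole type \<open>'m\<close>; the smooth structure is the one
  generated by the (not necessarily maximal) atlas \<open>A\<close>. The model space is a finite-dimensional
  inner product space rather than an instance of class \<open>euclidean_space\<close>, because the latter
  excludes dimension 0 (a trivial Lie group, for example).
\<close>

definition smooth_manifold ::
    "('m::{t2_space, second_countable_topology}, 'e::real_inner) chart set \<Rightarrow> bool" where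
  "smooth_manifold A \<longleftrightarrow>
     (\<exists>B::'e set. finite B \<and> span B = UNIV) \<and>
     (\<forall>c\<in>A. is_chart c) \<and>
     (\<Union>(U, \<phi>)\<in>A. U) = UNIV \<and>
     (\<forall>(U, \<phi>)\<in>A. \<forall>(V, \<psi>)\<in>A. smooth_on (\<phi> ` (U \<inter> V)) (\<psi> \<circ> inv_into U \<phi>))"

definition smooth_map ::
    "('m::topological_space, 'e::real_inner) chart set \<Rightarrow>
     ('n::topological_space, 'f::real_inner) chart set \<Rightarrow> ('m \<Rightarrow> 'n) \<Rightarrow> bool" where
  "smooth_map A B F \<longleftrightarrow>
     continuous_on UNIV F \<and>
     (\<forall>(U, \<phi>)\<in>A. \<forall>(V, \<psi>)\<in>B. smooth_on (\<phi> ` (U \<inter> F -` V)) (\<psi> \<circ> F \<circ> inv_into U \<phi>))"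

definition prod_atlas ::
    "('m, 'e) chart set \<Rightarrow> ('n, 'f) chart set \<Rightarrow> ('m \<times> 'n, 'e \<times> 'f) chart set" where
  "prod_atlas A B = {(U \<times> V, map_prod \<phi> \<psi>) | U \<phi> V \<psi>. (U, \<phi>) \<in> A \<and> (V, \<psi>) \<in> B}"

definition smooth_functions ::
    "('m::topological_space, 'e::real_inner) chart set \<Rightarrow> ('m \<Rightarrow> real) set" where
  "smooth_functions A = {f. smooth_map A {(UNIV, id :: real \<Rightarrow> real)} f}"

text \<open>
  Tangent vectors at \<open>p\<close> are derivations at \<open>p\<close> of the smooth functions, set to 0 on
  non-smooth functions so that they are determined by their values on smooth functions.
\<close>

definition tangent_space ::
    "('m::topological_space, 'e::real_inner) chart set \<Rightarrow> 'm \<Rightarrow> (('m \<Rightarrow> real) \<Rightarrow> real) set" where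
  "tangent_space A p = {v.
     (\<forall>f. f \<notin> smooth_functions A \<longrightarrow> v f = 0) \<and>
     (\<forall>f\<in>smooth_functions A. \<forall>g\<in>smooth_functions A.
        v (\<lambda>x. f x + g x) = v f + v g \<and>
        v (\<lambda>x. f x * g x) = f p * v g + g p * v f) \<and>
     (\<forall>f\<in>smooth_functions A. \<forall>c. v (\<lambda>x. c * f x) = c * v f)}"

text \<open>\<open>tangent_map B F v\<close> is the image of a tangent vector \<open>v\<close> under the differential of \<open>F\<close>;
  \<open>B\<close> is the atlas of the target manifold.\<close>

definition tangent_map ::
    "('n::topological_space, 'f::real_inner) chart set \<Rightarrow> ('m \<Rightarrow> 'n) \<Rightarrow>
     (('m \<Rightarrow> real) \<Rightarrow> real) \<Rightarrow> (('n \<Rightarrow> real) \<Rightarrow> real)" where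
  "tangent_map B F v = (\<lambda>f. if f \<in> smooth_functions B then v (f \<circ> F) else 0)"


section \<open>Lie groups and the coadjoint action\<close>

definition lie_group ::
    "('g::{t2_space, second_countable_topology}, 'e::real_inner) chart set \<Rightarrow> 'g monoid \<Rightarrow> bool" where
  "lie_group AG G \<longleftrightarrow>
     smooth_manifold AG \<and> Group.group G \<and> carrier G = UNIV \<and>
     smooth_map (prod_atlas AG AG) AG (\<lambda>(g, h). g \<otimes>\<^bsub>G\<^esub> h) \<and>
     smooth_map AG AG (\<lambda>g. inv\<^bsub>G\<^esub> g)"

definition lie_algebra ::
    "('g::topological_space, 'e::real_inner) chart set \<Rightarrow> 'g monoid \<Rightarrow> (('g \<Rightarrow> real) \<Rightarrow> real) set" where
  "lie_algebra AG G = tangent_space AG \<one>\<^bsub>G\<^esub>"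

text \<open>The dual of the Lie algebra: linear functionals on it, extended by 0 outside.\<close>

definition lie_dual ::
    "('g::topological_space, 'e::real_inner) chart set \<Rightarrow> 'g monoid \<Rightarrow>
     ((('g \<Rightarrow> real) \<Rightarrow> real) \<Rightarrow> real) set" where
  "lie_dual AG G = {\<alpha>.
     (\<forall>\<xi>. \<xi> \<notin> lie_algebra AG G \<longrightarrow> \<alpha> \<xi> = 0) \<and>
     (\<forall>\<xi>\<in>lie_algebra AG G. \<forall>\<eta>\<in>lie_algebra AG G. \<alpha> (\<lambda>f. \<xi> f + \<eta> f) = \<alpha> \<xi> + \<alpha> \<eta>) \<and>
     (\<forall>\<xi>\<in>lie_algebra AG G. \<forall>c. \<alpha> (\<lambda>f. c * \<xi> f) = c * \<alpha> \<xi>)}"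

definition Ad ::
    "('g::topological_space, 'e::real_inner) chart set \<Rightarrow> 'g monoid \<Rightarrow> 'g \<Rightarrow>
     (('g \<Rightarrow> real) \<Rightarrow> real) \<Rightarrow> (('g \<Rightarrow> real) \<Rightarrow> real)" where
  "Ad AG G g = tangent_map AG (\<lambda>h. g \<otimes>\<^bsub>G\<^esub> h \<otimes>\<^bsub>G\<^esub> inv\<^bsub>G\<^esub> g)"

definition coAd ::
    "('g::topological_space, 'e::real_inner) chart set \<Rightarrow> 'g monoid \<Rightarrow> 'g \<Rightarrow>
     ((('g \<Rightarrow> real) \<Rightarrow> real) \<Rightarrow> real) \<Rightarrow> ((('g \<Rightarrow> real) \<Rightarrow> real) \<Rightarrow> real)" where
  "coAd AG G g \<alpha> = (\<lambda>\<xi>. if \<xi> \<in> lie_algebra AG G then \<alpha> (Ad AG G (inv\<^bsub>G\<^esub> g) \<xi>) else 0)"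


section \<open>Poisson algebras\<close>

record 'b poisson = "(real, 'b) module" +
  pbracket :: "'b \<Rightarrow> 'b \<Rightarrow> 'b"

abbreviation real_ring :: "real ring" where
  "real_ring \<equiv> ring_of_type_algebra"

text \<open>Commutative unital real algebras with a Lie bracket satisfying the Leibniz rule.\<close>

locale poisson_algebra = Module.algebra real_ring P for P :: "('b, 'z) poisson_scheme" +
  assumes bracket_closed:
      "\<lbrakk>x \<in> carrier P; y \<in> carrier P\<rbrakk> \<Longrightarrow> pbracket P x y \<in> carrier P"
    and bracket_add:
      "\<lbrakk>x \<in> carrier P; y \<in> carrier P; z \<in> carrier P\<rbrakk> \<Longrightarrow>
       pbracket P (x \<oplus>\<^bsub>P\<^esub> y) z = pbracket P x z \<oplus>\<^bsub>P\<^esub> pbracket P y z"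
    and bracket_smult:
      "\<lbrakk>x \<in> carrier P; y \<in> carrier P\<rbrakk> \<Longrightarrow>
       pbracket P (a \<odot>\<^bsub>P\<^esub> x) y = a \<odot>\<^bsub>P\<^esub> pbracket P x y"
    and bracket_antisym:
      "\<lbrakk>x \<in> carrier P; y \<in> carrier P\<rbrakk> \<Longrightarrow> pbracket P x y = \<ominus>\<^bsub>P\<^esub> pbracket P y x"
    and bracket_jacobi:
      "\<lbrakk>x \<in> carrier P; y \<in> carrier P; z \<in> carrier P\<rbrakk> \<Longrightarrow>
       pbracket P x (pbracket P y z) \<oplus>\<^bsub>P\<^esub> pbracket P y (pbracket P z x)
         \<oplus>\<^bsub>P\<^esub> pbracket P z (pbracket P x y) = \<zero>\<^bsub>P\<^esub>"
    and bracket_leibniz: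
      "\<lbrakk>x \<in> carrier P; y \<in> carrier P; z \<in> carrier P\<rbrakk> \<Longrightarrow>
       pbracket P x (y \<otimes>\<^bsub>P\<^esub> z) = pbracket P x y \<otimes>\<^bsub>P\<^esub> z \<oplus>\<^bsub>P\<^esub> y \<otimes>\<^bsub>P\<^esub> pbracket P x z"

definition poisson_iso ::
    "('a, 'y) poisson_scheme \<Rightarrow> ('b, 'z) poisson_scheme \<Rightarrow> ('a \<Rightarrow> 'b) set" where
  "poisson_iso P Q = {\<Phi> \<in> ring_iso P Q.
     (\<forall>a. \<forall>x\<in>carrier P. \<Phi> (a \<odot>\<^bsub>P\<^esub> x) = a \<odot>\<^bsub>Q\<^esub> \<Phi> x) \<and>
     (\<forall>x\<in>carrier P. \<forall>y\<in>carrier P. \<Phi> (pbracket P x y) = pbracket Q (\<Phi> x) (\<Phi> y))}"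

definition isomorphic_poisson_algebras ::
    "('a, 'y) poisson_scheme \<Rightarrow> ('b, 'z) poisson_scheme \<Rightarrow> bool" where
  "isomorphic_poisson_algebras P Q \<longleftrightarrow>
     poisson_algebra P \<and> poisson_algebra Q \<and> poisson_iso P Q \<noteq> {}"

text \<open>
  The quotient by an ideal \<open>I\<close>, with all operations defined through representatives as for
  \<^const>\<open>FactRing\<close>. Where an operation does not depend on the representatives, the
  union below is a single coset; otherwise it is not a coset, so that a subset of the
  cosets which is closed under \<^const>\<open>pbracket\<close> has a well-defined bracket. For this reason
  \<open>I\<close> need not be a Poisson ideal.
\<close>

definition poisson_quot :: "('b, 'z) poisson_scheme \<Rightarrow> 'b set \<Rightarrow> 'b set poisson" where
  "poisson_quot P I =
     \<lparr>carrier = a_rcosets\<^bsub>P\<^esub> I, monoid.mult = rcoset_mult P I,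
      one = I +>\<^bsub>P\<^esub> \<one>\<^bsub>P\<^esub>, ring.zero = I, add = set_add P,
      smult = (\<lambda>a K. \<Union>x\<in>K. I +>\<^bsub>P\<^esub> (a \<odot>\<^bsub>P\<^esub> x)),
      pbracket = (\<lambda>K L. \<Union>x\<in>K. \<Union>y\<in>L. I +>\<^bsub>P\<^esub> pbracket P x y)\<rparr>"


section \<open>Poisson manifolds and Hamiltonian actions\<close>

definition function_algebra ::
    "('m::topological_space, 'e::real_inner) chart set \<Rightarrow>
     (('m \<Rightarrow> real) \<Rightarrow> ('m \<Rightarrow> real) \<Rightarrow> ('m \<Rightarrow> real)) \<Rightarrow> ('m \<Rightarrow> real) poisson" where
  "function_algebra A br =
     \<lparr>carrier = smooth_functions A, monoid.mult = (\<lambda>f g x. f x * g x),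
      one = (\<lambda>x. 1), ring.zero = (\<lambda>x. 0), add = (\<lambda>f g x. f x + g x),
      smult = (\<lambda>a f x. a * f x), pbracket = br\<rparr>"

definition poisson_manifold ::
    "('m::{t2_space, second_countable_topology}, 'e::real_inner) chart set \<Rightarrow>
     (('m \<Rightarrow> real) \<Rightarrow> ('m \<Rightarrow> real) \<Rightarrow> ('m \<Rightarrow> real)) \<Rightarrow> bool" where
  "poisson_manifold A br \<longleftrightarrow> smooth_manifold A \<and> poisson_algebra (function_algebra A br)"

definition smooth_action ::
    "('g::topological_space, 'e::real_inner) chart set \<Rightarrow> 'g monoid \<Rightarrow>
     ('m::topological_space, 'f::real_inner) chart set \<Rightarrow> ('g \<Rightarrow> 'm \<Rightarrow> 'm) \<Rightarrow> bool" where
  "smooth_action AG G A act \<longleftrightarrow>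
     group_action G UNIV act \<and> smooth_map (prod_atlas AG A) A (\<lambda>(g, x). act g x)"

text \<open>
  The fundamental vector field of \<open>\<xi>\<close> at \<open>x\<close> is the image of \<open>\<xi>\<close> under the
  differential at the identity of \<open>g \<mapsto> g\<^sup>-\<^sup>1 x\<close>, i.e. the velocity at \<open>t = 0\<close> of
  \<open>exp (- t \<xi>) x\<close>. With this sign \<open>\<xi> \<mapsto> fundamental_field \<xi>\<close> is a Lie algebra
  action on functions; the opposite sign amounts to replacing a moment map by its negative.
\<close>

definition fundamental_field ::
    "'g monoid \<Rightarrow> ('m::topological_space, 'f::real_inner) chart set \<Rightarrow> ('g \<Rightarrow> 'm \<Rightarrow> 'm) \<Rightarrow>
     (('g \<Rightarrow> real) \<Rightarrow> real) \<Rightarrow> 'm \<Rightarrow> (('m \<Rightarrow> real) \<Rightarrow> real)" where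
  "fundamental_field G A act \<xi> x = tangent_map A (\<lambda>g. act (inv\<^bsub>G\<^esub> g) x) \<xi>"

text \<open>The component function \<open>J(\<xi>)\<close> of \<open>J\<close>.\<close>

definition component ::
    "('m \<Rightarrow> ((('g \<Rightarrow> real) \<Rightarrow> real) \<Rightarrow> real)) \<Rightarrow> (('g \<Rightarrow> real) \<Rightarrow> real) \<Rightarrow> 'm \<Rightarrow> real" where
  "component J \<xi> = (\<lambda>x. J x \<xi>)"

text \<open>Since the Lie algebra is finite-dimensional, \<open>J\<close> is smooth iff all its components are.\<close>

definition moment_map ::
    "('g::topological_space, 'e::real_inner) chart set \<Rightarrow> 'g monoid \<Rightarrow>
     ('m::topological_space, 'f::real_inner) chart set \<Rightarrow>
     (('m \<Rightarrow> real) \<Rightarrow> ('m \<Rightarrow> real) \<Rightarrow> ('m \<Rightarrow> real)) \<Rightarrow> ('g \<Rightarrow> 'm \<Rightarrow> 'm) \<Rightarrow>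
     ('m \<Rightarrow> ((('g \<Rightarrow> real) \<Rightarrow> real) \<Rightarrow> real)) \<Rightarrow> bool" where
  "moment_map AG G A br act J \<longleftrightarrow>
     (\<forall>x. J x \<in> lie_dual AG G) \<and>
     (\<forall>\<xi>\<in>lie_algebra AG G. component J \<xi> \<in> smooth_functions A) \<and>
     (\<forall>\<xi>\<in>lie_algebra AG G. \<forall>f\<in>smooth_functions A. \<forall>x.
        fundamental_field G A act \<xi> x f = br (component J \<xi>) f x) \<and>
     (\<forall>g x. J (act g x) = coAd AG G g (J x))"

definition hamiltonian_action ::
    "('g::topological_space, 'e::real_inner) chart set \<Rightarrow> 'g monoid \<Rightarrow>
     ('m::topological_space, 'f::real_inner) chart set \<Rightarrow>
     (('m \<Rightarrow> real) \<Rightarrow> ('m \<Rightarrow> real) \<Rightarrow> ('m \<Rightarrow> real)) \<Rightarrow> ('g \<Rightarrow> 'm \<Rightarrow> 'm) \<Rightarrow>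
     ('m \<Rightarrow> ((('g \<Rightarrow> real) \<Rightarrow> real) \<Rightarrow> real)) \<Rightarrow> bool" where
  "hamiltonian_action AG G A br act J \<longleftrightarrow>
     smooth_action AG G A act \<and> moment_map AG G A br act J"

definition zero_level :: "('m \<Rightarrow> ((('g \<Rightarrow> real) \<Rightarrow> real) \<Rightarrow> real)) \<Rightarrow> 'm set" where
  "zero_level J = J -` {\<lambda>\<xi>. 0}"


section \<open>The two reduced algebras\<close>

definition vanishing_ideal ::
    "('m::topological_space, 'e::real_inner) chart set \<Rightarrow> 'm set \<Rightarrow> ('m \<Rightarrow> real) set" where
  "vanishing_ideal A Z = {f \<in> smooth_functions A. \<forall>z\<in>Z. f z = 0}"

definition first_class ::
    "('m::topological_space, 'e::real_inner) chart set \<Rightarrow>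
     (('m \<Rightarrow> real) \<Rightarrow> ('m \<Rightarrow> real) \<Rightarrow> ('m \<Rightarrow> real)) \<Rightarrow> 'm set \<Rightarrow> bool" where
  "first_class A br Z \<longleftrightarrow>
     (\<forall>f\<in>vanishing_ideal A Z. \<forall>g\<in>vanishing_ideal A Z. br f g \<in> vanishing_ideal A Z)"

text \<open>
  The smooth functions on \<open>Z\<close> are the cosets of the vanishing ideal, the restriction of \<open>F\<close>
  being its coset. An element \<open>h\<close> of the ideal sends the coset of \<open>F\<close> to that of
  \<open>br h F\<close>; the zero of the quotient is the ideal itself.
\<close>

definition ideal_act ::
    "('m::topological_space, 'e::real_inner) chart set \<Rightarrow>
     (('m \<Rightarrow> real) \<Rightarrow> ('m \<Rightarrow> real) \<Rightarrow> ('m \<Rightarrow> real)) \<Rightarrow> 'm set \<Rightarrow>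
     ('m \<Rightarrow> real) \<Rightarrow> ('m \<Rightarrow> real) set \<Rightarrow> ('m \<Rightarrow> real) set" where
  "ideal_act A br Z h K =
     (\<Union>F\<in>K. vanishing_ideal A Z +>\<^bsub>function_algebra A br\<^esub> br h F)"

definition dirac_reduction ::
    "('m::topological_space, 'e::real_inner) chart set \<Rightarrow>
     (('m \<Rightarrow> real) \<Rightarrow> ('m \<Rightarrow> real) \<Rightarrow> ('m \<Rightarrow> real)) \<Rightarrow> 'm set \<Rightarrow> ('m \<Rightarrow> real) set poisson" where
  "dirac_reduction A br Z =
     (let Q = poisson_quot (function_algebra A br) (vanishing_ideal A Z)
      in Q\<lparr>carrier := {K \<in> carrier Q. \<forall>h\<in>vanishing_ideal A Z. ideal_act A br Z h K = \<zero>\<^bsub>Q\<^esub>}\<rparr>)"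

definition invariant_algebra ::
    "('g::topological_space, 'e::real_inner) chart set \<Rightarrow> 'g monoid \<Rightarrow>
     ('m::topological_space, 'f::real_inner) chart set \<Rightarrow>
     (('m \<Rightarrow> real) \<Rightarrow> ('m \<Rightarrow> real) \<Rightarrow> ('m \<Rightarrow> real)) \<Rightarrow>
     ('m \<Rightarrow> ((('g \<Rightarrow> real) \<Rightarrow> real) \<Rightarrow> real)) \<Rightarrow> ('m \<Rightarrow> real) poisson" where
  "invariant_algebra AG G A br J =
     (function_algebra A br)\<lparr>carrier :=
        {f \<in> smooth_functions A. \<forall>\<xi>\<in>lie_algebra AG G. br (component J \<xi>) f = (\<lambda>x. 0)}\<rparr>"

definition universal_reduction ::
    "('g::topological_space, 'e::real_inner) chart set \<Rightarrow> 'g monoid \<Rightarrow>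
     ('m::topological_space, 'f::real_inner) chart set \<Rightarrow>
     (('m \<Rightarrow> real) \<Rightarrow> ('m \<Rightarrow> real) \<Rightarrow> ('m \<Rightarrow> real)) \<Rightarrow>
     ('m \<Rightarrow> ((('g \<Rightarrow> real) \<Rightarrow> real) \<Rightarrow> real)) \<Rightarrow> ('m \<Rightarrow> real) set poisson" where
  "universal_reduction AG G A br J =
     poisson_quot (invariant_algebra AG G A br J)
       (vanishing_ideal A (zero_level J) \<inter> carrier (invariant_algebra AG G A br J))"

end

theory Submission
  imports Defs
begin

text \<open>
  Let \<open>I\<close> be the ideal of functions vanishing on \<open>Z\<close>, let \<open>N = {f | \<forall>h\<in>I. {h, f} \<in> I}\<close> be its
  normalizer and let \<open>C\<close> be the algebra of functions commuting with all components of \<open>J\<close>.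
  Since \<open>Z\<close> is first class, \<open>I\<close> is a Poisson ideal of \<open>N\<close>, and Dirac reduction is
  \<open>N / I\<close>; universal reduction is \<open>C / (I \<inter> C)\<close>. By the second isomorphism theorem
  for Poisson algebras (\<open>poisson_second_isomorphism\<close>) it suffices that \<open>C \<subseteq> N\<close> and \<open>N \<subseteq> I + C\<close>.

  \<open>C \<subseteq> N\<close> (\<open>invariants_normalize\<close>). Zero need not be a regular value, so \<open>I\<close> may be larger than
  the ideal generated by the components of \<open>J\<close>, and the Leibniz rule alone does not give
  \<open>{C, I} \<subseteq> I\<close>. But if \<open>f \<in> C\<close>, then \<open>J\<close> is constant along the integral curves of the Hamiltonian vector
  field of \<open>f\<close>; such a curve starting on \<open>Z\<close> stays in \<open>Z\<close>, and a function \<open>h \<in> I\<close> is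
  zero along it, so that \<open>{f, h} = 0\<close> on \<open>Z\<close>. This needs the Picard-Lindeloef theorem and the fact
  that a derivation of the smooth functions acts in a chart as a vector field with smooth
  coefficients, which follows from Hadamard's lemma and the existence of bump functions
  (\<open>tangent_vector_in_chart\<close>, \<open>derivation_tangent_to_common_level\<close>).

  \<open>N \<subseteq> I + C\<close>. If \<open>f \<in> N\<close>, then the brackets of \<open>f\<close> with the components of \<open>J\<close> vanish on \<open>Z\<close>.
  As \<open>Z\<close> is invariant under \<open>G\<close>, all derivatives of \<open>g \<mapsto> f (g\<inverse> z)\<close> vanish for \<open>z \<in> Z\<close>, and
  because \<open>G\<close> is connected \<open>f\<close> is constant on the orbits in \<open>Z\<close>
  (\<open>normalizer_constant_on_orbits\<close>). The average of \<open>f\<close> over the compact group \<open>G\<close> is then an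
  invariant function with the same restriction to \<open>Z\<close> (\<open>normalizer_average\<close>). The average is taken with
  respect to a right invariant mean on the continuous functions on \<open>G\<close>, obtained as
  the limit of iterated averages over a dense sequence (\<open>avg_iter_tendsto\<close>); it is smooth
  because such functionals may be interchanged with differentiation in parameters
  (\<open>Ck_mean\<close>).
\<close>

section \<open>Calculus of iterated derivatives\<close>

text \<open>
  The model spaces are real inner product spaces spanned by a finite set. They need not be instances
  of class \<open>euclidean_space\<close>, which excludes dimension zero, so an orthonormal basis is carried along
  as a set.
\<close>

definition onb :: "'a::real_inner set \<Rightarrow> bool" where
  "onb B \<longleftrightarrow> finite B \<and> (\<forall>b\<in>B. \<forall>c\<in>B. b \<bullet> c = (if b = c then 1 else 0)) \<and>
     (\<forall>x. x = (\<Sum>b\<in>B. (x \<bullet> b) *\<^sub>R b))"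

lemma onb_exists:
  fixes B0 :: "'a::real_inner set"
  assumes "finite B0" "span B0 = UNIV"
  obtains B :: "'a set" where "onb B"
proof -
  obtain C where C: "finite C" "span C = span B0" "pairwise orthogonal C"
    using basis_orthogonal[OF assms(1)] by blast
  define B where "B = (\<lambda>c. c /\<^sub>R norm c) ` (C - {0})"
  have fin: "finite B" unfolding B_def using C(1) by simp
  have sp: "span B = UNIV"
  proof -
    have "C - {0} \<subseteq> span B"
    proof
      fix c assume c: "c \<in> C - {0}"
      have "norm c *\<^sub>R (c /\<^sub>R norm c) \<in> span B"
        by (rule span_scale, rule span_base) (use c B_def in auto)
      then show "c \<in> span B" using c by simp
    qed
    then have "span (C - {0}) \<subseteq> span B" by (rule span_minimal) (rule subspace_span)
    then show ?thesis using C(2) assms(2) by (simp add: span_delete_0 top.extremum_uniqueI)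
  qed
  have orth: "b \<bullet> c = (if b = c then 1 else 0)" if "b \<in> B" "c \<in> B" for b c
  proof -
    from \<open>b \<in> B\<close> obtain b' where b': "b' \<in> C" "b' \<noteq> 0" "b = b' /\<^sub>R norm b'"
      unfolding B_def by blast
    from \<open>c \<in> B\<close> obtain c' where c': "c' \<in> C" "c' \<noteq> 0" "c = c' /\<^sub>R norm c'"
      unfolding B_def by blast
    show ?thesis
    proof (cases "b' = c'")
      case True
      then show ?thesis using b' c' by (simp add: dot_square_norm power2_eq_square)
    next
      case False
      then have "b' \<bullet> c' = 0" using C(3) b' c' by (auto simp: pairwise_def orthogonal_def)
      then have 0: "b \<bullet> c = 0" using b' c' by simp
      have "c \<bullet> c = 1" using c' by (simp add: dot_square_norm power2_eq_square)
      then have "b \<noteq> c" using 0 by auto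
      then show ?thesis using 0 by simp
    qed
  qed
  have "x = (\<Sum>b\<in>B. (x \<bullet> b) *\<^sub>R b)" for x
  proof -
    have "x \<in> span B" using sp by simp
    then obtain u where u: "x = (\<Sum>b\<in>B. u b *\<^sub>R b)"
      using fin by (auto simp: span_finite)
    have "x \<bullet> c = u c" if c: "c \<in> B" for c
    proof -
      have "x \<bullet> c = (\<Sum>b\<in>B. u b * (b \<bullet> c))" unfolding u by (simp add: inner_sum_left)
      also have "\<dots> = (\<Sum>b\<in>B. if b = c then u b else 0)"
        by (rule sum.cong) (use orth c in auto)
      also have "\<dots> = u c" using fin c by simp
      finally show ?thesis .
    qed
    then show ?thesis using u by simp
  qed
  then have "onb B" unfolding onb_def using fin orth by blast
  then show thesis by (rule that)
qed

lemma onb_finite: "onb B \<Longrightarrow> finite B"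
  unfolding onb_def by blast

lemma onb_expand: "onb B \<Longrightarrow> x = (\<Sum>b\<in>B. (x \<bullet> b) *\<^sub>R b)"
  unfolding onb_def by blast

lemma onb_inner: "onb B \<Longrightarrow> b \<in> B \<Longrightarrow> c \<in> B \<Longrightarrow> b \<bullet> c = (if b = c then 1 else 0)"
  unfolding onb_def by blast

lemma onb_norm: "onb B \<Longrightarrow> b \<in> B \<Longrightarrow> norm b = 1"
  by (simp add: onb_inner norm_eq_sqrt_inner)

lemma onb_linear_expand:
  assumes "onb B" "linear f"
  shows "f x = (\<Sum>b\<in>B. (x \<bullet> b) *\<^sub>R f b)"
proof -
  have "f x = f (\<Sum>b\<in>B. (x \<bullet> b) *\<^sub>R b)" using onb_expand[OF assms(1), of x] by simp
  also have "\<dots> = (\<Sum>b\<in>B. (x \<bullet> b) *\<^sub>R f b)"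
    by (simp add: linear_sum[OF assms(2)] linear_scale[OF assms(2)])
  finally show ?thesis .
qed

text \<open>
  Makes operator norms accessible through finitely many directional derivatives, whose
  continuity is what \<open>Ck_on\<close> provides.
\<close>

lemma onb_norm_linear_le:
  assumes "onb B" "linear f" "\<And>b. b \<in> B \<Longrightarrow> norm (f b) \<le> e"
  shows "norm (f x) \<le> real (card B) * e * norm x"
proof -
  have "norm (f x) = norm (\<Sum>b\<in>B. (x \<bullet> b) *\<^sub>R f b)"
    using onb_linear_expand[OF assms(1,2), of x] by simp
  also have "\<dots> \<le> (\<Sum>b\<in>B. norm x * e)"
  proof (rule sum_norm_le)
    fix b assume b: "b \<in> B"
    have "\<bar>x \<bullet> b\<bar> \<le> norm x" using Cauchy_Schwarz_ineq2[of x b] onb_norm[OF assms(1) b] by simp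
    then show "norm ((x \<bullet> b) *\<^sub>R f b) \<le> norm x * e"
      using assms(3)[OF b] by (simp add: mult_mono)
  qed
  finally show ?thesis by (simp add: mult_ac)
qed

lemma onb_prod:
  assumes "onb B" "onb C"
  shows "onb ((\<lambda>b. (b, 0)) ` B \<union> Pair 0 ` C)"
proof -
  have nz: "b \<noteq> 0" if "b \<in> B" for b using onb_norm[OF assms(1) that] by auto
  have disj: "(\<lambda>b. (b, 0)) ` B \<inter> Pair 0 ` C = {}" using nz by auto
  have "x = (\<Sum>b\<in>(\<lambda>b. (b, 0)) ` B \<union> Pair 0 ` C. (x \<bullet> b) *\<^sub>R b)" for x :: "'a \<times> 'b"
  proof -
    have "(\<Sum>b\<in>(\<lambda>b. (b, 0)) ` B \<union> Pair 0 ` C. (x \<bullet> b) *\<^sub>R b)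
       = (\<Sum>b\<in>B. (x \<bullet> (b, 0)) *\<^sub>R (b, 0)) + (\<Sum>c\<in>C. (x \<bullet> (0, c)) *\<^sub>R (0, c))"
      using disj onb_finite[OF assms(1)] onb_finite[OF assms(2)]
      by (subst sum.union_disjoint) (auto simp: sum.reindex inj_on_def)
    also have "\<dots> = (\<Sum>b\<in>B. (fst x \<bullet> b) *\<^sub>R b, \<Sum>c\<in>C. (snd x \<bullet> c) *\<^sub>R c)"
      by (simp add: inner_prod_def prod_eq_iff fst_sum snd_sum)
    also have "\<dots> = x"
      using onb_expand[OF assms(1), of "fst x"] onb_expand[OF assms(2), of "snd x"] by simp
    finally show ?thesis by simp
  qed
  moreover have "b \<bullet> c = (if b = c then 1 else 0)"
    if "b \<in> (\<lambda>b. (b, 0)) ` B \<union> Pair 0 ` C" "c \<in> (\<lambda>b. (b, 0)) ` B \<union> Pair 0 ` C" for b c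
    using that nz by (auto simp: inner_prod_def onb_inner[OF assms(1)] onb_inner[OF assms(2)] split: if_splits)
  ultimately show ?thesis
    using onb_finite[OF assms(1)] onb_finite[OF assms(2)] unfolding onb_def by blast
qed

lemma onb_real: "onb {1::real}"
  unfolding onb_def by (intro conjI ballI allI) simp_all

lemma frechet_derivative_cong_open:
  assumes "open U" "x \<in> U" "\<And>y. y \<in> U \<Longrightarrow> f y = g y"
  shows "frechet_derivative f (at x) = frechet_derivative g (at x)"
proof -
  have "(f has_derivative D) (at x) \<longleftrightarrow> (g has_derivative D) (at x)" for D
    using assms has_derivative_transform_within_open[of f D x UNIV U g]
      has_derivative_transform_within_open[of g D x UNIV U f] by auto
  then show ?thesis unfolding frechet_derivative_def by simp
qed

lemma Ck_cong:
  assumes "open U" "\<And>x. x \<in> U \<Longrightarrow> f x = g x"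
  shows "Ck_on k f U \<longleftrightarrow> Ck_on k g U"
  using assms(2)
proof (induction k arbitrary: f g)
  case 0
  then show ?case by (auto intro: continuous_on_cong)
next
  case (Suc k)
  have d: "f differentiable (at x) \<longleftrightarrow> g differentiable (at x)" if "x \<in> U" for x
    unfolding differentiable_def
    using assms(1) that Suc.prems has_derivative_transform_within_open[of f _ x UNIV U g]
      has_derivative_transform_within_open[of g _ x UNIV U f] by metis
  have "Ck_on k (\<lambda>x. frechet_derivative f (at x) v) U \<longleftrightarrow>
        Ck_on k (\<lambda>x. frechet_derivative g (at x) v) U" for v
    by (rule Suc.IH) (metis frechet_derivative_cong_open assms(1) Suc.prems)
  then show ?case using d by simp
qed

lemma Ck_SucI:
  assumes "open U" "\<And>x. x \<in> U \<Longrightarrow> (f has_derivative f' x) (at x)"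
    "\<And>v. Ck_on k (\<lambda>x. f' x v) U"
  shows "Ck_on (Suc k) f U"
proof -
  have "Ck_on k (\<lambda>x. frechet_derivative f (at x) v) U" for v
    using Ck_cong[OF assms(1), of "\<lambda>x. frechet_derivative f (at x) v" "\<lambda>x. f' x v" k]
      assms(2,3) frechet_derivative_at by metis
  then show ?thesis using assms(2) by (auto simp: differentiable_def)
qed

lemma Ck_Suc_has_derivative:
  "Ck_on (Suc k) f U \<Longrightarrow> x \<in> U \<Longrightarrow> (f has_derivative frechet_derivative f (at x)) (at x)"
  by (simp add: frechet_derivative_works)

lemma Ck_Suc_derivative:
  "Ck_on (Suc k) f U \<Longrightarrow> Ck_on k (\<lambda>x. frechet_derivative f (at x) v) U"
  by simp

lemma Ck_continuous: "Ck_on k f U \<Longrightarrow> continuous_on U f"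
  by (cases k) (auto intro!: continuous_at_imp_continuous_on differentiable_imp_continuous_within)

lemma Ck_Suc_D: "Ck_on (Suc k) f U \<Longrightarrow> Ck_on k f U"
proof (induction k arbitrary: f)
  case 0
  then show ?case using Ck_continuous[of "Suc 0" f U] by simp
next
  case (Suc k)
  have "Ck_on k (\<lambda>x. frechet_derivative f (at x) v) U" for v
    by (rule Suc.IH) (use Suc.prems in auto)
  then show ?case using Suc.prems by auto
qed

lemma Ck_subset: "Ck_on k f U \<Longrightarrow> V \<subseteq> U \<Longrightarrow> Ck_on k f V"
  by (induction k arbitrary: f) (auto intro: continuous_on_subset)

text \<open>
  Lets smoothness be checked in a neighbourhood of each point, each time in the charts that fit.
\<close>

lemma Ck_local:
  assumes "\<And>x. x \<in> U \<Longrightarrow> \<exists>V. open V \<and> x \<in> V \<and> Ck_on k f V"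
  shows "Ck_on k f U"
  using assms
proof (induction k arbitrary: f)
  case 0
  show ?case unfolding Ck_on.simps
  proof (rule continuous_at_imp_continuous_on, rule ballI)
    fix x assume "x \<in> U"
    then obtain V where "open V" "x \<in> V" "continuous_on V f" using 0[of x] by auto
    then show "isCont f x" by (simp add: continuous_on_eq_continuous_at)
  qed
next
  case (Suc k)
  have "Ck_on k (\<lambda>x. frechet_derivative f (at x) v) U" for v
  proof (rule Suc.IH)
    fix x assume "x \<in> U"
    then show "\<exists>V. open V \<and> x \<in> V \<and> Ck_on k (\<lambda>x. frechet_derivative f (at x) v) V"
      using Suc.prems[of x] by auto
  qed
  moreover have "f differentiable (at x)" if "x \<in> U" for x
    using Suc.prems[OF that] by auto
  ultimately show ?case by simp
qed

lemma Ck_const: "Ck_on k (\<lambda>x. c) U"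
  by (induction k arbitrary: c) auto

lemma Ck_bounded_linear:
  assumes "open U" "bounded_linear f"
  shows "Ck_on k f U"
proof (cases k)
  case 0
  then show ?thesis using assms by (simp add: linear_continuous_on)
next
  case (Suc n)
  show ?thesis unfolding Suc
    by (rule Ck_SucI[OF assms(1)]) (auto intro: bounded_linear_imp_has_derivative assms(2) Ck_const)
qed

lemma Ck_compose_bounded_linear:
  assumes "open U" "bounded_linear h" "Ck_on k f U"
  shows "Ck_on k (\<lambda>x. h (f x)) U"
  using assms(3)
proof (induction k arbitrary: f)
  case 0
  then show ?case using assms(2) bounded_linear.continuous_on by force
next
  case (Suc k)
  show ?case
    by (rule Ck_SucI[OF assms(1) bounded_linear.has_derivative[OF assms(2) Ck_Suc_has_derivative[OF Suc.prems]]])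
      (use Suc in auto)
qed

lemma Ck_add:
  assumes "open U" "Ck_on k f U" "Ck_on k g U"
  shows "Ck_on k (\<lambda>x. f x + g x) U"
  using assms(2,3)
proof (induction k arbitrary: f g)
  case 0
  then show ?case by (simp add: continuous_on_add)
next
  case (Suc k)
  show ?case
    by (rule Ck_SucI[OF assms(1) has_derivative_add[OF Ck_Suc_has_derivative[OF Suc.prems(1)] Ck_Suc_has_derivative[OF Suc.prems(2)]]])
      (use Suc in auto)
qed

lemma Ck_sum:
  assumes "open U" "\<And>i. i \<in> I \<Longrightarrow> Ck_on k (f i) U"
  shows "Ck_on k (\<lambda>x. \<Sum>i\<in>I. f i x) U"
  using assms(2)
  by (induction I rule: infinite_finite_induct) (auto intro: Ck_const Ck_add[OF assms(1)])

lemma Ck_scaleR: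
  fixes a :: "'a::real_normed_vector \<Rightarrow> real"
  assumes "open U" "Ck_on k a U" "Ck_on k g U"
  shows "Ck_on k (\<lambda>x. a x *\<^sub>R g x) U"
  using assms(2,3)
proof (induction k arbitrary: a g)
  case 0
  then show ?case by (simp add: continuous_on_scaleR)
next
  case (Suc k)
  show ?case
    by (rule Ck_SucI[OF assms(1) has_derivative_scaleR[OF Ck_Suc_has_derivative[OF Suc.prems(1)] Ck_Suc_has_derivative[OF Suc.prems(2)]]])
      (auto intro!: Ck_add[OF assms(1)] Suc.IH Ck_Suc_D[OF Suc.prems(1)] Ck_Suc_D[OF Suc.prems(2)]
        Ck_Suc_derivative[OF Suc.prems(1)] Ck_Suc_derivative[OF Suc.prems(2)])
qed

lemmas Ck_mult = Ck_scaleR[where ?'b = real, unfolded real_scaleR_def]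

lemma Ck_diff:
  assumes "open U" "Ck_on k f U" "Ck_on k g U"
  shows "Ck_on k (\<lambda>x. f x - g x) U"
  using Ck_add[OF assms(1,2) Ck_scaleR[OF assms(1) Ck_const[of k "-1"] assms(3)]] by simp

text \<open>
  The chain rule gives \<open>D(g \<circ> f) v = Dg (Df v)\<close>, whose direction \<open>Df v\<close> depends on the point.
  Expanding it in the orthonormal basis leaves products of components of \<open>Df v\<close> with fixed
  directional derivatives of \<open>g\<close> composed with \<open>f\<close>, to which the induction hypothesis applies.
\<close>

lemma Ck_compose:
  fixes f :: "'a::real_normed_vector \<Rightarrow> 'b::real_inner" and B :: "'b set"
  assumes B: "onb B" and U: "open U" and V: "open V" and sub: "f ` U \<subseteq> V"
    and f: "Ck_on k f U" and g: "Ck_on k g V"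
  shows "Ck_on k (\<lambda>x. g (f x)) U"
  using f g
proof (induction k arbitrary: g)
  case 0
  then show ?case using sub by (auto intro: continuous_on_compose2)
next
  case (Suc k)
  have df: "x \<in> U \<Longrightarrow> (f has_derivative frechet_derivative f (at x)) (at x)" for x
    using Ck_Suc_has_derivative[OF Suc.prems(1)] .
  have dg: "x \<in> U \<Longrightarrow> (g has_derivative frechet_derivative g (at (f x))) (at (f x))" for x
    using Ck_Suc_has_derivative[OF Suc.prems(2)] sub by blast
  show ?case
  proof (rule Ck_SucI[OF U has_derivative_compose[OF df dg]])
    fix v
    have eq: "frechet_derivative g (at (f x)) (frechet_derivative f (at x) v) =
       (\<Sum>b\<in>B. (frechet_derivative f (at x) v \<bullet> b) *\<^sub>R frechet_derivative g (at (f x)) b)"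
      if "x \<in> U" for x
      by (rule onb_linear_expand[OF B has_derivative_linear[OF dg[OF that]]])
    have "Ck_on k (\<lambda>x. \<Sum>b\<in>B. (frechet_derivative f (at x) v \<bullet> b) *\<^sub>R frechet_derivative g (at (f x)) b) U"
    proof (rule Ck_sum[OF U], rule Ck_scaleR[OF U])
      fix b assume "b \<in> B"
      show "Ck_on k (\<lambda>x. frechet_derivative f (at x) v \<bullet> b) U"
        by (rule Ck_compose_bounded_linear[OF U bounded_linear_inner_left])
          (use Suc.prems in auto)
      show "Ck_on k (\<lambda>x. frechet_derivative g (at (f x)) b) U"
        by (rule Suc.IH) (use Suc.prems Ck_Suc_D in auto)
    qed
    then show "Ck_on k (\<lambda>x. frechet_derivative g (at (f x)) (frechet_derivative f (at x) v)) U"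
      by (subst Ck_cong[OF U eq]) auto
  qed
qed

lemma Ck_Pair_const:
  assumes "open U"
  shows "Ck_on k (\<lambda>x. (x, c)) U" "Ck_on k (\<lambda>x. (c, x)) U"
proof -
  have "Ck_on k (\<lambda>x. (x, 0) + (0, c)) U"
    by (rule Ck_add[OF assms Ck_bounded_linear[OF assms] Ck_const])
      (auto intro!: bounded_linear_Pair bounded_linear_ident bounded_linear_zero)
  then show "Ck_on k (\<lambda>x. (x, c)) U" by simp
  have "Ck_on k (\<lambda>x. (0, x) + (c, 0)) U"
    by (rule Ck_add[OF assms Ck_bounded_linear[OF assms] Ck_const])
      (auto intro!: bounded_linear_Pair bounded_linear_ident bounded_linear_zero)
  then show "Ck_on k (\<lambda>x. (c, x)) U" by simp
qed

section \<open>Smooth functions on manifolds\<close>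

lemma chartD:
  assumes "is_chart (U, \<phi>)"
  shows "open U" "open (\<phi> ` U)" "inj_on \<phi> U" "continuous_on U \<phi>"
    "continuous_on (\<phi> ` U) (inv_into U \<phi>)"
proof -
  have h: "open U" "open (\<phi> ` U)" "homeomorphism U (\<phi> ` U) \<phi> (inv_into U \<phi>)"
    using assms by (auto simp: is_chart_def)
  then show "open U" "open (\<phi> ` U)" "continuous_on U \<phi>" "continuous_on (\<phi> ` U) (inv_into U \<phi>)"
    by (auto simp: homeomorphism_def)
  show "inj_on \<phi> U"
    using h(3) by (metis homeomorphism_apply1 inj_on_inverseI)
qed

lemma chart_open_image:
  assumes "is_chart (U, \<phi>)" "open W" "W \<subseteq> U"
  shows "open (\<phi> ` W)"
proof -
  have "\<phi> ` W = \<phi> ` U \<inter> inv_into U \<phi> -` W"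
    using assms(3) chartD(3)[OF assms(1)] by (auto simp: inv_into_f_f image_iff subset_iff)
  then show ?thesis
    using continuous_openin_preimage_gen[OF chartD(5)[OF assms(1)] assms(2)]
      openin_open_eq[OF chartD(2)[OF assms(1)]] by simp
qed

lemma chart_open_preimage:
  assumes "is_chart (U, \<phi>)" "open W"
  shows "open (U \<inter> \<phi> -` W)"
  using continuous_openin_preimage_gen[OF chartD(4)[OF assms(1)] assms(2)]
    openin_open_eq[OF chartD(1)[OF assms(1)]] by simp

lemma is_chart_prod:
  assumes "is_chart (U, \<phi>)" "is_chart (V, \<psi>)"
  shows "is_chart (U \<times> V, map_prod \<phi> \<psi>)"
    and "\<And>a b. a \<in> \<phi> ` U \<Longrightarrow> b \<in> \<psi> ` V \<Longrightarrow>
      inv_into (U \<times> V) (map_prod \<phi> \<psi>) (a, b) = (inv_into U \<phi> a, inv_into V \<psi> b)"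
proof -
  note c = chartD[OF assms(1)] and d = chartD[OF assms(2)]
  have inj: "inj_on (map_prod \<phi> \<psi>) (U \<times> V)"
    using c(3) d(3) by (auto simp: inj_on_def)
  have im: "map_prod \<phi> \<psi> ` (U \<times> V) = \<phi> ` U \<times> \<psi> ` V" by auto
  show inv: "inv_into (U \<times> V) (map_prod \<phi> \<psi>) (a, b) = (inv_into U \<phi> a, inv_into V \<psi> b)"
    if "a \<in> \<phi> ` U" "b \<in> \<psi> ` V" for a b
    by (rule inv_into_f_eq[OF inj]) (use that in \<open>auto simp: inv_into_into f_inv_into_f\<close>)
  have "continuous_on (\<phi> ` U \<times> \<psi> ` V) (\<lambda>p. (inv_into U \<phi> (fst p), inv_into V \<psi> (snd p)))"
    by (intro continuous_on_Pair continuous_on_compose2[OF c(5)] continuous_on_compose2[OF d(5)]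
        continuous_on_fst continuous_on_snd continuous_on_id) auto
  then have ci: "continuous_on (\<phi> ` U \<times> \<psi> ` V) (inv_into (U \<times> V) (map_prod \<phi> \<psi>))"
    by (rule continuous_on_eq) (auto simp: inv)
  have "continuous_on (U \<times> V) (\<lambda>p. (\<phi> (fst p), \<psi> (snd p)))"
    by (intro continuous_on_Pair continuous_on_compose2[OF c(4)] continuous_on_compose2[OF d(4)]
        continuous_on_fst continuous_on_snd continuous_on_id) auto
  then have cm: "continuous_on (U \<times> V) (map_prod \<phi> \<psi>)"
    by (rule continuous_on_eq) auto
  have "homeomorphism (U \<times> V) (\<phi> ` U \<times> \<psi> ` V) (map_prod \<phi> \<psi>) (inv_into (U \<times> V) (map_prod \<phi> \<psi>))"
    unfolding homeomorphism_def
    using cm ci im inv_into_image_cancel[OF inj order_refl] inv_into_f_f[OF inj]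
      f_inv_into_f[of _ "map_prod \<phi> \<psi>" "U \<times> V"] by simp
  then show "is_chart (U \<times> V, map_prod \<phi> \<psi>)"
    using c d im by (simp add: is_chart_def open_Times)
qed

lemma smooth_manifold_onb:
  fixes A :: "('m::{t2_space, second_countable_topology}, 'e::real_inner) chart set"
  assumes "smooth_manifold A"
  obtains B :: "'e set" where "onb B"
proof -
  from assms obtain S :: "'e set" where "finite S" "span S = UNIV"
    unfolding smooth_manifold_def by blast
  then show thesis using onb_exists that by blast
qed

lemma smooth_manifold_chart: "smooth_manifold A \<Longrightarrow> (U, \<phi>) \<in> A \<Longrightarrow> is_chart (U, \<phi>)"
  unfolding smooth_manifold_def by blast

lemma smooth_manifold_chart_at:
  assumes "smooth_manifold A"
  obtains U \<phi> where "(U, \<phi>) \<in> A" "x \<in> U"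
  using assms unfolding smooth_manifold_def by blast

lemma smooth_manifold_transition:
  assumes "smooth_manifold A" "(U, \<phi>) \<in> A" "(V, \<psi>) \<in> A"
  shows "Ck_on k (\<psi> \<circ> inv_into U \<phi>) (\<phi> ` (U \<inter> V))"
  using assms unfolding smooth_manifold_def smooth_on_def by blast

lemma smooth_functionsD:
  "f \<in> smooth_functions A \<Longrightarrow> continuous_on UNIV f"
  "f \<in> smooth_functions A \<Longrightarrow> (U, \<phi>) \<in> A \<Longrightarrow> Ck_on k (f \<circ> inv_into U \<phi>) (\<phi> ` U)"
  unfolding smooth_functions_def smooth_map_def smooth_on_def by fastforce+

lemma smooth_functionsI:
  assumes "continuous_on UNIV f"
    "\<And>U \<phi> k. (U, \<phi>) \<in> A \<Longrightarrow> Ck_on k (f \<circ> inv_into U \<phi>) (\<phi> ` U)"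
  shows "f \<in> smooth_functions A"
  using assms unfolding smooth_functions_def smooth_map_def smooth_on_def by auto

lemma continuous_from_charts:
  assumes "smooth_manifold A"
    "\<And>U \<phi>. (U, \<phi>) \<in> A \<Longrightarrow> continuous_on (\<phi> ` U) (f \<circ> inv_into U \<phi>)"
  shows "continuous_on UNIV f"
proof (rule continuous_at_imp_continuous_on, rule ballI)
  fix x
  obtain U \<phi> where c: "(U, \<phi>) \<in> A" "x \<in> U" by (rule smooth_manifold_chart_at[OF assms(1)])
  note ch = chartD[OF smooth_manifold_chart[OF assms(1) c(1)]]
  have "continuous_on U (\<lambda>y. (f \<circ> inv_into U \<phi>) (\<phi> y))"
    by (rule continuous_on_compose2[OF assms(2)[OF c(1)] ch(4)]) simp
  then have "continuous_on U f"
    by (rule continuous_on_eq) (simp add: inv_into_f_f[OF ch(3)])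
  then show "isCont f x" using c ch(1) by (simp add: continuous_on_eq_continuous_at)
qed

lemma smooth_functionsI_charts:
  assumes "smooth_manifold A"
    "\<And>U \<phi> k. (U, \<phi>) \<in> A \<Longrightarrow> Ck_on k (f \<circ> inv_into U \<phi>) (\<phi> ` U)"
  shows "f \<in> smooth_functions A"
  by (rule smooth_functionsI[OF continuous_from_charts[OF assms(1) Ck_continuous[OF assms(2)]] assms(2)])

lemma smooth_functions_const:
  "smooth_manifold A \<Longrightarrow> (\<lambda>x. c) \<in> smooth_functions A"
  by (rule smooth_functionsI_charts) (auto simp: o_def Ck_const)

lemma smooth_functions_add:
  assumes "smooth_manifold A" "f \<in> smooth_functions A" "g \<in> smooth_functions A"
  shows "(\<lambda>x. f x + g x) \<in> smooth_functions A"
proof (rule smooth_functionsI_charts[OF assms(1)])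
  fix U \<phi> k assume c: "(U, \<phi>) \<in> A"
  show "Ck_on k ((\<lambda>x. f x + g x) \<circ> inv_into U \<phi>) (\<phi> ` U)"
    using Ck_add[OF chartD(2)[OF smooth_manifold_chart[OF assms(1) c]]
        smooth_functionsD(2)[OF assms(2) c] smooth_functionsD(2)[OF assms(3) c]] by (simp add: o_def)
qed

lemma smooth_functions_mult:
  assumes "smooth_manifold A" "f \<in> smooth_functions A" "g \<in> smooth_functions A"
  shows "(\<lambda>x. f x * g x) \<in> smooth_functions A"
proof (rule smooth_functionsI_charts[OF assms(1)])
  fix U \<phi> k assume c: "(U, \<phi>) \<in> A"
  show "Ck_on k ((\<lambda>x. f x * g x) \<circ> inv_into U \<phi>) (\<phi> ` U)"
    using Ck_mult[OF chartD(2)[OF smooth_manifold_chart[OF assms(1) c]]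
        smooth_functionsD(2)[OF assms(2) c] smooth_functionsD(2)[OF assms(3) c]] by (simp add: o_def)
qed

lemma smooth_functions_scale:
  assumes "smooth_manifold A" "f \<in> smooth_functions A"
  shows "(\<lambda>x. c * f x) \<in> smooth_functions A"
  by (rule smooth_functions_mult[OF assms(1) smooth_functions_const[OF assms(1)] assms(2)])

lemma smooth_functions_compose:
  fixes B :: "('n::{t2_space, second_countable_topology}, 'f::real_inner) chart set"
  assumes F: "smooth_map A B F" and A: "\<And>U \<phi>. (U, \<phi>) \<in> A \<Longrightarrow> is_chart (U, \<phi>)"
    and B: "smooth_manifold B" and f: "f \<in> smooth_functions B"
  shows "(\<lambda>x. f (F x)) \<in> smooth_functions A"
proof (rule smooth_functionsI)
  have cF: "continuous_on UNIV F" using F by (simp add: smooth_map_def)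
  show "continuous_on UNIV (\<lambda>x. f (F x))"
    by (rule continuous_on_compose2[OF smooth_functionsD(1)[OF f] cF]) simp
  fix U \<phi> k assume c: "(U, \<phi>) \<in> A"
  note ch = chartD[OF A[OF c]]
  obtain E :: "'f set" where E: "onb E" by (rule smooth_manifold_onb[OF B])
  show "Ck_on k ((\<lambda>x. f (F x)) \<circ> inv_into U \<phi>) (\<phi> ` U)"
  proof (rule Ck_local)
    fix y assume "y \<in> \<phi> ` U"
    then obtain p where p: "p \<in> U" "y = \<phi> p" by auto
    obtain V \<psi> where d: "(V, \<psi>) \<in> B" "F p \<in> V" by (rule smooth_manifold_chart_at[OF B])
    note dh = chartD[OF smooth_manifold_chart[OF B d(1)]]
    define W where "W = \<phi> ` (U \<inter> F -` V)"
    have oF: "open (F -` V)" using cF dh(1) by (simp add: continuous_on_open_vimage[OF open_UNIV])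
    have oW: "open W" unfolding W_def
      by (rule chart_open_image[OF A[OF c]]) (use ch(1) oF in auto)
    have 1: "Ck_on k (\<psi> \<circ> F \<circ> inv_into U \<phi>) W"
      using F c d unfolding smooth_map_def smooth_on_def W_def by blast
    have 2: "Ck_on k (\<lambda>y. (f \<circ> inv_into V \<psi>) ((\<psi> \<circ> F \<circ> inv_into U \<phi>) y)) W"
      by (rule Ck_compose[OF E oW dh(2) _ 1 smooth_functionsD(2)[OF f d(1)]])
        (auto simp: W_def inv_into_f_f[OF ch(3)])
    have "Ck_on k ((\<lambda>x. f (F x)) \<circ> inv_into U \<phi>) W"
      by (rule iffD1[OF Ck_cong[OF oW] 2])
        (auto simp: W_def inv_into_f_f[OF ch(3)] inv_into_f_f[OF dh(3)])
    then show "\<exists>V. open V \<and> y \<in> V \<and> Ck_on k ((\<lambda>x. f (F x)) \<circ> inv_into U \<phi>) V"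
      using oW p d(2) unfolding W_def by blast
  qed
qed

lemma prod_atlas_chart:
  assumes "smooth_manifold A" "smooth_manifold B" "(W, \<theta>) \<in> prod_atlas A B"
  shows "is_chart (W, \<theta>)"
proof -
  from assms(3) obtain U \<phi> V \<psi> where "(U, \<phi>) \<in> A" "(V, \<psi>) \<in> B"
    "W = U \<times> V" "\<theta> = map_prod \<phi> \<psi>"
    unfolding prod_atlas_def by blast
  then show ?thesis using assms(1,2) by (simp add: is_chart_prod(1) smooth_manifold_chart)
qed

text \<open>
  In product charts the inverse of the chart map is a pair of inverses, which turns smoothness on a
  product manifold into joint smoothness in both coordinates.
\<close>

lemma smooth_prod_local:
  assumes A: "smooth_manifold A" and B: "smooth_manifold B"
    and K: "K \<in> smooth_functions (prod_atlas A B)"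
    and c: "(U, \<phi>) \<in> A" and d: "(V, \<psi>) \<in> B"
  shows "Ck_on k (\<lambda>p. K (inv_into U \<phi> (fst p), inv_into V \<psi> (snd p))) (\<phi> ` U \<times> \<psi> ` V)"
proof -
  note ch = smooth_manifold_chart[OF A c] smooth_manifold_chart[OF B d]
  have "(U \<times> V, map_prod \<phi> \<psi>) \<in> prod_atlas A B" using c d unfolding prod_atlas_def by blast
  then have *: "Ck_on k (K \<circ> inv_into (U \<times> V) (map_prod \<phi> \<psi>)) (map_prod \<phi> \<psi> ` (U \<times> V))"
    by (rule smooth_functionsD(2)[OF K])
  have im: "map_prod \<phi> \<psi> ` (U \<times> V) = \<phi> ` U \<times> \<psi> ` V" by auto
  show ?thesis
    by (rule iffD1[OF Ck_cong *[unfolded im]])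
      (auto simp: is_chart_prod(2)[OF ch] intro!: open_Times chartD(2)[OF ch(1)] chartD(2)[OF ch(2)])
qed

lemma smooth_functions_slice:
  fixes A :: "('m::{t2_space, second_countable_topology}, 'e::real_inner) chart set"
    and B :: "('n::{t2_space, second_countable_topology}, 'f::real_inner) chart set"
  assumes A: "smooth_manifold A" and B: "smooth_manifold B"
    and K: "K \<in> smooth_functions (prod_atlas A B)"
  shows "(\<lambda>x. K (x, y)) \<in> smooth_functions A" "(\<lambda>y. K (x, y)) \<in> smooth_functions B"
proof -
  obtain E :: "'e set" where E: "onb E" by (rule smooth_manifold_onb[OF A])
  obtain E' :: "'f set" where E': "onb E'" by (rule smooth_manifold_onb[OF B])
  note onb = onb_prod[OF E E']
  show "(\<lambda>x. K (x, y)) \<in> smooth_functions A"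
  proof (rule smooth_functionsI_charts[OF A])
    fix U \<phi> k assume c: "(U, \<phi>) \<in> A"
    obtain V \<psi> where d: "(V, \<psi>) \<in> B" "y \<in> V" by (rule smooth_manifold_chart_at[OF B])
    note ch = chartD[OF smooth_manifold_chart[OF A c]] and dh = chartD[OF smooth_manifold_chart[OF B d(1)]]
    have "Ck_on k (\<lambda>a. K (inv_into U \<phi> (fst (a, \<psi> y)), inv_into V \<psi> (snd (a, \<psi> y)))) (\<phi> ` U)"
      by (rule Ck_compose[OF onb ch(2) _ _ Ck_Pair_const(1)[OF ch(2)] smooth_prod_local[OF A B K c d(1)]])
        (use d ch dh in \<open>auto intro: open_Times\<close>)
    then show "Ck_on k ((\<lambda>x. K (x, y)) \<circ> inv_into U \<phi>) (\<phi> ` U)"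
      using d dh by (simp add: o_def inv_into_f_f)
  qed
  show "(\<lambda>y. K (x, y)) \<in> smooth_functions B"
  proof (rule smooth_functionsI_charts[OF B])
    fix V \<psi> k assume d: "(V, \<psi>) \<in> B"
    obtain U \<phi> where c: "(U, \<phi>) \<in> A" "x \<in> U" by (rule smooth_manifold_chart_at[OF A])
    note ch = chartD[OF smooth_manifold_chart[OF A c(1)]] and dh = chartD[OF smooth_manifold_chart[OF B d]]
    have "Ck_on k (\<lambda>b. K (inv_into U \<phi> (fst (\<phi> x, b)), inv_into V \<psi> (snd (\<phi> x, b)))) (\<psi> ` V)"
      by (rule Ck_compose[OF onb dh(2) _ _ Ck_Pair_const(2)[OF dh(2)] smooth_prod_local[OF A B K c(1) d]])
        (use c ch dh in \<open>auto intro: open_Times\<close>)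
    then show "Ck_on k ((\<lambda>y. K (x, y)) \<circ> inv_into V \<psi>) (\<psi> ` V)"
      using c ch by (simp add: o_def inv_into_f_f)
  qed
qed

text \<open>
  The compact set \<open>C\<close> pulls back to a compact subset of the manifold, which is closed because the
  manifold is Hausdorff. Its complement and the chart domain are therefore two open sets that cover
  the manifold, and on each of them the extension is smooth.
\<close>

lemma smooth_extension_by_zero:
  fixes A :: "('m::{t2_space, second_countable_topology}, 'e::real_inner) chart set"
  assumes A: "smooth_manifold A" and c: "(U, \<phi>) \<in> A"
    and O: "open O'" "O' \<subseteq> \<phi> ` U" and g: "\<And>k. Ck_on k g O'"
    and C: "compact C" "C \<subseteq> O'" and 0: "\<And>y. y \<in> O' \<Longrightarrow> y \<notin> C \<Longrightarrow> g y = (0::real)"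
  shows "(\<lambda>x. if x \<in> U \<and> \<phi> x \<in> O' then g (\<phi> x) else 0) \<in> smooth_functions A" (is "?f \<in> _")
proof (rule smooth_functionsI_charts[OF A])
  obtain E :: "'e set" where E: "onb E" by (rule smooth_manifold_onb[OF A])
  note ch = chartD[OF smooth_manifold_chart[OF A c]]
  define K where "K = inv_into U \<phi> ` C"
  have "compact K" unfolding K_def
    by (rule compact_continuous_image[OF continuous_on_subset[OF ch(5)] C(1)]) (use C O in auto)
  then have clK: "closed K" by (rule compact_imp_closed)
  have f0: "?f x = 0" if "x \<notin> K" for x
  proof (cases "x \<in> U \<and> \<phi> x \<in> O'")
    case True
    have "\<phi> x \<notin> C"
    proof
      assume "\<phi> x \<in> C"
      then have "inv_into U \<phi> (\<phi> x) \<in> K" unfolding K_def by (rule imageI)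
      then show False using that True by (simp add: inv_into_f_f[OF ch(3)])
    qed
    then show ?thesis using True 0 by simp
  next
    case False
    then show ?thesis by (rule if_not_P)
  qed
  fix V \<psi> k assume d: "(V, \<psi>) \<in> A"
  note dh = chartD[OF smooth_manifold_chart[OF A d]]
  show "Ck_on k (?f \<circ> inv_into V \<psi>) (\<psi> ` V)"
  proof (rule Ck_local)
    fix y assume "y \<in> \<psi> ` V"
    then obtain p where p: "p \<in> V" "y = \<psi> p" by auto
    show "\<exists>W. open W \<and> y \<in> W \<and> Ck_on k (?f \<circ> inv_into V \<psi>) W"
    proof (cases "p \<in> K")
      case False
      define W where "W = \<psi> ` (V - K)"
      have W: "open W" unfolding W_def
        by (rule chart_open_image[OF smooth_manifold_chart[OF A d]]) (use dh(1) clK in auto)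
      have "Ck_on k (?f \<circ> inv_into V \<psi>) W"
      proof (rule iffD1[OF Ck_cong[OF W] Ck_const[of k "0::real"]])
        fix z assume "z \<in> W"
        then obtain q where q: "q \<in> V" "q \<notin> K" "z = \<psi> q" unfolding W_def by auto
        then show "0 = (?f \<circ> inv_into V \<psi>) z"
          unfolding o_def q(3) inv_into_f_f[OF dh(3) q(1)] by (intro sym[OF f0[OF q(2)]])
      qed
      then show ?thesis using W p False unfolding W_def by blast
    next
      case True
      then obtain a where a: "a \<in> C" "p = inv_into U \<phi> a" unfolding K_def by auto
      have aU: "a \<in> \<phi> ` U" "a \<in> O'" using a C O by auto
      have pU: "p \<in> U" "\<phi> p \<in> O'"
        unfolding a(2) using inv_into_into[OF aU(1)] f_inv_into_f[OF aU(1)] aU(2) by auto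
      define W0 where "W0 = V \<inter> (U \<inter> \<phi> -` O')"
      define W where "W = \<psi> ` W0"
      have oW0: "open W0" unfolding W0_def
        using dh(1) chart_open_preimage[OF smooth_manifold_chart[OF A c] O(1)] by auto
      have W: "open W" unfolding W_def
        by (rule chart_open_image[OF smooth_manifold_chart[OF A d] oW0]) (auto simp: W0_def)
      have t: "Ck_on k (\<phi> \<circ> inv_into V \<psi>) W"
        by (rule Ck_subset[OF smooth_manifold_transition[OF A d c]]) (auto simp: W_def W0_def)
      have 1: "Ck_on k (\<lambda>y. g ((\<phi> \<circ> inv_into V \<psi>) y)) W"
        by (rule Ck_compose[OF E W O(1) _ t g]) (auto simp: W_def W0_def inv_into_f_f[OF dh(3)])
      have "Ck_on k (?f \<circ> inv_into V \<psi>) W"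
        by (rule iffD1[OF Ck_cong[OF W] 1]) (auto simp: W_def W0_def inv_into_f_f[OF dh(3)])
      then show ?thesis using W p pU unfolding W_def W0_def by blast
    qed
  qed
qed

section \<open>Smooth dependence on parameters\<close>

text \<open>
  Linear functionals on \<open>C(S)\<close> of norm at most one. The functional is applied to arbitrary functions,
  hence the restriction to continuous ones in each clause. The integral over \<open>[0, 1]\<close> and the
  invariant mean of a compact group are the two instances.
\<close>

definition mean_on :: "'t::topological_space set \<Rightarrow> (('t \<Rightarrow> real) \<Rightarrow> real) \<Rightarrow> bool" where
  "mean_on S L \<longleftrightarrow>
     (\<forall>f g. continuous_on S f \<longrightarrow> continuous_on S g \<longrightarrow> L (\<lambda>t. f t + g t) = L f + L g) \<and>
     (\<forall>f c. continuous_on S f \<longrightarrow> L (\<lambda>t. c * f t) = c * L f) \<and>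
     (\<forall>f M. continuous_on S f \<longrightarrow> (\<forall>t\<in>S. \<bar>f t\<bar> \<le> M) \<longrightarrow> \<bar>L f\<bar> \<le> M)"

lemma mean_on_diff:
  assumes "mean_on S L" "continuous_on S f" "continuous_on S g"
  shows "L (\<lambda>t. f t - g t) = L f - L g"
proof -
  have "L (\<lambda>t. f t + (-1) * g t) = L f + L (\<lambda>t. (-1) * g t)"
    using assms unfolding mean_on_def by (blast intro: continuous_on_mult_left)
  moreover have "L (\<lambda>t. (-1) * g t) = (-1) * L g"
    using assms unfolding mean_on_def by blast
  ultimately show ?thesis by simp
qed

lemma mean_on_bound:
  assumes "mean_on S L" "continuous_on S f" "\<And>t. t \<in> S \<Longrightarrow> \<bar>f t\<bar> \<le> M"
  shows "\<bar>L f\<bar> \<le> M"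
  using assms unfolding mean_on_def by blast

text \<open>
  A family \<open>H t\<close> of functions on \<open>W\<close>, indexed by \<open>t \<in> S\<close>, whose derivatives in \<open>W\<close> up to order
  \<open>k\<close> are jointly continuous. The parameters form a bare topological space, since they
  range over a group or an interval.
\<close>

primrec PCk :: "nat \<Rightarrow> 't::topological_space set \<Rightarrow> ('t \<Rightarrow> 'a::real_normed_vector \<Rightarrow> real) \<Rightarrow> 'a set \<Rightarrow> bool" where
  "PCk 0 S H W \<longleftrightarrow> continuous_on (W \<times> S) (\<lambda>p. H (snd p) (fst p))"
| "PCk (Suc k) S H W \<longleftrightarrow> continuous_on (W \<times> S) (\<lambda>p. H (snd p) (fst p)) \<and>
     (\<forall>t\<in>S. \<forall>y\<in>W. H t differentiable (at y)) \<and>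
     (\<forall>v. PCk k S (\<lambda>t y. frechet_derivative (H t) (at y) v) W)"

lemma PCk_continuous: "PCk k S H W \<Longrightarrow> continuous_on (W \<times> S) (\<lambda>p. H (snd p) (fst p))"
  by (cases k) auto

lemma PCk_continuous_slice:
  assumes "PCk k S H W" "y \<in> W"
  shows "continuous_on S (\<lambda>t. H t y)"
proof -
  have "continuous_on S (\<lambda>t. H (snd (y, t)) (fst (y, t)))"
    by (rule continuous_on_compose2[OF PCk_continuous[OF assms(1)]])
      (use assms(2) in \<open>auto intro!: continuous_intros\<close>)
  then show ?thesis by simp
qed

lemma PCk_uniform:
  assumes "PCk k S H W" "compact S" "y \<in> W" "e > 0" "open W"
  obtains V where "open V" "y \<in> V" "V \<subseteq> W" "\<And>y' t. y' \<in> V \<Longrightarrow> t \<in> S \<Longrightarrow> \<bar>H t y' - H t y\<bar> \<le> e"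
proof -
  obtain V where "y \<in> V" "open V" "\<forall>x\<in>V \<inter> W. \<forall>t\<in>S. dist (H t x) (H t y) \<le> e"
    using continuous_on_prod_compactE[OF PCk_continuous[OF assms(1)] assms(2,3,4)] by auto
  then show thesis using that[of "V \<inter> W"] assms(3,5) by (auto simp: dist_real_def)
qed

lemma onb_bounded_linear:
  fixes f :: "'a::real_inner \<Rightarrow> 'b::real_normed_vector" and B :: "'a set"
  assumes "onb B" "linear f"
  shows "bounded_linear f"
proof -
  have "norm (f b) \<le> (\<Sum>b\<in>B. norm (f b))" if "b \<in> B" for b
    using member_le_sum[of b B "\<lambda>b. norm (f b)"] that onb_finite[OF assms(1)] by simp
  then have "norm (f x) \<le> norm x * (real (card B) * (\<Sum>b\<in>B. norm (f b)))" for x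
    using onb_norm_linear_le[OF assms, of "\<Sum>b\<in>B. norm (f b)" x] by (simp add: mult_ac)
  then show ?thesis
    by (intro bounded_linear_intro[where K = "real (card B) * (\<Sum>b\<in>B. norm (f b))"])
      (simp_all add: linear_add[OF assms(2)] linear_scale[OF assms(2)])
qed

text \<open>
  Compactness of \<open>S\<close> makes the derivatives \<open>DH t\<close> continuous in \<open>y\<close> uniformly in \<open>t\<close>. By the mean
  value inequality the first order expansion of \<open>H t\<close> at \<open>y\<close> then has an error \<open>o(\<bar>y' - y\<bar>)\<close> uniform in
  \<open>t\<close>, and such an error survives the application of \<open>L\<close>.
\<close>

lemma mean_has_derivative:
  fixes B :: "'a::real_inner set" and H :: "'t::topological_space \<Rightarrow> 'a \<Rightarrow> real"
  assumes B: "onb B" and S: "compact S" and W: "open W" and L: "mean_on S L"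
    and H: "PCk (Suc k) S H W" and y: "y \<in> W"
  shows "((\<lambda>y. L (\<lambda>t. H t y)) has_derivative
           (\<lambda>v. L (\<lambda>t. frechet_derivative (H t) (at y) v))) (at y)"
    (is "(_ has_derivative ?D) _")
proof -
  define dH where "dH t y = frechet_derivative (H t) (at y)" for t y
  have dH: "(H t has_derivative dH t y) (at y)" if "t \<in> S" "y \<in> W" for t y
    using H that by (simp add: dH_def frechet_derivative_works)
  have PdH: "PCk k S (\<lambda>t y. dH t y v) W" for v using H by (simp add: dH_def)
  note cH = PCk_continuous_slice[OF H] and cdH = PCk_continuous_slice[OF PdH]
  have lin_dH: "linear (dH t y)" if "t \<in> S" "y \<in> W" for t y
    using has_derivative_linear[OF dH[OF that]] .
  have Lcong: "L f = L g" if "continuous_on S f" "continuous_on S g" "\<And>t. t \<in> S \<Longrightarrow> f t = g t" for f g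
    using mean_on_bound[OF L continuous_on_diff[OF that(1,2)], of 0] mean_on_diff[OF L that(1,2)] that(3)
    by simp
  have lin: "linear ?D"
  proof (rule linearI)
    fix v w :: 'a and c :: real
    have "L (\<lambda>t. dH t y (v + w)) = L (\<lambda>t. dH t y v + dH t y w)"
      by (rule Lcong) (auto intro!: continuous_intros cdH y simp: linear_add[OF lin_dH] y)
    then show "L (\<lambda>t. frechet_derivative (H t) (at y) (v + w)) =
        L (\<lambda>t. frechet_derivative (H t) (at y) v) + L (\<lambda>t. frechet_derivative (H t) (at y) w)"
      using L cdH[OF y] unfolding mean_on_def dH_def by simp
    have "L (\<lambda>t. dH t y (c *\<^sub>R v)) = L (\<lambda>t. c * dH t y v)"
      by (rule Lcong) (auto intro!: continuous_intros cdH y simp: linear_scale[OF lin_dH] y)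
    then show "L (\<lambda>t. frechet_derivative (H t) (at y) (c *\<^sub>R v)) =
        c *\<^sub>R L (\<lambda>t. frechet_derivative (H t) (at y) v)"
      using L cdH[OF y] unfolding mean_on_def dH_def by simp
  qed
  show ?thesis unfolding has_derivative_at_alt
  proof (intro conjI allI impI)
    show "bounded_linear ?D" by (rule onb_bounded_linear[OF B lin])
    fix e :: real assume e: "e > 0"
    define e' where "e' = e / (real (card B) + 1)"
    have e': "e' > 0" "real (card B) * e' \<le> e" unfolding e'_def using e by (auto simp: field_simps)
    have "\<exists>V. open V \<and> y \<in> V \<and> V \<subseteq> W \<and> (\<forall>y'\<in>V. \<forall>t\<in>S. \<bar>dH t y' b - dH t y b\<bar> \<le> e')" for b
      using PCk_uniform[OF PdH S y e'(1) W, of b] by metis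
    then obtain V where V: "\<And>b. open (V b)" "\<And>b. y \<in> V b" "\<And>b. V b \<subseteq> W"
      "\<And>b y' t. y' \<in> V b \<Longrightarrow> t \<in> S \<Longrightarrow> \<bar>dH t y' b - dH t y b\<bar> \<le> e'" by metis
    have "open (W \<inter> (\<Inter>b\<in>B. V b))" using V(1) W onb_finite[OF B] by blast
    then obtain d where d: "d > 0" "ball y d \<subseteq> W \<inter> (\<Inter>b\<in>B. V b)"
      using y V(2) by (meson IntI INT_I openE)
    show "\<exists>d>0. \<forall>y'. norm (y' - y) < d \<longrightarrow>
       norm (L (\<lambda>t. H t y') - L (\<lambda>t. H t y) - ?D (y' - y)) \<le> e * norm (y' - y)"
    proof (intro exI[of _ d] conjI allI impI d(1))
      fix y' assume "norm (y' - y) < d"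
      then have y': "y' \<in> ball y d" by (simp add: dist_norm norm_minus_commute)
      then have y'W: "y' \<in> W" using d(2) by blast
      have pt: "\<bar>H t y' - H t y - dH t y (y' - y)\<bar> \<le> e * norm (y' - y)" if t: "t \<in> S" for t
      proof -
        have "norm (H t y' - H t y - dH t y (y' - y)) \<le> norm (y' - y) * (real (card B) * e')"
        proof (rule differentiable_bound_linearization[where S = "ball y d"])
          show "y + s *\<^sub>R (y' - y) \<in> ball y d" if "s \<in> {0..1}" for s
          proof -
            have "(1 - s) *\<^sub>R y + s *\<^sub>R y' \<in> ball y d"
              using y' d(1) that by (intro convexD[OF convex_ball]) auto
            then show ?thesis by (simp add: algebra_simps)
          qed
          show "(H t has_derivative dH t z) (at z within ball y d)" if "z \<in> ball y d" for z
            using dH[OF t, of z] that d(2) has_derivative_at_withinI by blast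
          show "y \<in> ball y d" using d by simp
          fix z assume z: "z \<in> ball y d"
          have zW: "z \<in> W" using z d(2) by blast
          show "onorm (dH t z - dH t y) \<le> real (card B) * e'"
          proof (rule onorm_bound)
            fix w
            have l: "linear (\<lambda>w. dH t z w - dH t y w)"
              by (rule linear_compose_sub[OF lin_dH[OF t zW] lin_dH[OF t y]])
            show "norm ((dH t z - dH t y) w) \<le> real (card B) * e' * norm w"
              using onb_norm_linear_le[OF B l, of e' w] V(4)[of z _ t] z d(2) t by auto
          qed (use e' in simp)
        qed
        also have "\<dots> \<le> norm (y' - y) * e" using e'(2) by (intro mult_left_mono) auto
        finally show ?thesis by (simp add: mult.commute)
      qed
      have "L (\<lambda>t. H t y') - L (\<lambda>t. H t y) - L (\<lambda>t. dH t y (y' - y)) =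
            L (\<lambda>t. H t y' - H t y - dH t y (y' - y))"
        by (simp add: mean_on_diff[OF L] continuous_on_diff cH cdH y y'W)
      moreover have "\<bar>L (\<lambda>t. H t y' - H t y - dH t y (y' - y))\<bar> \<le> e * norm (y' - y)"
        by (rule mean_on_bound[OF L _ pt]) (intro continuous_on_diff cH cdH y y'W)
      ultimately show "norm (L (\<lambda>t. H t y') - L (\<lambda>t. H t y) - ?D (y' - y)) \<le> e * norm (y' - y)"
        by (simp add: dH_def)
    qed
  qed
qed

lemma Ck_mean:
  fixes B :: "'a::real_inner set" and H :: "'t::topological_space \<Rightarrow> 'a \<Rightarrow> real"
  assumes B: "onb B" and S: "compact S" and W: "open W" and L: "mean_on S L"
    and H: "PCk k S H W"
  shows "Ck_on k (\<lambda>y. L (\<lambda>t. H t y)) W"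
  using H
proof (induction k arbitrary: H)
  case 0
  show ?case unfolding Ck_on.simps continuous_on_iff
  proof (intro ballI allI impI)
    fix y and e :: real assume y: "y \<in> W" and e: "e > 0"
    obtain V where V: "open V" "y \<in> V" "V \<subseteq> W" "\<And>y' t. y' \<in> V \<Longrightarrow> t \<in> S \<Longrightarrow> \<bar>H t y' - H t y\<bar> \<le> e / 2"
      using PCk_uniform[OF 0 S y _ W, of "e / 2"] e by auto
    obtain d where d: "d > 0" "ball y d \<subseteq> V" using V(1,2) by (meson openE)
    show "\<exists>d>0. \<forall>x'\<in>W. dist x' y < d \<longrightarrow> dist (L (\<lambda>t. H t x')) (L (\<lambda>t. H t y)) < e"
    proof (intro exI[of _ d] conjI ballI impI d(1))
      fix x' assume x': "x' \<in> W" "dist x' y < d"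
      then have "x' \<in> V" using d(2) by (auto simp: dist_commute)
      note c = PCk_continuous_slice[OF 0 x'(1)] PCk_continuous_slice[OF 0 y]
      have "\<bar>L (\<lambda>t. H t x' - H t y)\<bar> \<le> e / 2"
        by (rule mean_on_bound[OF L continuous_on_diff[OF c] V(4)[OF \<open>x' \<in> V\<close>]])
      then show "dist (L (\<lambda>t. H t x')) (L (\<lambda>t. H t y)) < e"
        using mean_on_diff[OF L c] e by (simp add: dist_real_def)
    qed
  qed
next
  case (Suc k)
  show ?case
    by (rule Ck_SucI[OF W mean_has_derivative[OF B S W L Suc.prems] Suc.IH]) (use Suc.prems in auto)
qed

text \<open>
  For a manifold of parameters, joint smoothness is only known in charts. Near \<open>s\<close> the parameter
  enters through a map \<open>\<phi> s\<close> into a vector space, and derivatives of \<open>H\<close> in \<open>y\<close> are derivatives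
  of the local expression \<open>h s\<close> in the directions \<open>(0, v)\<close>.
\<close>

lemma PCk_of_Ck:
  fixes H :: "'t::topological_space \<Rightarrow> 'a::real_normed_vector \<Rightarrow> real"
    and \<phi> :: "'t \<Rightarrow> 't \<Rightarrow> 'p::real_normed_vector"
  assumes W: "open W"
    and U: "\<And>s. s \<in> S \<Longrightarrow> open (U s) \<and> s \<in> U s \<and> continuous_on (U s) (\<phi> s) \<and> open (Q s)"
    and Q: "\<And>s t y. s \<in> S \<Longrightarrow> t \<in> U s \<Longrightarrow> t \<in> S \<Longrightarrow> y \<in> W \<Longrightarrow> (\<phi> s t, y) \<in> Q s"
    and H: "\<And>s t y. s \<in> S \<Longrightarrow> t \<in> U s \<Longrightarrow> t \<in> S \<Longrightarrow> y \<in> W \<Longrightarrow> H t y = h s (\<phi> s t, y)"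
    and h: "\<And>s. s \<in> S \<Longrightarrow> Ck_on k (h s) (Q s)"
  shows "PCk k S H W"
  using H h
proof (induction k arbitrary: H h)
  have cont: "continuous_on (W \<times> S) (\<lambda>p. H (snd p) (fst p))"
    if H: "\<And>s t y. s \<in> S \<Longrightarrow> t \<in> U s \<Longrightarrow> t \<in> S \<Longrightarrow> y \<in> W \<Longrightarrow> H t y = h s (\<phi> s t, y)"
      and h: "\<And>s. s \<in> S \<Longrightarrow> continuous_on (Q s) (h s)"
    for h :: "'t \<Rightarrow> 'p \<times> 'a \<Rightarrow> real" and H :: "'t \<Rightarrow> 'a \<Rightarrow> real"
    unfolding continuous_on_def
  proof
    fix p assume p: "p \<in> W \<times> S"
    define s where "s = snd p"
    have s: "s \<in> S" using p by (auto simp: s_def)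
    have "continuous_on (W \<times> (S \<inter> U s)) (\<lambda>p. h s (\<phi> s (snd p), fst p))"
      by (rule continuous_on_compose2[OF h[OF s]], intro continuous_on_Pair continuous_on_fst
        continuous_on_id continuous_on_compose2[where g = "\<phi> s" and f = snd and t = "U s"]
        continuous_on_snd) (use U[OF s] Q[OF s] in auto)
    then have "continuous_on (W \<times> (S \<inter> U s)) (\<lambda>p. H (snd p) (fst p))"
      by (rule continuous_on_eq) (use H[OF s] in auto)
    then have "((\<lambda>p. H (snd p) (fst p)) \<longlongrightarrow> H (snd p) (fst p)) (at p within W \<times> (S \<inter> U s))"
      unfolding continuous_on_def
    proof (rule bspec)
      show "p \<in> W \<times> (S \<inter> U s)" using p U[OF s] by (auto simp: s_def mem_Times_iff)
    qed
    moreover have "at p within W \<times> (S \<inter> U s) = at p within W \<times> S"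
      by (rule at_within_nhd[where S = "UNIV \<times> U s"]) (use U[OF s] in \<open>auto simp: s_def open_Times mem_Times_iff\<close>)
    ultimately show "((\<lambda>p. H (snd p) (fst p)) \<longlongrightarrow> H (snd p) (fst p)) (at p within W \<times> S)" by simp
  qed
  {
    case 0
    show ?case unfolding PCk.simps by (rule cont[where H = H and h = h, OF 0(1)]) (use 0(2) in auto)
  next
    case (Suc k)
    have d: "(H t has_derivative (\<lambda>v. frechet_derivative (h s) (at (\<phi> s t, y)) (0, v))) (at y)"
      if "s \<in> S" "t \<in> U s" "t \<in> S" "y \<in> W" for s t y
    proof -
      have "((\<lambda>y. (\<phi> s t, y)) has_derivative (\<lambda>v. (0, v))) (at y)"
        by (auto intro!: derivative_eq_intros)
      moreover have "(h s has_derivative frechet_derivative (h s) (at (\<phi> s t, y))) (at (\<phi> s t, y))"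
        by (rule Ck_Suc_has_derivative[OF Suc.prems(2)[OF that(1)] Q[OF that]])
      ultimately have "((\<lambda>y. h s (\<phi> s t, y)) has_derivative
          (\<lambda>v. frechet_derivative (h s) (at (\<phi> s t, y)) (0, v))) (at y)"
        using has_derivative_compose[of "\<lambda>y. (\<phi> s t, y)" "\<lambda>v. (0, v)" y UNIV "h s"] by simp
      then show ?thesis
        by (rule has_derivative_transform_within_open[OF _ W that(4)])
          (use Suc.prems(1) that in auto)
    qed
    have "PCk k S (\<lambda>t y. frechet_derivative (H t) (at y) v) W" for v
    proof (rule Suc.IH)
      show "frechet_derivative (H t) (at y) v = (\<lambda>p. frechet_derivative (h s) (at p) (0, v)) (\<phi> s t, y)"
        if "s \<in> S" "t \<in> U s" "t \<in> S" "y \<in> W" for s t y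
        using frechet_derivative_at[OF d[OF that]] by metis
      show "Ck_on k (\<lambda>p. frechet_derivative (h s) (at p) (0, v)) (Q s)" if "s \<in> S" for s
        using Suc.prems(2)[OF that] by simp
    qed
    moreover have "continuous_on (W \<times> S) (\<lambda>p. H (snd p) (fst p))"
      by (rule cont[where H = H and h = h, OF Suc.prems(1)]) (use Ck_continuous[OF Suc.prems(2)] in auto)
    moreover have "H t differentiable (at y)" if "t \<in> S" "y \<in> W" for t y
      using d[OF that(1) _ that] U[OF that(1)] by (auto simp: differentiable_def)
    ultimately show ?case by simp
  }
qed

section \<open>Bump functions and Hadamard's lemma\<close>

text \<open>
  For \<open>n = 0\<close> the standard smooth function that is flat at zero; the factors \<open>(1 / t) ^ n\<close> are there to close the family under differentiation.
\<close>

definition exp_recip :: "nat \<Rightarrow> real \<Rightarrow> real" where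
  "exp_recip n t = (if t \<le> 0 then 0 else (1 / t) ^ n * exp (- (1 / t)))"

lemma exp_recip_tendsto_0: "(exp_recip n \<longlongrightarrow> 0) (at 0)"
proof -
  have "((\<lambda>s::real. s ^ n / exp s) \<longlongrightarrow> 0) at_top" by (rule tendsto_power_div_exp_0)
  then have "((\<lambda>t. (inverse t) ^ n / exp (inverse t)) \<longlongrightarrow> 0) (at_right (0::real))"
    by (rule filterlim_compose) (rule filterlim_inverse_at_top_right)
  then have "(exp_recip n \<longlongrightarrow> 0) (at_right 0)"
  proof (rule Lim_transform_eventually)
    show "\<forall>\<^sub>F t in at_right 0. (inverse t) ^ n / exp (inverse t) = exp_recip n t"
      using eventually_at_right_less[of "0::real"]
      by eventually_elim (simp add: exp_recip_def exp_minus field_simps)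
  qed
  moreover have "(exp_recip n \<longlongrightarrow> 0) (at_left 0)"
  proof (rule Lim_transform_eventually[OF tendsto_const])
    show "\<forall>\<^sub>F t in at_left 0. 0 = exp_recip n t"
      unfolding eventually_at_filter by (simp add: exp_recip_def)
  qed
  ultimately show ?thesis by (simp add: filterlim_at_split)
qed

lemma exp_recip_has_derivative:
  "(exp_recip n has_real_derivative (exp_recip (n + 2) t - real n * exp_recip (n + 1) t)) (at t)"
proof -
  consider "t < 0" | "t > 0" | "t = 0" by linarith
  then show ?thesis
  proof cases
    case 1
    have "((\<lambda>t. 0::real) has_real_derivative 0) (at t)" by simp
    then have "(exp_recip n has_real_derivative 0) (at t)"
      by (rule has_field_derivative_transform_within_open[where S = "{..<0}"])
        (use 1 in \<open>auto simp: exp_recip_def\<close>)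
    then show ?thesis using 1 by (simp add: exp_recip_def)
  next
    case 2
    define s where "s = 1 / t"
    have d1: "((\<lambda>t. 1 / t) has_real_derivative - (s * s)) (at t)"
      using 2 by (auto intro!: derivative_eq_intros simp: s_def)
    have d2: "((\<lambda>t. exp (- (1 / t))) has_real_derivative exp (- s) * (s * s)) (at t)"
      using 2 by (auto intro!: derivative_eq_intros simp: s_def)
    have "real n * (- (s * s) * s ^ (n - Suc 0)) * exp (- s) + exp (- s) * (s * s) * s ^ n =
        s ^ (n + 2) * exp (- s) - real n * (s ^ (n + 1) * exp (- s))"
      by (cases n) (auto simp: algebra_simps)
    then have "((\<lambda>t. (1 / t) ^ n * exp (- (1 / t))) has_real_derivative
        (1 / t) ^ (n + 2) * exp (- (1 / t)) - real n * ((1 / t) ^ (n + 1) * exp (- (1 / t)))) (at t)"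
      using DERIV_mult[OF DERIV_power[OF d1, of n] d2] by (simp add: s_def)
    then have "(exp_recip n has_real_derivative
        (1 / t) ^ (n + 2) * exp (- (1 / t)) - real n * ((1 / t) ^ (n + 1) * exp (- (1 / t)))) (at t)"
      by (rule has_field_derivative_transform_within_open[where S = "{0<..}"])
        (use 2 in \<open>auto simp: exp_recip_def\<close>)
    then show ?thesis using 2 by (simp add: exp_recip_def)
  next
    case 3
    have "((\<lambda>h. (exp_recip n (0 + h) - exp_recip n 0) / h) \<longlongrightarrow> 0) (at 0)"
      by (rule Lim_transform_eventually[OF exp_recip_tendsto_0[of "Suc n"]])
        (auto simp: exp_recip_def eventually_at_filter)
    then have "(exp_recip n has_real_derivative 0) (at 0)" by (simp add: DERIV_def)
    then show ?thesis using 3 by (simp add: exp_recip_def)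
  qed
qed

lemma Ck_exp_recip: "Ck_on k (exp_recip n) UNIV"
proof (induction k arbitrary: n)
  case 0
  show ?case unfolding Ck_on.simps
    by (rule DERIV_continuous_on) (use exp_recip_has_derivative has_field_derivative_at_within in blast)
next
  case (Suc k)
  have d: "(exp_recip n has_derivative
      (\<lambda>v. (exp_recip (n + 2) t - real n * exp_recip (n + 1) t) * v)) (at t)" for t
    using exp_recip_has_derivative[of n t] by (simp add: has_field_derivative_def)
  show ?case
  proof (rule Ck_SucI[OF open_UNIV d])
    fix v :: real
    show "Ck_on k (\<lambda>t. (exp_recip (n + 2) t - real n * exp_recip (n + 1) t) * v) UNIV"
      by (intro Ck_mult[OF open_UNIV] Ck_diff[OF open_UNIV] Ck_const Suc.IH open_UNIV)
  qed
qed

lemma exp_recip_pos: "t > 0 \<Longrightarrow> exp_recip n t > 0"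
  by (simp add: exp_recip_def)

text \<open>
  The function \<open>exp (-1 / (r\<^sup>2 - \<bar>y - a\<bar>\<^sup>2))\<close> on the ball, continued by zero. The inner product in place of the
  norm makes smoothness in \<open>y\<close> immediate.
\<close>

definition bump :: "'e::real_inner \<Rightarrow> real \<Rightarrow> 'e \<Rightarrow> real" where
  "bump a r y = exp_recip 0 (r\<^sup>2 - (y - a) \<bullet> (y - a))"

lemma Ck_inner_self:
  fixes a :: "'e::real_inner"
  assumes "open W"
  shows "Ck_on k (\<lambda>y. (y - a) \<bullet> (y - a)) W"
proof (cases k)
  case 0
  then show ?thesis by (auto intro!: continuous_intros)
next
  case (Suc n)
  have "((\<lambda>y. (y - a) \<bullet> (y - a)) has_derivative (\<lambda>v. 2 * (v \<bullet> (y - a)))) (at y)" for y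
    by (auto intro!: derivative_eq_intros simp: inner_commute)
  then show ?thesis unfolding Suc
  proof (rule Ck_SucI[OF assms])
    fix v
    have "Ck_on n (\<lambda>y. 2 * (v \<bullet> y) - 2 * (v \<bullet> a)) W"
      by (intro Ck_diff Ck_const Ck_bounded_linear assms bounded_linear_const_mult
          bounded_linear_inner_right)
    then show "Ck_on n (\<lambda>y. 2 * (v \<bullet> (y - a))) W" by (simp add: inner_diff_right algebra_simps)
  qed
qed

lemma Ck_bump:
  assumes "open W"
  shows "Ck_on k (bump a r) W"
  unfolding bump_def
  by (rule Ck_compose[OF onb_real assms open_UNIV _ _ Ck_exp_recip])
    (auto intro!: Ck_diff Ck_const Ck_inner_self assms)

lemma bump_pos: "y \<in> ball a r \<Longrightarrow> bump a r y > 0"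
  unfolding bump_def
  by (rule exp_recip_pos)
    (auto simp: dist_norm norm_minus_commute dot_square_norm intro: power_strict_mono)

lemma bump_zero: "r > 0 \<Longrightarrow> y \<notin> cball a r \<Longrightarrow> bump a r y = 0"
proof -
  assume r: "r > 0" and y: "y \<notin> cball a r"
  have "r\<^sup>2 \<le> (norm (y - a))\<^sup>2"
    by (rule power_mono) (use r y in \<open>auto simp: dist_norm norm_minus_commute\<close>)
  then show "bump a r y = 0"
    unfolding bump_def exp_recip_def by (simp add: dot_square_norm)
qed

text \<open>
  By induction on \<open>B\<close>, adding one compact interval factor at a time; the closed balls of a
  finite-dimensional space lie in such boxes.
\<close>

lemma compact_box_finite:
  fixes B :: "'e::real_normed_vector set"
  assumes "finite B"
  shows "\<exists>K. compact K \<and> (\<forall>c. (\<forall>b\<in>B. \<bar>c b\<bar> \<le> C) \<longrightarrow> (\<Sum>b\<in>B. c b *\<^sub>R b) \<in> K)"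
  using assms
proof (induction B)
  case empty
  show ?case by (intro exI[of _ "{0}"]) auto
next
  case (insert b B)
  then obtain K where K: "compact K" "\<And>c. (\<forall>b\<in>B. \<bar>c b\<bar> \<le> C) \<Longrightarrow> (\<Sum>b\<in>B. c b *\<^sub>R b) \<in> K" by blast
  define K' where "K' = (\<lambda>p. fst p *\<^sub>R b + snd p) ` ({- C..C} \<times> K)"
  have "compact K'" unfolding K'_def
    by (intro compact_continuous_image compact_Times compact_Icc K continuous_intros)
  moreover have "(\<Sum>x\<in>insert b B. c x *\<^sub>R x) \<in> K'" if "\<forall>x\<in>insert b B. \<bar>c x\<bar> \<le> C" for c
  proof -
    have "(c b, \<Sum>x\<in>B. c x *\<^sub>R x) \<in> {- C..C} \<times> K" using that K(2)[of c] by auto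
    then have "c b *\<^sub>R b + (\<Sum>x\<in>B. c x *\<^sub>R x) \<in> K'" unfolding K'_def by (rule rev_image_eqI) simp
    then show ?thesis using insert.hyps by simp
  qed
  ultimately show ?case by blast
qed

lemma compact_cball_onb:
  fixes a :: "'e::real_inner" and B :: "'e set"
  assumes B: "onb B"
  shows "compact (cball a r)"
proof -
  obtain K where K: "compact K" "\<And>c. (\<forall>b\<in>B. \<bar>c b\<bar> \<le> norm a + r) \<Longrightarrow> (\<Sum>b\<in>B. c b *\<^sub>R b) \<in> K"
    using compact_box_finite[OF onb_finite[OF B]] by meson
  have "cball a r \<subseteq> K"
  proof
    fix x assume x: "x \<in> cball a r"
    have "norm x \<le> norm a + r" using x norm_triangle_sub[of x a] by (simp add: dist_norm norm_minus_commute)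
    then have "\<forall>b\<in>B. \<bar>x \<bullet> b\<bar> \<le> norm a + r"
      using Cauchy_Schwarz_ineq2[of x] onb_norm[OF B] by (metis mult.right_neutral order_trans)
    then show "x \<in> K" using K(2)[of "\<lambda>b. x \<bullet> b"] onb_expand[OF B, of x] by simp
  qed
  then show ?thesis using compact_Int_closed[OF K(1) closed_cball[of a r]] by (simp add: Int_absorb1)
qed

lemma Ck_component: "open W \<Longrightarrow> Ck_on k (\<lambda>y. y \<bullet> b) W"
  by (simp add: Ck_bounded_linear bounded_linear_inner_left)

lemma mean_on_integral: "mean_on {0..1} (\<lambda>f. integral {0..1::real} f)"
  unfolding mean_on_def
proof (intro conjI allI impI)
  fix f :: "real \<Rightarrow> real" and M assume "continuous_on {0..1} f" "\<forall>t\<in>{0..1}. \<bar>f t\<bar> \<le> M"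
  then show "\<bar>integral {0..1} f\<bar> \<le> M" using integral_bound[of 0 1 f M] by simp
qed (auto intro: Henstock_Kurzweil_Integration.integral_add integrable_continuous_real)

text \<open>
  Integrating the derivative of \<open>f\<close> along the segment from \<open>a\<close> to \<open>y\<close> gives
  \<open>f y - f a = \<integral> Df(a + t (y - a)) (y - a) dt\<close>; expanding \<open>y - a\<close> in the basis gives the coefficients
  \<open>q b\<close>, which are smooth by differentiation under the integral sign.
\<close>

lemma hadamard:
  fixes f :: "'e::real_inner \<Rightarrow> real" and B :: "'e set"
  assumes B: "onb B" and f: "\<And>k. Ck_on k f (ball y0 R)" and a: "a \<in> ball y0 R"
  obtains q where "\<And>b k. Ck_on k (q b) (ball y0 R)"
    "\<And>y. y \<in> ball y0 R \<Longrightarrow> f y - f a = (\<Sum>b\<in>B. ((y - a) \<bullet> b) * q b y)"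
    "\<And>b. q b a = frechet_derivative f (at a) b"
proof -
  define q where "q b y = integral {0..1} (\<lambda>t. frechet_derivative f (at (a + t *\<^sub>R (y - a))) b)" for b y
  define \<sigma> where "\<sigma> p = a + fst p *\<^sub>R (snd p - a)" for p :: "real \<times> 'e"
  have seg: "a + t *\<^sub>R (y - a) \<in> ball y0 R" if "t \<in> {0..1}" "y \<in> ball y0 R" for t y
  proof -
    have "(1 - t) *\<^sub>R a + t *\<^sub>R y \<in> ball y0 R"
      using a that by (intro convexD[OF convex_ball]) auto
    then show ?thesis by (simp add: algebra_simps)
  qed
  have Q: "open (\<sigma> -` ball y0 R)"
    by (rule open_vimage[OF open_ball]) (auto simp: \<sigma>_def intro!: continuous_intros)
  have s: "Ck_on k \<sigma> (\<sigma> -` ball y0 R)" for k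
    unfolding \<sigma>_def[abs_def]
    by (intro Ck_add Ck_const Ck_scaleR Ck_diff Ck_bounded_linear bounded_linear_fst bounded_linear_snd
        Q[unfolded \<sigma>_def[abs_def]])
  have df: "Ck_on k (\<lambda>y. frechet_derivative f (at y) b) (ball y0 R)" for k b
    using f[of "Suc k"] by simp
  have P: "PCk k {0..1} (\<lambda>t y. frechet_derivative f (at (a + t *\<^sub>R (y - a))) b) (ball y0 R)" for k b
  proof (rule PCk_of_Ck[where U = "\<lambda>_. UNIV" and \<phi> = "\<lambda>_ t. t" and Q = "\<lambda>_. \<sigma> -` ball y0 R"
        and h = "\<lambda>_ p. frechet_derivative f (at (\<sigma> p)) b"])
    show "Ck_on k (\<lambda>p. frechet_derivative f (at (\<sigma> p)) b) (\<sigma> -` ball y0 R)"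
      by (rule Ck_compose[OF B Q open_ball _ s df]) auto
  qed (use Q seg in \<open>auto simp: \<sigma>_def\<close>)
  have Cq: "Ck_on k (q b) (ball y0 R)" for k b
    using Ck_mean[OF B compact_Icc open_ball mean_on_integral P] unfolding q_def[abs_def] by simp
  have eq: "f y - f a = (\<Sum>b\<in>B. ((y - a) \<bullet> b) * q b y)" if y: "y \<in> ball y0 R" for y
  proof -
    have d: "((\<lambda>t. f (a + t *\<^sub>R (y - a))) has_vector_derivative
        frechet_derivative f (at (a + t *\<^sub>R (y - a))) (y - a)) (at t within {0..1})"
      if t: "t \<in> {0..1}" for t
    proof -
      have "((\<lambda>t. a + t *\<^sub>R (y - a)) has_derivative (\<lambda>h. h *\<^sub>R (y - a))) (at t within {0..1})"
        by (auto intro!: derivative_eq_intros)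
      from has_derivative_compose[OF this Ck_Suc_has_derivative[OF f seg[OF t y]]]
      show ?thesis
        unfolding has_vector_derivative_def
        using linear_scale[OF has_derivative_linear[OF Ck_Suc_has_derivative[OF f seg[OF t y]]]]
        by simp
    qed
    have "((\<lambda>t. frechet_derivative f (at (a + t *\<^sub>R (y - a))) (y - a)) has_integral
        f (a + 1 *\<^sub>R (y - a)) - f (a + 0 *\<^sub>R (y - a))) {0..1}"
      by (rule fundamental_theorem_of_calculus) (use d in auto)
    then have 1: "((\<lambda>t. frechet_derivative f (at (a + t *\<^sub>R (y - a))) (y - a)) has_integral f y - f a) {0..1}"
      by simp
    have "((\<lambda>t. \<Sum>b\<in>B. ((y - a) \<bullet> b) * frechet_derivative f (at (a + t *\<^sub>R (y - a))) b) has_integral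
        (\<Sum>b\<in>B. ((y - a) \<bullet> b) * q b y)) {0..1}"
      unfolding q_def
      by (intro has_integral_sum has_integral_mult_right integrable_integral onb_finite[OF B]
          integrable_continuous_real PCk_continuous_slice[OF P y])
    then have 2: "((\<lambda>t. frechet_derivative f (at (a + t *\<^sub>R (y - a))) (y - a)) has_integral
        (\<Sum>b\<in>B. ((y - a) \<bullet> b) * q b y)) {0..1}"
    proof (rule has_integral_eq[rotated])
      fix t :: real assume t: "t \<in> {0..1}"
      show "(\<Sum>b\<in>B. ((y - a) \<bullet> b) * frechet_derivative f (at (a + t *\<^sub>R (y - a))) b) =
          frechet_derivative f (at (a + t *\<^sub>R (y - a))) (y - a)"
        using onb_linear_expand[OF B has_derivative_linear[OF Ck_Suc_has_derivative[OF f seg[OF t y]]], of "y - a"]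
        by simp
    qed
    show ?thesis by (rule has_integral_unique[OF 1 2])
  qed
  show thesis by (rule that[OF Cq eq]) (auto simp: q_def)
qed

section \<open>Integral curves\<close>

text \<open>
  Existence only, by the contraction principle on the functions with values in the ball. The curves are
  parametrized by the whole line, with the time clamped to \<open>[0, \<epsilon>]\<close>, so that they form a closed subset
  of the complete space of bounded continuous functions.
\<close>

lemma picard_lindelof_banach:
  fixes Y :: "'b::banach \<Rightarrow> 'b"
  assumes r: "r > 0" and K: "K \<ge> 0"
    and lip: "\<And>x y. x \<in> cball y0 r \<Longrightarrow> y \<in> cball y0 r \<Longrightarrow> norm (Y x - Y y) \<le> K * norm (x - y)"
  obtains \<epsilon> \<gamma> where "\<epsilon> > 0" "\<gamma> 0 = y0"
    "\<And>t. t \<in> {0..\<epsilon>} \<Longrightarrow> \<gamma> t \<in> cball y0 r"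
    "\<And>t. t \<in> {0..\<epsilon>} \<Longrightarrow> (\<gamma> has_vector_derivative Y (\<gamma> t)) (at t within {0..\<epsilon>})"
proof -
  define M where "M = norm (Y y0) + K * r"
  have M0: "M \<ge> 0" unfolding M_def using r K by simp
  have bd: "norm (Y x) \<le> M" if "x \<in> cball y0 r" for x
  proof -
    have "norm (Y x) \<le> norm (Y y0) + norm (Y x - Y y0)"
      using norm_triangle_sub[of "Y x" "Y y0"] by simp
    also have "norm (Y x - Y y0) \<le> K * norm (x - y0)" using lip that r by simp
    also have "\<dots> \<le> K * r"
      using that K by (intro mult_left_mono) (auto simp: dist_norm norm_minus_commute)
    finally show ?thesis unfolding M_def by simp
  qed
  \<comment> \<open>The first bound keeps the curves in the ball, the second makes the integral operator a contraction.\<close>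
  define \<epsilon> where "\<epsilon> = min (r / (M + 1)) (1 / (2 * (K + 1)))"
  have e0: "\<epsilon> > 0" unfolding \<epsilon>_def using r K M0 by simp
  have eM: "M * \<epsilon> \<le> r"
  proof -
    have "M * \<epsilon> \<le> M * (r / (M + 1))" unfolding \<epsilon>_def using M0 by (intro mult_left_mono) auto
    also have "\<dots> \<le> r" using M0 r by (simp add: field_simps)
    finally show ?thesis .
  qed
  have eK: "K * \<epsilon> \<le> 1 / 2"
  proof -
    have "K * \<epsilon> \<le> K * (1 / (2 * (K + 1)))" unfolding \<epsilon>_def using K by (intro mult_left_mono) auto
    also have "\<dots> \<le> 1 / 2" using K by (simp add: field_simps)
    finally show ?thesis .
  qed
  have contY: "continuous_on (cball y0 r) Y"
  proof (rule continuous_onI)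
    fix x e :: 'b and e' :: real assume x: "x \<in> cball y0 r" and e': "e' > 0"
    show "\<exists>d>0. \<forall>x'\<in>cball y0 r. dist x' x < d \<longrightarrow> dist (Y x') (Y x) \<le> e'"
    proof (intro exI conjI ballI impI)
      show "e' / (K + 1) > 0" using e' K by simp
      fix x' assume x': "x' \<in> cball y0 r" "dist x' x < e' / (K + 1)"
      have "dist (Y x') (Y x) \<le> K * norm (x' - x)" using lip x x' by (simp add: dist_norm)
      also have "\<dots> \<le> K * (e' / (K + 1))" using x' K by (intro mult_left_mono) (auto simp: dist_norm)
      also have "\<dots> \<le> e'" using K e' by (simp add: field_simps)
      finally show "dist (Y x') (Y x) \<le> e'" .
    qed
  qed
  define S where "S = PiC (UNIV :: real set) (\<lambda>_. cball y0 r)"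
  have memS: "u \<in> S \<longleftrightarrow> (\<forall>t. apply_bcontfun u t \<in> cball y0 r)" for u
    unfolding S_def mem_PiC_iff by auto
  have "closed S" unfolding S_def by (rule closed_PiC) auto
  then have compS: "complete S" by (simp add: complete_eq_closed)
  have neS: "S \<noteq> {}"
  proof -
    have "const_bcontfun y0 \<in> S" using r by (simp add: memS const_bcontfun.rep_eq)
    then show ?thesis by auto
  qed
  define cl where "cl t = max 0 (min \<epsilon> t)" for t :: real
  have cl: "cl t \<in> {0..\<epsilon>}" for t unfolding cl_def using e0 by auto
  have contF: "continuous_on {0..c} (\<lambda>\<tau>. Y (apply_bcontfun u \<tau>))" if "u \<in> S" for u c
    by (rule continuous_on_compose2[OF contY]) (use that memS in auto)
  define I where "I u t = y0 + integral {0..cl t} (\<lambda>\<tau>. Y (apply_bcontfun u \<tau>))" for u t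
  have Iball: "I u t \<in> cball y0 r" if "u \<in> S" for u t
  proof -
    have "norm (integral {0..cl t} (\<lambda>\<tau>. Y (apply_bcontfun u \<tau>))) \<le> M * (cl t - 0)"
      by (rule integral_bound) (use cl contF[OF that] bd that memS in auto)
    also have "\<dots> \<le> M * \<epsilon>" using cl M0 by (intro mult_left_mono) auto
    finally show ?thesis using eM by (simp add: I_def dist_norm)
  qed
  have Ibc: "I u \<in> bcontfun" if "u \<in> S" for u
  proof (rule bcontfun_normI)
    have "continuous_on {0..\<epsilon>} (\<lambda>x. integral {0..x} (\<lambda>\<tau>. Y (apply_bcontfun u \<tau>)))"
      by (rule indefinite_integral_continuous_1[OF integrable_continuous_real[OF contF[OF that]]])
    then have "continuous_on UNIV (\<lambda>t. integral {0..cl t} (\<lambda>\<tau>. Y (apply_bcontfun u \<tau>)))"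
      by (rule continuous_on_compose2) (use cl in \<open>auto simp: cl_def intro!: continuous_intros\<close>)
    then show "continuous_on UNIV (I u)" unfolding I_def by (intro continuous_intros)
    show "norm (I u x) \<le> norm y0 + r" for x
      using Iball[OF that, of x] norm_triangle_sub[of "I u x" y0]
      by (simp add: dist_norm norm_minus_commute)
  qed
  define T where "T u = Bcontfun (I u)" for u
  have T: "apply_bcontfun (T u) t = I u t" if "u \<in> S" for u t
    unfolding T_def using Bcontfun_inverse[OF Ibc[OF that]] by simp
  have "\<exists>!u\<in>S. T u = u"
  proof (rule Banach_fix[OF compS neS])
    show "T ` S \<subseteq> S" using T Iball memS by auto
    fix u v assume uv: "u \<in> S" "v \<in> S"
    show "dist (T u) (T v) \<le> 1/2 * dist u v"
    proof (rule dist_bound)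
      fix t
      have "I u t - I v t = integral {0..cl t} (\<lambda>\<tau>. Y (apply_bcontfun u \<tau>) - Y (apply_bcontfun v \<tau>))"
        unfolding I_def by (simp add: Henstock_Kurzweil_Integration.integral_diff
            integrable_continuous_real contF uv)
      moreover have "norm (integral {0..cl t} (\<lambda>\<tau>. Y (apply_bcontfun u \<tau>) - Y (apply_bcontfun v \<tau>)))
          \<le> (K * dist u v) * (cl t - 0)"
      proof (rule integral_bound)
        show "continuous_on {0..cl t} (\<lambda>\<tau>. Y (apply_bcontfun u \<tau>) - Y (apply_bcontfun v \<tau>))"
          by (intro continuous_on_diff contF uv)
        fix \<tau>
        have "norm (Y (apply_bcontfun u \<tau>) - Y (apply_bcontfun v \<tau>))
           \<le> K * norm (apply_bcontfun u \<tau> - apply_bcontfun v \<tau>)"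
          using lip uv memS by blast
        also have "\<dots> \<le> K * dist u v"
          using dist_bounded[of u \<tau> v] K by (intro mult_left_mono) (auto simp: dist_norm)
        finally show "norm (Y (apply_bcontfun u \<tau>) - Y (apply_bcontfun v \<tau>)) \<le> K * dist u v" .
      qed (use cl in auto)
      moreover have "(K * dist u v) * (cl t - 0) \<le> (K * \<epsilon>) * dist u v"
        using cl[of t] K by (simp add: mult_left_mono mult_ac mult_right_mono)
      moreover have "(K * \<epsilon>) * dist u v \<le> 1/2 * dist u v"
        using eK by (intro mult_right_mono) auto
      ultimately show "dist (apply_bcontfun (T u) t) (apply_bcontfun (T v) t) \<le> 1/2 * dist u v"
        using T uv by (simp add: dist_norm)
    qed
  qed auto
  then obtain u where u: "u \<in> S" "T u = u" by blast
  have eq: "apply_bcontfun u t = y0 + integral {0..t} (\<lambda>\<tau>. Y (apply_bcontfun u \<tau>))"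
    if "t \<in> {0..\<epsilon>}" for t
    using T[OF u(1), of t] u(2) that by (simp add: I_def cl_def)
  show thesis
  proof (rule that[of \<epsilon> "apply_bcontfun u"])
    show "apply_bcontfun u 0 = y0" using eq[of 0] e0 by simp
    show "apply_bcontfun u t \<in> cball y0 r" for t using u memS by blast
    fix t assume t: "t \<in> {0..\<epsilon>}"
    have "((\<lambda>t. y0 + integral {0..t} (\<lambda>\<tau>. Y (apply_bcontfun u \<tau>))) has_vector_derivative
        0 + Y (apply_bcontfun u t)) (at t within {0..\<epsilon>})"
      by (intro has_vector_derivative_add has_vector_derivative_const
          integral_has_vector_derivative contF u t)
    then show "(apply_bcontfun u has_vector_derivative Y (apply_bcontfun u t)) (at t within {0..\<epsilon>})"
      by (intro has_vector_derivative_transform[OF t eq]) simp_all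
  qed (rule e0)
qed

text \<open>
  A finite-dimensional inner product space need not be of class \<open>banach\<close>. It embeds into its dual
  space, which is, by \<open>x \<mapsto> (x \<bullet> _)\<close>, and the basis provides a linear left inverse of this
  embedding; the vector field is transported along the two maps.
\<close>

lemma picard_lindelof:
  fixes V :: "'e::real_inner \<Rightarrow> 'e"
  assumes B: "onb (B :: 'e set)" and r: "r > 0" and K: "K \<ge> 0"
    and lip: "\<And>x y. x \<in> cball y0 r \<Longrightarrow> y \<in> cball y0 r \<Longrightarrow> norm (V x - V y) \<le> K * norm (x - y)"
  obtains \<epsilon> \<gamma> where "\<epsilon> > 0" "\<gamma> 0 = y0"
    "\<And>t. t \<in> {0..\<epsilon>} \<Longrightarrow> \<gamma> t \<in> cball y0 r"
    "\<And>t. t \<in> {0..\<epsilon>} \<Longrightarrow> (\<gamma> has_vector_derivative V (\<gamma> t)) (at t within {0..\<epsilon>})"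
proof -
  define n where "n = card B"
  define E where "E = (blinfun_inner_right :: 'e \<Rightarrow> 'e \<Rightarrow>\<^sub>L real)"
  define P where "P s = (\<Sum>b\<in>B. blinfun_apply s b *\<^sub>R b)" for s :: "'e \<Rightarrow>\<^sub>L real"
  have Ediff: "E x - E y = E (x - y)" for x y
    by (rule blinfun_eqI) (simp add: E_def blinfun_inner_right.rep_eq blinfun.diff_left inner_diff_left)
  have normE: "norm (E x) \<le> norm x" for x
    by (rule norm_blinfun_bound) (auto simp: E_def blinfun_inner_right.rep_eq Cauchy_Schwarz_ineq2)
  have PE: "P (E x) = x" for x
    using onb_expand[OF B, of x] by (simp add: P_def E_def blinfun_inner_right.rep_eq)
  have normP: "norm (P s) \<le> norm s * real n" for s
  proof -
    have "norm (P s) \<le> (\<Sum>b\<in>B. norm s)" unfolding P_def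
    proof (rule sum_norm_le)
      fix b assume "b \<in> B"
      then show "norm (blinfun_apply s b *\<^sub>R b) \<le> norm s"
        using norm_blinfun[of s b] onb_norm[OF B] by simp
    qed
    then show ?thesis by (simp add: n_def mult.commute)
  qed
  have blP: "bounded_linear P"
    by (rule bounded_linear_intro[OF _ _ normP])
      (auto simp: P_def blinfun.add_left blinfun.scaleR_left scaleR_add_left sum.distrib scaleR_sum_right)
  have Pdiff: "P s - P t = P (s - t)" for s t
    using linear_diff[OF bounded_linear.linear[OF blP]] by simp
  \<comment> \<open>The left inverse of the embedding has norm at most \<open>n\<close>.\<close>
  define r' where "r' = r / (real n + 1)"
  have r': "r' > 0" "r' * real n \<le> r" unfolding r'_def using r by (auto simp: field_simps)
  have Pball: "P s \<in> cball y0 r" if "s \<in> cball (E y0) r'" for s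
  proof -
    have "norm (P s - y0) \<le> norm (s - E y0) * real n"
      using normP[of "s - E y0"] Pdiff[of s "E y0"] PE by simp
    also have "\<dots> \<le> r' * real n"
      using that by (intro mult_right_mono) (auto simp: dist_norm norm_minus_commute)
    finally show ?thesis using r' by (simp add: dist_norm norm_minus_commute)
  qed
  have lipY: "norm (E (V (P s)) - E (V (P t))) \<le> (K * real n) * norm (s - t)"
    if "s \<in> cball (E y0) r'" "t \<in> cball (E y0) r'" for s t
  proof -
    have "norm (E (V (P s)) - E (V (P t))) \<le> norm (V (P s) - V (P t))"
      unfolding Ediff by (rule normE)
    also have "\<dots> \<le> K * norm (P s - P t)" using lip Pball that by blast
    also have "\<dots> \<le> K * (norm (s - t) * real n)"
      using normP[of "s - t"] Pdiff K by (intro mult_left_mono) auto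
    finally show ?thesis by (simp add: mult_ac)
  qed
  obtain \<epsilon> \<gamma> where g: "\<epsilon> > 0" "\<gamma> 0 = E y0" "\<And>t. t \<in> {0..\<epsilon>} \<Longrightarrow> \<gamma> t \<in> cball (E y0) r'"
    "\<And>t. t \<in> {0..\<epsilon>} \<Longrightarrow> (\<gamma> has_vector_derivative E (V (P (\<gamma> t)))) (at t within {0..\<epsilon>})"
    by (rule picard_lindelof_banach[where Y = "\<lambda>s. E (V (P s))" and K = "K * real n", OF r'(1) _ lipY])
      (use K in auto)
  show thesis
  proof (rule that[of \<epsilon> "\<lambda>t. P (\<gamma> t)"])
    show "((\<lambda>t. P (\<gamma> t)) has_vector_derivative V (P (\<gamma> t))) (at t within {0..\<epsilon>})"
      if "t \<in> {0..\<epsilon>}" for t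
      using bounded_linear.has_vector_derivative[OF blP g(4)[OF that]] by (simp add: PE)
  qed (use g PE Pball in auto)
qed

section \<open>The invariant mean of a compact group\<close>

locale compact_group = Group.group G for G :: "'g::{t2_space, second_countable_topology} monoid" (structure) +
  assumes carrier_UNIV: "carrier G = UNIV"
    and compact_UNIV: "compact (UNIV :: 'g set)"
    and continuous_mult: "continuous_on UNIV (\<lambda>p. fst p \<otimes> snd p)"
    and continuous_inv: "continuous_on UNIV (\<lambda>g. inv g)"
begin

lemma in_carrier [simp]: "x \<in> carrier G"
  by (simp add: carrier_UNIV)

lemma continuous_mult_comp:
  fixes a b :: "'z::topological_space \<Rightarrow> 'g"
  assumes "continuous_on S a" "continuous_on S b"
  shows "continuous_on S (\<lambda>p. a p \<otimes> b p)"
  using continuous_on_compose2[OF continuous_mult continuous_on_Pair[OF assms]] by simp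

lemma continuous_inv_comp:
  fixes a :: "'z::topological_space \<Rightarrow> 'g"
  assumes "continuous_on S a"
  shows "continuous_on S (\<lambda>p. inv (a p))"
  using continuous_on_compose2[OF continuous_inv assms] by simp

definition dense_seq :: "nat \<Rightarrow> 'g" where
  "dense_seq = (SOME d. \<forall>V. open V \<longrightarrow> V \<noteq> {} \<longrightarrow> (\<exists>n. d n \<in> V))"

lemma dense_seq: "open V \<Longrightarrow> V \<noteq> {} \<Longrightarrow> \<exists>n. dense_seq n \<in> V"
proof -
  obtain D :: "'g set" where D: "countable D" "\<And>V. open V \<Longrightarrow> V \<noteq> {} \<Longrightarrow> \<exists>d\<in>D. d \<in> V"
    using countable_dense_exists by metis
  have "\<exists>n. from_nat_into D n \<in> V" if "open V" "V \<noteq> {}" for V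
    using D(2)[OF that] from_nat_into_surj[OF D(1)] by metis
  then have "\<exists>d :: nat \<Rightarrow> 'g. \<forall>V. open V \<longrightarrow> V \<noteq> {} \<longrightarrow> (\<exists>n. d n \<in> V)" by blast
  from someI_ex[OF this] show "open V \<Longrightarrow> V \<noteq> {} \<Longrightarrow> \<exists>n. dense_seq n \<in> V"
    unfolding dense_seq_def by blast
qed

text \<open>
  The averaging operator of the random walk that multiplies from the left by \<open>dense_seq n\<close> with
  probability \<open>(1/2) ^ Suc n\<close>. It commutes with right translations.
\<close>

definition avg :: "('g \<Rightarrow> real) \<Rightarrow> 'g \<Rightarrow> real" where
  "avg f x = suminf (\<lambda>n. (1/2) ^ Suc n * f (dense_seq n \<otimes> x))"

definition bdd :: "('g \<Rightarrow> real) \<Rightarrow> bool" where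
  "bdd f \<longleftrightarrow> (\<exists>C. \<forall>x. \<bar>f x\<bar> \<le> C)"

lemma bdd_continuous:
  assumes "continuous_on UNIV f"
  shows "bdd f"
proof -
  have "bounded (range f)"
    by (rule compact_imp_bounded[OF compact_continuous_image[OF assms compact_UNIV]])
  then show ?thesis unfolding bdd_def bounded_iff by auto
qed

lemma bdd_between:
  assumes "\<And>x. a \<le> f x" "\<And>x. f x \<le> b"
  shows "bdd f"
proof -
  have "\<bar>f x\<bar> \<le> \<bar>a\<bar> + \<bar>b\<bar>" for x using assms(1)[of x] assms(2)[of x] by arith
  then show ?thesis unfolding bdd_def by blast
qed

lemma summable_avg:
  assumes "bdd f"
  shows "summable (\<lambda>n. (1/2) ^ Suc n * f (dense_seq n \<otimes> x))"
proof -
  obtain C where C: "\<And>x. \<bar>f x\<bar> \<le> C" using assms unfolding bdd_def by blast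
  show ?thesis
  proof (rule summable_comparison_test')
    show "summable (\<lambda>n. (1/2::real) ^ Suc n * C)"
      by (intro summable_mult2) (rule sums_summable[OF power_half_series])
    show "norm ((1/2) ^ Suc n * f (dense_seq n \<otimes> x)) \<le> (1/2) ^ Suc n * C" for n
      using C[of "dense_seq n \<otimes> x"] by (simp add: abs_mult)
  qed
qed

lemma avg_upper:
  assumes "bdd f" "\<And>x. f x \<le> b"
  shows "avg f x \<le> b - (1/2) ^ Suc n * (b - f (dense_seq n \<otimes> x))"
proof -
  let ?w = "\<lambda>n. (1/2::real) ^ Suc n" and ?y = "\<lambda>n. dense_seq n \<otimes> x"
  have s: "(\<lambda>m. ?w m * b - ?w m * f (?y m)) sums (1 * b - avg f x)"
    unfolding avg_def
    by (intro sums_diff sums_mult2 power_half_series summable_sums summable_avg assms)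
  have "(\<Sum>m\<in>{n}. ?w m * b - ?w m * f (?y m)) \<le> suminf (\<lambda>m. ?w m * b - ?w m * f (?y m))"
    by (rule sum_le_suminf[OF sums_summable[OF s]]) (auto simp: assms(2))
  then have "?w n * b - ?w n * f (?y n) \<le> 1 * b - avg f x"
    unfolding sums_unique[OF s, symmetric] by simp
  then show ?thesis by (simp add: right_diff_distrib del: power_Suc)
qed

lemma avg_add:
  assumes "bdd f" "bdd g"
  shows "avg (\<lambda>x. f x + g x) = (\<lambda>x. avg f x + avg g x)"
  unfolding avg_def by (rule ext) (simp add: suminf_add summable_avg assms distrib_left del: power_Suc)

lemma avg_scale:
  assumes "bdd f"
  shows "avg (\<lambda>x. c * f x) = (\<lambda>x. c * avg f x)"
  unfolding avg_def
  by (rule ext) (simp add: suminf_mult[OF summable_avg[OF assms], symmetric] mult.left_commute del: power_Suc)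

lemma avg_le:
  assumes "bdd f" "\<And>x. f x \<le> b"
  shows "avg f x \<le> b"
proof -
  have "avg f x \<le> b - (1/2) * (b - f (dense_seq 0 \<otimes> x))"
    using avg_upper[OF assms, of x 0] by simp
  then show ?thesis using assms(2)[of "dense_seq 0 \<otimes> x"] by argo
qed

lemma avg_ge:
  assumes "bdd f" "\<And>x. a \<le> f x"
  shows "a \<le> avg f x"
proof -
  have "bdd (\<lambda>x. (-1) * f x)" using assms(1) by (simp add: bdd_def)
  then have "avg (\<lambda>x. (-1) * f x) x \<le> - a" by (rule avg_le) (simp add: assms(2))
  then show ?thesis unfolding avg_scale[OF assms(1)] by simp
qed

lemma bdd_avg: "bdd f \<Longrightarrow> bdd (avg f)"
proof -
  assume f: "bdd f"
  then obtain C where C: "\<And>x. \<bar>f x\<bar> \<le> C" unfolding bdd_def by blast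
  have "- C \<le> avg f x" for x by (rule avg_ge[OF f]) (use C in \<open>smt (verit)\<close>)
  moreover have "avg f x \<le> C" for x by (rule avg_le[OF f]) (use C in \<open>smt (verit)\<close>)
  ultimately show "bdd (avg f)" by (rule bdd_between)
qed

lemma bdd_avg_iter: "bdd f \<Longrightarrow> bdd ((avg ^^ k) f)"
  by (induction k) (auto simp: bdd_avg)

lemma avg_iter_bounds:
  assumes "bdd f" "\<And>x. a \<le> f x" "\<And>x. f x \<le> b"
  shows "a \<le> (avg ^^ k) f x" "(avg ^^ k) f x \<le> b"
  by (induction k arbitrary: x) (auto intro: avg_le avg_ge bdd_avg_iter assms)

lemma avg_iter_translate:
  "(avg ^^ k) (\<lambda>x. f (x \<otimes> h)) x = (avg ^^ k) f (x \<otimes> h)"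
  by (induction k arbitrary: x) (auto simp: avg_def m_assoc)

lemma avg_iter_add:
  assumes "bdd f" "bdd g"
  shows "(avg ^^ k) (\<lambda>x. f x + g x) = (\<lambda>x. (avg ^^ k) f x + (avg ^^ k) g x)"
  by (induction k) (auto simp: avg_add bdd_avg_iter assms)

lemma avg_iter_scale:
  assumes "bdd f"
  shows "(avg ^^ k) (\<lambda>x. c * f x) = (\<lambda>x. c * (avg ^^ k) f x)"
  by (induction k) (auto simp: avg_scale bdd_avg_iter assms)

definition osc :: "('g \<Rightarrow> real) \<Rightarrow> real" where
  "osc f = (SUP x. f x) - (INF x. f x)"

lemma bddD:
  assumes "bdd f"
  shows "bdd_above (range f)" "bdd_below (range f)"
proof -
  obtain C where "\<And>x. \<bar>f x\<bar> \<le> C" using assms unfolding bdd_def by blast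
  then have "f x \<le> C" "- C \<le> f x" for x by (simp_all add: abs_le_iff minus_le_iff)
  then show "bdd_above (range f)" "bdd_below (range f)"
    unfolding bdd_above_def bdd_below_def by blast+
qed

lemma osc_bounds:
  assumes "bdd f"
  shows "(INF x. f x) \<le> f x" "f x \<le> (SUP x. f x)" "0 \<le> osc f"
proof -
  show 1: "(INF x. f x) \<le> f x" for x by (rule cINF_lower[OF bddD(2)[OF assms]]) simp
  show 2: "f x \<le> (SUP x. f x)" for x by (rule cSUP_upper[OF _ bddD(1)[OF assms]]) simp
  show "0 \<le> osc f" unfolding osc_def using 1[of undefined] 2[of undefined] by linarith
qed

text \<open>
  Let \<open>f\<close> be almost minimal at \<open>y\<close>. For every \<open>x\<close> one of the first \<open>N\<close> points \<open>dense_seq n \<otimes> x\<close> lies in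
  \<open>y V\<close>, where \<open>f\<close> is still almost minimal. As its weight is bounded below, it pulls the average at \<open>x\<close>
  below the supremum by a definite amount.
\<close>

lemma osc_avg_contract:
  assumes f: "bdd f" and V: "\<And>y v. v \<in> V \<Longrightarrow> \<bar>f (y \<otimes> v) - f y\<bar> \<le> e"
    and N: "\<And>x y. \<exists>n<N. inv y \<otimes> (dense_seq n \<otimes> x) \<in> V"
  shows "osc (avg f) \<le> osc f - (1/2) ^ Suc N * (osc f - e)"
proof -
  \<comment> \<open>The weight \<open>?w\<close> is a lower bound for the weights of the first \<open>N\<close> elements of the sequence.\<close>
  let ?a = "INF x. f x" and ?b = "SUP x. f x" and ?w = "(1/2::real) ^ Suc N"
  have "avg f x \<le> ?b - ?w * (?b - e - f y)" for x y
  proof -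
    obtain n where n: "n < N" "inv y \<otimes> (dense_seq n \<otimes> x) \<in> V" using N by blast
    have "y \<otimes> (inv y \<otimes> (dense_seq n \<otimes> x)) = dense_seq n \<otimes> x" by (simp flip: m_assoc)
    then have "f (dense_seq n \<otimes> x) \<le> f y + e" using V[OF n(2), of y] by simp
    then have "?w * (?b - e - f y) \<le> ?w * (?b - f (dense_seq n \<otimes> x))"
      by (intro mult_left_mono) auto
    also have "\<dots> \<le> (1/2) ^ Suc n * (?b - f (dense_seq n \<otimes> x))"
      by (rule mult_right_mono[OF power_decreasing]) (use n osc_bounds[OF f] in auto)
    finally show ?thesis using avg_upper[OF f osc_bounds(2)[OF f], of x n] by linarith
  qed
  then have *: "(avg f x - ?b) / ?w + (?b - e) \<le> f y" for x y
    by (simp add: field_simps)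
  have "(avg f x - ?b) / ?w + (?b - e) \<le> ?a" for x
    by (rule cINF_greatest) (use * in auto)
  then have "avg f x \<le> ?b - ?w * (?b - ?a - e)" for x
    by (simp add: field_simps)
  then have 1: "(SUP x. avg f x) \<le> ?b - ?w * (?b - ?a - e)"
    by (intro cSUP_least) auto
  have 2: "?a \<le> (INF x. avg f x)"
    by (rule cINF_greatest) (auto intro: avg_ge[OF f] osc_bounds[OF f])
  show ?thesis unfolding osc_def using 1 2 by linarith
qed

lemma osc_avg_le: "bdd f \<Longrightarrow> osc (avg f) \<le> osc f"
proof -
  assume f: "bdd f"
  have "(SUP x. avg f x) \<le> (SUP x. f x)"
    by (rule cSUP_least) (auto intro: avg_le[OF f] osc_bounds[OF f])
  moreover have "(INF x. f x) \<le> (INF x. avg f x)"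
    by (rule cINF_greatest) (auto intro: avg_ge[OF f] osc_bounds[OF f])
  ultimately show ?thesis by (simp add: osc_def)
qed

lemma modulus:
  fixes f :: "'g \<Rightarrow> real"
  assumes f: "continuous_on UNIV f" and e: "e > 0"
  obtains V where "open V" "\<one> \<in> V" "\<And>y v. v \<in> V \<Longrightarrow> \<bar>f (y \<otimes> v) - f y\<bar> \<le> e"
proof -
  have c: "continuous_on (UNIV \<times> UNIV) (\<lambda>p. f (snd p \<otimes> fst p))"
    by (rule continuous_on_compose2[OF f]) (intro continuous_mult_comp continuous_intros subset_UNIV)+
  obtain V where V: "\<one> \<in> V" "open V"
    "\<forall>v\<in>V \<inter> UNIV. \<forall>y\<in>UNIV. dist (f (snd (v, y) \<otimes> fst (v, y))) (f (snd (\<one>, y) \<otimes> fst (\<one>, y))) \<le> e"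
    by (rule continuous_on_prod_compactE[OF c compact_UNIV UNIV_I[of \<one>] e])
  show thesis
  proof (rule that[OF V(2,1)])
    fix y v assume "v \<in> V"
    then have "dist (f (y \<otimes> v)) (f (y \<otimes> \<one>)) \<le> e" using V(3) by simp
    then show "\<bar>f (y \<otimes> v) - f y\<bar> \<le> e" by (simp add: dist_real_def)
  qed
qed

text \<open>
  Averaging acts from the left and the modulus of continuity is taken from the right, so it is
  inherited by all iterates. Hence \<open>V\<close>, and with it the number \<open>N\<close> of steps, can be chosen once and for
  all.
\<close>

lemma modulus_avg_iter:
  assumes f: "bdd f" and V: "\<And>y v. v \<in> V \<Longrightarrow> \<bar>f (y \<otimes> v) - f y\<bar> \<le> e" and v: "v \<in> V"
  shows "\<bar>(avg ^^ k) f (y \<otimes> v) - (avg ^^ k) f y\<bar> \<le> e"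
proof -
  have b: "bdd (\<lambda>x. f (x \<otimes> v))" "bdd (\<lambda>x. (-1) * f x)" using f by (auto simp: bdd_def)
  have b': "bdd (\<lambda>x. f (x \<otimes> v) + (-1) * f x)"
    by (rule bdd_between[of "- e" _ e]) (use V[OF v] in \<open>smt (verit)\<close>)+
  have eq: "(avg ^^ k) (\<lambda>x. f (x \<otimes> v) + (-1) * f x) y = (avg ^^ k) f (y \<otimes> v) - (avg ^^ k) f y"
    by (simp only: avg_iter_add[OF b] avg_iter_scale[OF f] avg_iter_translate)
  have "- e \<le> (avg ^^ k) (\<lambda>x. f (x \<otimes> v) + (-1) * f x) y"
    by (rule avg_iter_bounds(1)[OF b', where b = e]) (use V[OF v] in \<open>smt (verit)\<close>)+
  moreover have "(avg ^^ k) (\<lambda>x. f (x \<otimes> v) + (-1) * f x) y \<le> e"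
    by (rule avg_iter_bounds(2)[OF b', where a = "- e"]) (use V[OF v] in \<open>smt (verit)\<close>)+
  ultimately show ?thesis unfolding eq by linarith
qed

text \<open>
  Each pair \<open>(x, y)\<close> is served by some \<open>n\<close>, because the elements \<open>d\<close> with \<open>d \<otimes> x \<in> y V\<close> form a
  nonempty open set. By compactness of \<open>G \<times> G\<close> finitely many \<open>n\<close> are enough.
\<close>

lemma uniform_density:
  assumes V: "open V" "\<one> \<in> V"
  obtains N where "\<And>x y. \<exists>n<N. inv y \<otimes> (dense_seq n \<otimes> x) \<in> V"
proof -
  define Q where "Q n = (\<lambda>p. inv (snd p) \<otimes> (dense_seq n \<otimes> fst p)) -` V" for n
  have Q: "open (Q n)" for n unfolding Q_def
    by (rule open_vimage[OF V(1)]) (intro continuous_mult_comp continuous_inv_comp continuous_intros)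
  have cov: "UNIV \<subseteq> (\<Union>n\<in>UNIV. Q n)"
  proof
    fix p :: "'g \<times> 'g"
    obtain x y where p: "p = (x, y)" by fastforce
    have "open ((\<lambda>d. inv y \<otimes> (d \<otimes> x)) -` V)"
      by (rule open_vimage[OF V(1)]) (intro continuous_mult_comp continuous_intros)
    moreover have "inv y \<otimes> ((y \<otimes> inv x) \<otimes> x) = \<one>" by (simp add: m_assoc)
    then have "y \<otimes> inv x \<in> (\<lambda>d. inv y \<otimes> (d \<otimes> x)) -` V" using V(2) by simp
    ultimately obtain n where "dense_seq n \<in> (\<lambda>d. inv y \<otimes> (d \<otimes> x)) -` V"
      using dense_seq by blast
    then show "p \<in> (\<Union>n\<in>UNIV. Q n)" by (auto simp: Q_def p)
  qed
  have "compact (UNIV :: ('g \<times> 'g) set)" using compact_Times[OF compact_UNIV compact_UNIV] by simp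
  then obtain C where C: "finite C" "UNIV \<subseteq> (\<Union>n\<in>C. Q n)"
    by (rule compactE_image[OF _ Q cov])
  have "\<exists>n<Suc (Max (insert 0 C)). inv y \<otimes> (dense_seq n \<otimes> x) \<in> V" for x y
  proof -
    obtain n where n: "n \<in> C" "(x, y) \<in> Q n" using C(2) by blast
    then have "n \<le> Max (insert 0 C)" using C(1) by simp
    then show ?thesis using n(2) by (auto simp: Q_def less_Suc_eq_le)
  qed
  then show thesis by (rule that)
qed

text \<open>
  The oscillations decrease to some \<open>l\<close>. For each \<open>e > 0\<close> the contraction estimate, with weights that do
  not depend on the iterate, yields \<open>l \<le> l - w (l - e)\<close> with \<open>w > 0\<close> in the limit, that is \<open>l \<le> e\<close>.
\<close>

lemma osc_avg_iter_tendsto: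
  fixes f :: "'g \<Rightarrow> real"
  assumes f: "continuous_on UNIV f"
  shows "(\<lambda>k. osc ((avg ^^ k) f)) \<longlonglongrightarrow> 0"
proof -
  have b: "bdd ((avg ^^ k) f)" for k by (rule bdd_avg_iter[OF bdd_continuous[OF f]])
  have "decseq (\<lambda>k. osc ((avg ^^ k) f))"
    by (rule decseq_SucI) (simp add: osc_avg_le[OF b])
  then obtain l where l: "(\<lambda>k. osc ((avg ^^ k) f)) \<longlonglongrightarrow> l"
    by (rule decseq_convergent[of _ 0]) (use osc_bounds(3)[OF b] in auto)
  have l0: "0 \<le> l" by (rule LIMSEQ_le_const[OF l]) (use osc_bounds(3)[OF b] in auto)
  have "l \<le> e" if e: "e > 0" for e
  proof -
    obtain V where V: "open V" "\<one> \<in> V" "\<And>y v. v \<in> V \<Longrightarrow> \<bar>f (y \<otimes> v) - f y\<bar> \<le> e"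
      by (rule modulus[OF f e]) blast
    obtain N where N: "\<And>x y. \<exists>n<N. inv y \<otimes> (dense_seq n \<otimes> x) \<in> V"
      by (rule uniform_density[OF V(1,2)]) blast
    have "osc ((avg ^^ Suc k) f) \<le> osc ((avg ^^ k) f) - (1/2) ^ Suc N * (osc ((avg ^^ k) f) - e)" for k
      using osc_avg_contract[OF b modulus_avg_iter[OF bdd_continuous[OF f] V(3)] N] by simp
    moreover have "(\<lambda>k. osc ((avg ^^ k) f) - (1/2) ^ Suc N * (osc ((avg ^^ k) f) - e))
        \<longlonglongrightarrow> l - (1/2) ^ Suc N * (l - e)"
      by (intro tendsto_intros l)
    ultimately have "l \<le> l - (1/2) ^ Suc N * (l - e)"
      by (intro LIMSEQ_le[OF LIMSEQ_Suc[OF l]]) auto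
    then have "(1/2) ^ Suc N * (l - e) \<le> 0" by linarith
    moreover have "0 < (1/2::real) ^ Suc N" by simp
    ultimately show ?thesis unfolding mult_le_0_iff by linarith
  qed
  then have "l \<le> 0" using field_le_epsilon[of l 0] by simp
  then have "l = 0" using l0 by simp
  then show ?thesis using l by simp
qed

definition haar_mean :: "('g \<Rightarrow> real) \<Rightarrow> real" where
  "haar_mean f = lim (\<lambda>k. (avg ^^ k) f \<one>)"

text \<open>
  The infima of the iterates increase and their oscillation tends to zero, so the iterates converge
  to a constant function, whose value is the mean.
\<close>

lemma avg_iter_tendsto:
  fixes f :: "'g \<Rightarrow> real"
  assumes f: "continuous_on UNIV f"
  shows "(\<lambda>k. (avg ^^ k) f x) \<longlonglongrightarrow> haar_mean f"
proof -
  have b: "bdd ((avg ^^ k) f)" for k by (rule bdd_avg_iter[OF bdd_continuous[OF f]])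
  define a where "a k = (INF x. (avg ^^ k) f x)" for k
  have a: "a k \<le> (avg ^^ k) f x" "(avg ^^ k) f x \<le> a k + osc ((avg ^^ k) f)" for k x
    using osc_bounds(1,2)[OF b[of k], of x] by (auto simp: a_def osc_def)
  have "incseq a"
  proof (rule incseq_SucI)
    show "a k \<le> a (Suc k)" for k
      unfolding a_def by (rule cINF_greatest) (auto intro!: avg_ge[OF b] osc_bounds[OF b])
  qed
  moreover have "\<exists>C. \<forall>k. a k \<le> C"
  proof -
    obtain C where C: "\<And>x. \<bar>f x\<bar> \<le> C" using bdd_continuous[OF f] unfolding bdd_def by blast
    have "(avg ^^ k) f \<one> \<le> C" for k
      by (rule avg_iter_bounds(2)[OF bdd_continuous[OF f], of "- C"]) (use C in \<open>smt (verit)\<close>)+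
    then show ?thesis using a(1) order_trans by blast
  qed
  ultimately obtain l where l: "a \<longlonglongrightarrow> l"
    by (elim exE incseq_convergent) auto
  have u: "(\<lambda>k. a k + osc ((avg ^^ k) f)) \<longlonglongrightarrow> l"
    using tendsto_add[OF l osc_avg_iter_tendsto[OF f]] by simp
  have "(\<lambda>k. (avg ^^ k) f x) \<longlonglongrightarrow> l" for x
    by (rule real_tendsto_sandwich[OF _ _ l u]) (auto simp: a)
  moreover have "haar_mean f = l" unfolding haar_mean_def by (rule limI) fact
  ultimately show ?thesis by simp
qed

lemma haar_mean_mean_on: "mean_on UNIV haar_mean"
proof -
  have scale: "haar_mean (\<lambda>t. c * f t) = c * haar_mean f" if f: "continuous_on UNIV f" for f c
  proof (rule LIMSEQ_unique[OF avg_iter_tendsto])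
    show "(\<lambda>k. (avg ^^ k) (\<lambda>t. c * f t) \<one>) \<longlonglongrightarrow> c * haar_mean f"
      unfolding avg_iter_scale[OF bdd_continuous[OF f]]
      by (intro tendsto_intros avg_iter_tendsto f)
  qed (intro continuous_intros f)
  have add: "haar_mean (\<lambda>t. f t + g t) = haar_mean f + haar_mean g"
    if f: "continuous_on UNIV f" and g: "continuous_on UNIV g" for f g
  proof (rule LIMSEQ_unique[OF avg_iter_tendsto])
    show "(\<lambda>k. (avg ^^ k) (\<lambda>t. f t + g t) \<one>) \<longlonglongrightarrow> haar_mean f + haar_mean g"
      unfolding avg_iter_add[OF bdd_continuous[OF f] bdd_continuous[OF g]]
      by (intro tendsto_intros avg_iter_tendsto f g)
  qed (intro continuous_intros f g)
  have bound: "\<bar>haar_mean f\<bar> \<le> M" if f: "continuous_on UNIV f" and M: "\<And>t. \<bar>f t\<bar> \<le> M" for f M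
  proof (rule LIMSEQ_le_const2[OF tendsto_rabs[OF avg_iter_tendsto[OF f, of \<one>]]], intro exI allI impI)
    have fM: "- M \<le> f t" "f t \<le> M" for t using M[of t] by linarith+
    show "\<bar>(avg ^^ k) f \<one>\<bar> \<le> M" for k
      using avg_iter_bounds[OF bdd_continuous[OF f] fM, of k \<one>] by linarith
  qed
  show ?thesis unfolding mean_on_def
  proof (intro conjI allI impI, goal_cases)
    case (1 f g)
    then show ?case by (rule add)
  next
    case (2 f c)
    then show ?case by (rule scale)
  next
    case (3 f M)
    then show ?case by (intro bound) simp_all
  qed
qed

lemma haar_mean_translate:
  fixes f :: "'g \<Rightarrow> real"
  assumes f: "continuous_on UNIV f"
  shows "haar_mean (\<lambda>g. f (g \<otimes> h)) = haar_mean f"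
proof (rule LIMSEQ_unique[OF avg_iter_tendsto])
  show "continuous_on UNIV (\<lambda>g. f (g \<otimes> h))"
    by (rule continuous_on_compose2[OF f, where s = UNIV])
      (auto intro: continuous_mult_comp)
  show "(\<lambda>k. (avg ^^ k) (\<lambda>g. f (g \<otimes> h)) \<one>) \<longlonglongrightarrow> haar_mean f"
    unfolding avg_iter_translate[of _ f h] by (rule avg_iter_tendsto[OF f])
qed

lemma haar_mean_const: "haar_mean (\<lambda>g. c) = c"
proof (rule LIMSEQ_unique[OF avg_iter_tendsto])
  have b: "bdd (\<lambda>g. c)" unfolding bdd_def by (intro exI allI) (rule order_refl)
  have "(avg ^^ k) (\<lambda>g. c) \<one> = c" for k
    by (rule antisym) (rule avg_iter_bounds[OF b order_refl order_refl])+
  then show "(\<lambda>k. (avg ^^ k) (\<lambda>g. c) \<one>) \<longlonglongrightarrow> c" by simp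
qed simp

end

section \<open>Quotients of Poisson algebras\<close>

lemma real_ring_simps [simp]:
  "carrier real_ring = UNIV" "a \<otimes>\<^bsub>real_ring\<^esub> b = a * b" "a \<oplus>\<^bsub>real_ring\<^esub> b = a + b"
  "\<one>\<^bsub>real_ring\<^esub> = 1" "\<zero>\<^bsub>real_ring\<^esub> = 0"
  by (simp_all add: ring_of_type_algebra_def)

text \<open>
  All axioms are equations apart from closure and the existence of negatives, so they pass to
  surjective images.
\<close>

lemma poisson_algebra_image:
  fixes P :: "('a, 'y) poisson_scheme" and Q :: "('b, 'z) poisson_scheme"
  assumes P: "poisson_algebra P" and surj: "\<pi> ` carrier P = carrier Q"
    and mult: "\<And>x y. x \<in> carrier P \<Longrightarrow> y \<in> carrier P \<Longrightarrow> \<pi> (x \<otimes>\<^bsub>P\<^esub> y) = \<pi> x \<otimes>\<^bsub>Q\<^esub> \<pi> y"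
    and add: "\<And>x y. x \<in> carrier P \<Longrightarrow> y \<in> carrier P \<Longrightarrow> \<pi> (x \<oplus>\<^bsub>P\<^esub> y) = \<pi> x \<oplus>\<^bsub>Q\<^esub> \<pi> y"
    and one: "\<pi> \<one>\<^bsub>P\<^esub> = \<one>\<^bsub>Q\<^esub>" and zero: "\<pi> \<zero>\<^bsub>P\<^esub> = \<zero>\<^bsub>Q\<^esub>"
    and smult: "\<And>a x. x \<in> carrier P \<Longrightarrow> \<pi> (a \<odot>\<^bsub>P\<^esub> x) = a \<odot>\<^bsub>Q\<^esub> \<pi> x"
    and br: "\<And>x y. x \<in> carrier P \<Longrightarrow> y \<in> carrier P \<Longrightarrow> \<pi> (pbracket P x y) = pbracket Q (\<pi> x) (\<pi> y)"
  shows "poisson_algebra Q"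
proof -
  interpret P: poisson_algebra P by (rule P)
  have ex: "\<exists>x\<in>carrier P. y = \<pi> x" if "y \<in> carrier Q" for y using that surj by blast
  have cl: "\<pi> x \<in> carrier Q" if "x \<in> carrier P" for x using that surj by blast
  note r = mult[symmetric] add[symmetric] one[symmetric] zero[symmetric] smult[symmetric] br[symmetric]
  have sc: "a \<odot>\<^bsub>P\<^esub> x \<in> carrier P" if "x \<in> carrier P" for a x
    using P.smult_closed[of a x] that by simp
  have ag: "abelian_group Q"
  proof (rule abelian_groupI)
    show "\<zero>\<^bsub>Q\<^esub> \<in> carrier Q" using cl[of "\<zero>\<^bsub>P\<^esub>"] by (simp add: zero)
    show "\<exists>y\<in>carrier Q. y \<oplus>\<^bsub>Q\<^esub> x = \<zero>\<^bsub>Q\<^esub>" if x: "x \<in> carrier Q" for x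
    proof -
      obtain a where a: "a \<in> carrier P" "x = \<pi> a" using ex[OF x] by blast
      have "\<pi> (\<ominus>\<^bsub>P\<^esub> a) \<oplus>\<^bsub>Q\<^esub> x = \<zero>\<^bsub>Q\<^esub>" unfolding a(2) using a(1) by (simp add: r P.l_neg)
      then show ?thesis using cl[of "\<ominus>\<^bsub>P\<^esub> a"] a(1) by blast
    qed
  qed (auto dest!: ex simp: r cl P.add.m_ac)
  have cr: "cring Q"
  proof (rule cringI[OF ag])
    show "Group.comm_monoid Q"
      by (rule comm_monoidI) (use cl[of "\<one>\<^bsub>P\<^esub>"] in \<open>auto dest!: ex simp: r cl P.m_assoc P.m_comm P.m_lcomm\<close>)
  qed (auto dest!: ex simp: r P.l_distr)
  interpret Q: cring Q by (rule cr)
  have neg: "\<pi> (\<ominus>\<^bsub>P\<^esub> x) = \<ominus>\<^bsub>Q\<^esub> \<pi> x" if "x \<in> carrier P" for x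
  proof (rule sym, rule Q.minus_equality)
    show "\<pi> (\<ominus>\<^bsub>P\<^esub> x) \<oplus>\<^bsub>Q\<^esub> \<pi> x = \<zero>\<^bsub>Q\<^esub>" using that by (simp add: r P.l_neg)
  qed (use that cl in auto)
  have "Module.module real_ring Q"
    by (rule moduleI[OF P.R.is_cring ag])
      (auto dest!: ex simp: r cl sc P.smult_l_distr[simplified] P.smult_r_distr[simplified]
        P.smult_assoc1[simplified] P.smult_one[simplified])
  then have "Module.algebra real_ring Q"
    by (intro algebra.intro algebra_axioms.intro cr)
      (auto dest!: ex simp: r cl sc P.smult_assoc2[simplified])
  then show ?thesis
  proof (intro poisson_algebra.intro poisson_algebra_axioms.intro)
    fix x y z a assume x: "x \<in> carrier Q" and y: "y \<in> carrier Q"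
    obtain x' y' where xy: "x' \<in> carrier P" "x = \<pi> x'" "y' \<in> carrier P" "y = \<pi> y'"
      using ex x y by metis
    note bc = P.bracket_closed
    show "pbracket Q x y \<in> carrier Q" using xy by (simp add: r cl bc)
    show "pbracket Q (a \<odot>\<^bsub>Q\<^esub> x) y = a \<odot>\<^bsub>Q\<^esub> pbracket Q x y"
      using xy by (simp add: r cl bc sc P.bracket_smult)
    show "pbracket Q x y = \<ominus>\<^bsub>Q\<^esub> pbracket Q y x"
      using xy P.bracket_antisym[of x' y'] by (simp add: r cl bc neg[symmetric])
    assume z: "z \<in> carrier Q"
    then obtain z' where z': "z' \<in> carrier P" "z = \<pi> z'" using ex by metis
    show "pbracket Q (x \<oplus>\<^bsub>Q\<^esub> y) z = pbracket Q x z \<oplus>\<^bsub>Q\<^esub> pbracket Q y z"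
      using xy z' by (simp add: r bc P.bracket_add)
    show "pbracket Q x (pbracket Q y z) \<oplus>\<^bsub>Q\<^esub> pbracket Q y (pbracket Q z x)
         \<oplus>\<^bsub>Q\<^esub> pbracket Q z (pbracket Q x y) = \<zero>\<^bsub>Q\<^esub>"
      using xy z' by (simp add: r bc P.bracket_jacobi)
    show "pbracket Q x (y \<otimes>\<^bsub>Q\<^esub> z) = pbracket Q x y \<otimes>\<^bsub>Q\<^esub> z \<oplus>\<^bsub>Q\<^esub> y \<otimes>\<^bsub>Q\<^esub> pbracket Q x z"
      using xy z' by (simp add: r bc P.bracket_leibniz)
  qed
qed

definition poisson_subalgebra :: "'b set \<Rightarrow> ('b, 'z) poisson_scheme \<Rightarrow> bool" where
  "poisson_subalgebra N P \<longleftrightarrow> N \<subseteq> carrier P \<and> \<one>\<^bsub>P\<^esub> \<in> N \<and>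
     (\<forall>x\<in>N. \<forall>y\<in>N. x \<oplus>\<^bsub>P\<^esub> y \<in> N \<and> x \<otimes>\<^bsub>P\<^esub> y \<in> N \<and> pbracket P x y \<in> N) \<and>
     (\<forall>a. \<forall>x\<in>N. a \<odot>\<^bsub>P\<^esub> x \<in> N)"

lemma (in poisson_algebra) smult_carrier: "x \<in> carrier P \<Longrightarrow> a \<odot>\<^bsub>P\<^esub> x \<in> carrier P"
  using smult_closed[of a x] by simp

lemma (in poisson_algebra) smult_zero: "x \<in> carrier P \<Longrightarrow> 0 \<odot>\<^bsub>P\<^esub> x = \<zero>\<^bsub>P\<^esub>"
  using smult_l_null[of x] by simp

lemma (in poisson_algebra) smult_minus_one: "x \<in> carrier P \<Longrightarrow> (-1) \<odot>\<^bsub>P\<^esub> x = \<ominus>\<^bsub>P\<^esub> x"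
proof -
  assume x: "x \<in> carrier P"
  have "(-1) \<odot>\<^bsub>P\<^esub> x \<oplus>\<^bsub>P\<^esub> x = ((-1) + 1) \<odot>\<^bsub>P\<^esub> x"
    using smult_l_distr[of "-1" 1 x] smult_one[of x] x by simp
  then have "(-1) \<odot>\<^bsub>P\<^esub> x \<oplus>\<^bsub>P\<^esub> x = \<zero>\<^bsub>P\<^esub>" using smult_zero[OF x] by simp
  then show ?thesis using M.minus_equality[of "(-1) \<odot>\<^bsub>P\<^esub> x" x] x smult_carrier by simp
qed

lemma poisson_algebra_subalgebra:
  fixes P :: "('b, 'z) poisson_scheme"
  assumes P: "poisson_algebra P" and N: "poisson_subalgebra N P"
  shows "poisson_algebra (P\<lparr>carrier := N\<rparr>)" (is "poisson_algebra ?Q")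
proof -
  interpret P: poisson_algebra P by (rule P)
  have sub: "x \<in> carrier P" if "x \<in> N" for x using N that unfolding poisson_subalgebra_def by blast
  have cl: "\<one>\<^bsub>P\<^esub> \<in> N" "\<And>x y. x \<in> N \<Longrightarrow> y \<in> N \<Longrightarrow> x \<oplus>\<^bsub>P\<^esub> y \<in> N"
    "\<And>x y. x \<in> N \<Longrightarrow> y \<in> N \<Longrightarrow> x \<otimes>\<^bsub>P\<^esub> y \<in> N"
    "\<And>x y. x \<in> N \<Longrightarrow> y \<in> N \<Longrightarrow> pbracket P x y \<in> N"
    "\<And>a x. x \<in> N \<Longrightarrow> a \<odot>\<^bsub>P\<^esub> x \<in> N"
    using N unfolding poisson_subalgebra_def by blast+
  have zero: "\<zero>\<^bsub>P\<^esub> \<in> N" using cl(5)[OF cl(1), of 0] P.smult_zero by simp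
  have neg: "\<ominus>\<^bsub>P\<^esub> x \<in> N" if "x \<in> N" for x
    using cl(5)[OF that, of "-1"] P.smult_minus_one[OF sub[OF that]] by simp
  have ag: "abelian_group ?Q"
  proof (rule abelian_groupI)
    show "\<exists>y\<in>carrier ?Q. y \<oplus>\<^bsub>?Q\<^esub> x = \<zero>\<^bsub>?Q\<^esub>" if "x \<in> carrier ?Q" for x
      using that neg[of x] by (auto intro!: bexI[of _ "\<ominus>\<^bsub>P\<^esub> x"] simp: P.l_neg sub)
  qed (auto simp: cl zero sub P.add.m_ac)
  have cr: "cring ?Q"
  proof (rule cringI[OF ag])
    show "Group.comm_monoid ?Q"
      by (rule comm_monoidI) (auto simp: cl sub P.m_assoc P.m_comm P.m_lcomm)
  qed (auto simp: sub P.l_distr)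
  interpret Q: cring ?Q by (rule cr)
  have minus: "\<ominus>\<^bsub>?Q\<^esub> x = \<ominus>\<^bsub>P\<^esub> x" if "x \<in> N" for x
    by (rule Q.minus_equality) (use that neg sub in \<open>auto simp: P.l_neg\<close>)
  have "Module.module real_ring ?Q"
    by (rule moduleI[OF P.R.is_cring ag])
      (auto simp: cl sub P.smult_l_distr[simplified] P.smult_r_distr[simplified]
        P.smult_assoc1[simplified] P.smult_one[simplified])
  then have "Module.algebra real_ring ?Q"
    by (intro algebra.intro algebra_axioms.intro cr)
      (auto simp: cl sub P.smult_assoc2[simplified])
  then show ?thesis
    by (intro poisson_algebra.intro poisson_algebra_axioms.intro)
      (auto simp: cl sub minus P.bracket_add P.bracket_smult P.bracket_jacobi P.bracket_leibniz
        intro: P.bracket_antisym)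
qed

text \<open>
  Closure under scalar multiples and negatives follows, since these are products with multiples of
  the unit.
\<close>

definition poisson_ideal :: "'b set \<Rightarrow> ('b, 'z) poisson_scheme \<Rightarrow> bool" where
  "poisson_ideal I P \<longleftrightarrow> I \<subseteq> carrier P \<and> \<zero>\<^bsub>P\<^esub> \<in> I \<and> (\<forall>x\<in>I. \<forall>y\<in>I. x \<oplus>\<^bsub>P\<^esub> y \<in> I) \<and>
     (\<forall>x\<in>carrier P. \<forall>y\<in>I. x \<otimes>\<^bsub>P\<^esub> y \<in> I \<and> pbracket P x y \<in> I)"

lemma poisson_ideal_ideal:
  fixes P :: "('b, 'z) poisson_scheme"
  assumes P: "poisson_algebra P" and I: "poisson_ideal I P"
  shows "ideal I P"
proof -
  interpret P: poisson_algebra P by (rule P)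
  have I': "I \<subseteq> carrier P" "\<zero>\<^bsub>P\<^esub> \<in> I" "\<And>x y. x \<in> I \<Longrightarrow> y \<in> I \<Longrightarrow> x \<oplus>\<^bsub>P\<^esub> y \<in> I"
    "\<And>x y. x \<in> carrier P \<Longrightarrow> y \<in> I \<Longrightarrow> x \<otimes>\<^bsub>P\<^esub> y \<in> I"
    using I unfolding poisson_ideal_def by blast+
  have neg: "\<ominus>\<^bsub>P\<^esub> x \<in> I" if "x \<in> I" for x
  proof -
    have "(\<ominus>\<^bsub>P\<^esub> \<one>\<^bsub>P\<^esub>) \<otimes>\<^bsub>P\<^esub> x \<in> I" by (rule I'(4)) (use that in auto)
    moreover have "x \<in> carrier P" using I'(1) that by blast
    ultimately show ?thesis by (simp add: P.l_minus)
  qed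
  show ?thesis
  proof (rule idealI)
    show "ring P" using P by (simp add: poisson_algebra_def Module.algebra_def cring.axioms(1))
    show "subgroup I (add_monoid P)"
      by (rule P.add.subgroupI) (use I' neg in \<open>auto simp: a_inv_def\<close>)
    show "x \<otimes>\<^bsub>P\<^esub> a \<in> I" if "a \<in> I" "x \<in> carrier P" for a x using I'(4) that by blast
    then show "a \<otimes>\<^bsub>P\<^esub> x \<in> I" if "a \<in> I" "x \<in> carrier P" for a x
      using that I'(1) P.m_comm by (metis subsetD)
  qed
qed

text \<open>
  The operations of the quotient are unions over representatives. For a Poisson ideal all
  members of such a union coincide, so the projection preserves the operations.
\<close>

lemma poisson_quot_projection:
  fixes P :: "('b, 'z) poisson_scheme"
  assumes P: "poisson_algebra P" and I: "poisson_ideal I P"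
  defines "\<pi> \<equiv> \<lambda>x. I +>\<^bsub>P\<^esub> x" and "Q \<equiv> poisson_quot P I"
  shows "\<pi> ` carrier P = carrier Q"
    and "\<And>x y. x \<in> carrier P \<Longrightarrow> y \<in> carrier P \<Longrightarrow> \<pi> (x \<otimes>\<^bsub>P\<^esub> y) = \<pi> x \<otimes>\<^bsub>Q\<^esub> \<pi> y"
    and "\<And>x y. x \<in> carrier P \<Longrightarrow> y \<in> carrier P \<Longrightarrow> \<pi> (x \<oplus>\<^bsub>P\<^esub> y) = \<pi> x \<oplus>\<^bsub>Q\<^esub> \<pi> y"
    and "\<pi> \<one>\<^bsub>P\<^esub> = \<one>\<^bsub>Q\<^esub>" and "\<pi> \<zero>\<^bsub>P\<^esub> = \<zero>\<^bsub>Q\<^esub>"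
    and "\<And>a x. x \<in> carrier P \<Longrightarrow> \<pi> (a \<odot>\<^bsub>P\<^esub> x) = a \<odot>\<^bsub>Q\<^esub> \<pi> x"
    and "\<And>x y. x \<in> carrier P \<Longrightarrow> y \<in> carrier P \<Longrightarrow> \<pi> (pbracket P x y) = pbracket Q (\<pi> x) (\<pi> y)"
proof -
  interpret P: poisson_algebra P by (rule P)
  interpret I: ideal I P by (rule poisson_ideal_ideal[OF P I])
  have brI: "pbracket P x i \<in> I" if "x \<in> carrier P" "i \<in> I" for x i
    using I that unfolding poisson_ideal_def by blast
  have brI': "pbracket P i x \<in> I" if "x \<in> carrier P" "i \<in> I" for x i
    using P.bracket_antisym[of i x] brI[OF that] that I.a_inv_closed by (simp add: I.Icarr)
  have coset: "\<pi> (i \<oplus>\<^bsub>P\<^esub> x) = \<pi> x" if "i \<in> I" "x \<in> carrier P" for i x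
    unfolding \<pi>_def
    by (rule sym, rule I.a_repr_independence') (use that in \<open>auto simp: a_r_coset_def'\<close>)
  have mem: "\<exists>i\<in>I. x' = i \<oplus>\<^bsub>P\<^esub> x" if "x' \<in> \<pi> x" for x x'
    using that by (auto simp: \<pi>_def a_r_coset_def')
  have self: "x \<in> \<pi> x" if "x \<in> carrier P" for x unfolding \<pi>_def by (rule I.a_rcos_self[OF that])
  show "\<pi> ` carrier P = carrier Q"
    by (auto simp: \<pi>_def Q_def poisson_quot_def A_RCOSETS_def')
  show "\<pi> \<one>\<^bsub>P\<^esub> = \<one>\<^bsub>Q\<^esub>" by (simp add: \<pi>_def Q_def poisson_quot_def)
  show "\<pi> \<zero>\<^bsub>P\<^esub> = \<zero>\<^bsub>Q\<^esub>"
    using P.M.a_coset_join2[OF _ I.a_subgroup, of "\<zero>\<^bsub>P\<^esub>"] by (simp add: \<pi>_def Q_def poisson_quot_def)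
  fix x assume x: "x \<in> carrier P"
  show "\<pi> (a \<odot>\<^bsub>P\<^esub> x) = a \<odot>\<^bsub>Q\<^esub> \<pi> x" for a
  proof -
    have "\<pi> (a \<odot>\<^bsub>P\<^esub> x') = \<pi> (a \<odot>\<^bsub>P\<^esub> x)" if x': "x' \<in> \<pi> x" for x'
    proof -
      obtain i where i: "i \<in> I" "x' = i \<oplus>\<^bsub>P\<^esub> x" using mem[OF x'] by blast
      have "a \<odot>\<^bsub>P\<^esub> i = (a \<odot>\<^bsub>P\<^esub> \<one>\<^bsub>P\<^esub>) \<otimes>\<^bsub>P\<^esub> i"
        using P.smult_assoc2[of a "\<one>\<^bsub>P\<^esub>" i] i by (simp add: I.Icarr)
      then have "a \<odot>\<^bsub>P\<^esub> i \<in> I" using I.I_l_closed[OF i(1)] P.smult_carrier by simp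
      then show ?thesis
        using coset[of "a \<odot>\<^bsub>P\<^esub> i" "a \<odot>\<^bsub>P\<^esub> x"] P.smult_r_distr[of a i x] i x
        by (simp add: I.Icarr P.smult_carrier)
    qed
    then have "(\<Union>x'\<in>\<pi> x. \<pi> (a \<odot>\<^bsub>P\<^esub> x')) = \<pi> (a \<odot>\<^bsub>P\<^esub> x)" using self[OF x] by blast
    then show ?thesis by (simp add: \<pi>_def Q_def poisson_quot_def)
  qed
  fix y assume y: "y \<in> carrier P"
  show "\<pi> (x \<otimes>\<^bsub>P\<^esub> y) = \<pi> x \<otimes>\<^bsub>Q\<^esub> \<pi> y"
    using I.rcoset_mult_add[OF x y] by (simp add: \<pi>_def Q_def poisson_quot_def)
  show "\<pi> (x \<oplus>\<^bsub>P\<^esub> y) = \<pi> x \<oplus>\<^bsub>Q\<^esub> \<pi> y"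
    using I.a_rcos_sum[OF x y] by (simp add: \<pi>_def Q_def poisson_quot_def)
  show "\<pi> (pbracket P x y) = pbracket Q (\<pi> x) (\<pi> y)"
  proof -
    have "\<pi> (pbracket P x' y') = \<pi> (pbracket P x y)" if x': "x' \<in> \<pi> x" and y': "y' \<in> \<pi> y" for x' y'
    proof -
      obtain i j where i: "i \<in> I" "x' = i \<oplus>\<^bsub>P\<^esub> x" and j: "j \<in> I" "y' = j \<oplus>\<^bsub>P\<^esub> y"
        using mem[OF x'] mem[OF y'] by blast
      have cI: "i \<in> carrier P" "j \<in> carrier P" using i j I.Icarr by auto
      have x'P: "x' \<in> carrier P" "y' \<in> carrier P" using i j x y cI by auto
      note bc = P.bracket_closed
      have radd: "pbracket P u (v \<oplus>\<^bsub>P\<^esub> w) = pbracket P u v \<oplus>\<^bsub>P\<^esub> pbracket P u w"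
        if "u \<in> carrier P" "v \<in> carrier P" "w \<in> carrier P" for u v w
        using that P.bracket_antisym[of u "v \<oplus>\<^bsub>P\<^esub> w"] P.bracket_antisym[of u v] P.bracket_antisym[of u w]
          P.bracket_add[of v w u] by (simp add: bc P.M.minus_add)
      have 1: "pbracket P x' y' = pbracket P i y' \<oplus>\<^bsub>P\<^esub> pbracket P x y'"
        unfolding i(2) by (rule P.bracket_add) (use cI x x'P in auto)
      have 2: "pbracket P x y' = pbracket P x j \<oplus>\<^bsub>P\<^esub> pbracket P x y"
        unfolding j(2) by (rule radd) (use cI x y in auto)
      have "\<pi> (pbracket P x' y') = \<pi> (pbracket P x y')"
        unfolding 1 by (rule coset) (use brI'[OF x'P(2) i(1)] bc[OF x x'P(2)] in auto)
      also have "\<dots> = \<pi> (pbracket P x y)"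
        unfolding 2 by (rule coset) (use brI[OF x j(1)] bc[OF x y] in auto)
      finally show ?thesis .
    qed
    then have "(\<Union>x'\<in>\<pi> x. \<Union>y'\<in>\<pi> y. \<pi> (pbracket P x' y')) = \<pi> (pbracket P x y)"
      using self[OF x] self[OF y] by blast
    then show ?thesis by (simp add: \<pi>_def Q_def poisson_quot_def)
  qed
qed

lemma poisson_algebra_quot:
  assumes "poisson_algebra P" "poisson_ideal I P"
  shows "poisson_algebra (poisson_quot P I)"
  by (rule poisson_algebra_image[OF assms(1) poisson_quot_projection[OF assms]])

text \<open>
  The isomorphism sends a coset \<open>K\<close> of \<open>I\<close> to \<open>K \<inter> C\<close>. By assumption \<open>K\<close> contains some \<open>c \<in> C\<close>, and then
  \<open>K \<inter> C = I \<inter> C + c\<close>; so the map is compatible with the projections from \<open>C\<close> to the two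
  quotients, and everything else is read off from representatives in \<open>C\<close>.
\<close>

lemma poisson_second_isomorphism:
  fixes P :: "('b, 'z) poisson_scheme"
  assumes P: "poisson_algebra P" and C: "poisson_subalgebra C P"
    and I: "poisson_ideal I P" and cover: "\<And>x. x \<in> carrier P \<Longrightarrow> \<exists>i\<in>I. \<exists>c\<in>C. x = i \<oplus>\<^bsub>P\<^esub> c"
  shows "isomorphic_poisson_algebras (poisson_quot P I) (poisson_quot (P\<lparr>carrier := C\<rparr>) (I \<inter> C))"
proof -
  let ?C = "P\<lparr>carrier := C\<rparr>"
  let ?Q = "poisson_quot P I" and ?R = "poisson_quot ?C (I \<inter> C)"
  let ?\<pi> = "\<lambda>x. I +>\<^bsub>P\<^esub> x" and ?\<rho> = "\<lambda>x. (I \<inter> C) +>\<^bsub>?C\<^esub> x"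
  interpret P: poisson_algebra P by (rule P)
  interpret C: poisson_algebra ?C by (rule poisson_algebra_subalgebra[OF P C])
  interpret I: ideal I P by (rule poisson_ideal_ideal[OF P I])
  have CP: "x \<in> carrier P" if "x \<in> C" for x using C that unfolding poisson_subalgebra_def by blast
  have Ccl: "\<one>\<^bsub>P\<^esub> \<in> C" "\<And>x y. x \<in> C \<Longrightarrow> y \<in> C \<Longrightarrow> x \<oplus>\<^bsub>P\<^esub> y \<in> C"
    "\<And>x y. x \<in> C \<Longrightarrow> y \<in> C \<Longrightarrow> x \<otimes>\<^bsub>P\<^esub> y \<in> C"
    "\<And>x y. x \<in> C \<Longrightarrow> y \<in> C \<Longrightarrow> pbracket P x y \<in> C"
    "\<And>a x. x \<in> C \<Longrightarrow> a \<odot>\<^bsub>P\<^esub> x \<in> C"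
    using C unfolding poisson_subalgebra_def by blast+
  have IC: "poisson_ideal (I \<inter> C) ?C"
    using I C CP C.zero_closed unfolding poisson_ideal_def poisson_subalgebra_def by auto
  note pQ = poisson_quot_projection[OF P I] and pR = poisson_quot_projection[OF C.poisson_algebra_axioms IC]
  have \<rho>: "?\<pi> c \<inter> C = ?\<rho> c" if c: "c \<in> C" for c
  proof
    show "?\<rho> c \<subseteq> ?\<pi> c \<inter> C" using Ccl(2) c by (auto simp: a_r_coset_def')
    show "?\<pi> c \<inter> C \<subseteq> ?\<rho> c"
    proof
      fix x assume "x \<in> ?\<pi> c \<inter> C"
      then obtain i where i: "i \<in> I" "x = i \<oplus>\<^bsub>P\<^esub> c" "x \<in> C" by (auto simp: a_r_coset_def')
      have iP: "i \<in> carrier P" "c \<in> carrier P" using i(1) I.Icarr CP c by auto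
      have "(-1) \<odot>\<^bsub>P\<^esub> c \<in> C" by (rule Ccl(5)[OF c])
      then have "x \<oplus>\<^bsub>P\<^esub> (\<ominus>\<^bsub>P\<^esub> c) \<in> C" using Ccl(2)[OF i(3)] P.smult_minus_one[OF iP(2)] by simp
      moreover have "x \<oplus>\<^bsub>P\<^esub> (\<ominus>\<^bsub>P\<^esub> c) = i"
        unfolding i(2) using iP by (simp add: P.add.m_assoc P.r_neg)
      ultimately show "x \<in> ?\<rho> c" using i by (auto simp: a_r_coset_def')
    qed
  qed
  have rep: "\<exists>c\<in>C. K = ?\<pi> c" if "K \<in> carrier ?Q" for K
  proof -
    have "K \<in> ?\<pi> ` carrier P" using that by (simp only: pQ(1))
    then obtain x where x: "x \<in> carrier P" "K = ?\<pi> x" by blast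
    obtain i c where ic: "i \<in> I" "c \<in> C" "x = i \<oplus>\<^bsub>P\<^esub> c" using cover[OF x(1)] by blast
    have "?\<pi> c = ?\<pi> x"
      by (rule I.a_repr_independence') (use ic CP in \<open>auto simp: a_r_coset_def'\<close>)
    then show ?thesis using ic x by blast
  qed
  define \<Phi> where "\<Phi> K = K \<inter> C" for K
  have \<Phi>: "\<Phi> (?\<pi> c) = ?\<rho> c" if "c \<in> C" for c using \<rho>[OF that] by (simp add: \<Phi>_def)
  have Rcl: "?\<rho> c \<in> carrier ?R" if "c \<in> C" for c using pR(1) that by auto
  have "\<Phi> \<in> ring_hom ?Q ?R"
  proof (rule ring_hom_memI)
    fix K assume "K \<in> carrier ?Q"
    then obtain c where c: "c \<in> C" "K = ?\<pi> c" using rep by blast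
    show "\<Phi> K \<in> carrier ?R" using c \<Phi> Rcl by simp
    fix L assume "L \<in> carrier ?Q"
    then obtain d where d: "d \<in> C" "L = ?\<pi> d" using rep by blast
    show "\<Phi> (K \<otimes>\<^bsub>?Q\<^esub> L) = \<Phi> K \<otimes>\<^bsub>?R\<^esub> \<Phi> L"
      unfolding c(2) d(2) \<Phi>[OF c(1)] \<Phi>[OF d(1)]
      using pQ(2)[of c d, symmetric] pR(2)[of c d, symmetric] c d CP Ccl \<Phi> by simp
    show "\<Phi> (K \<oplus>\<^bsub>?Q\<^esub> L) = \<Phi> K \<oplus>\<^bsub>?R\<^esub> \<Phi> L"
      unfolding c(2) d(2) \<Phi>[OF c(1)] \<Phi>[OF d(1)]
      using pQ(3)[of c d, symmetric] pR(3)[of c d, symmetric] c d CP Ccl \<Phi> by simp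
  next
    show "\<Phi> \<one>\<^bsub>?Q\<^esub> = \<one>\<^bsub>?R\<^esub>" using pQ(4) pR(4) \<Phi>[OF Ccl(1)] by simp
  qed
  moreover have "bij_betw \<Phi> (carrier ?Q) (carrier ?R)"
  proof (rule bij_betwI')
    fix K L assume "K \<in> carrier ?Q" "L \<in> carrier ?Q"
    then obtain c d where cd: "c \<in> C" "K = ?\<pi> c" "d \<in> C" "L = ?\<pi> d" using rep by blast
    show "\<Phi> K = \<Phi> L \<longleftrightarrow> K = L"
    proof
      assume eq: "\<Phi> K = \<Phi> L"
      have "c \<in> \<Phi> K" using I.a_rcos_self[OF CP[OF cd(1)]] cd by (simp add: \<Phi>_def)
      then have "c \<in> \<Phi> L" using eq by simp
      then have "c \<in> ?\<pi> d" unfolding \<Phi>_def cd(4) by blast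
      then show "K = L" using I.a_repr_independence'[OF _ CP[OF cd(3)]] cd by simp
    qed simp
  next
    fix K assume "K \<in> carrier ?Q"
    then obtain c where c: "c \<in> C" "K = ?\<pi> c" using rep by blast
    then show "\<Phi> K \<in> carrier ?R" using \<Phi> Rcl by simp
  next
    fix L assume "L \<in> carrier ?R"
    then have "L \<in> ?\<rho> ` carrier ?C" by (simp only: pR(1))
    then obtain c where c: "c \<in> C" "L = ?\<rho> c" by auto
    then have "?\<pi> c \<in> carrier ?Q" "L = \<Phi> (?\<pi> c)" using pQ(1) CP \<Phi> by auto
    then show "\<exists>K\<in>carrier ?Q. L = \<Phi> K" by blast
  qed
  moreover have "\<Phi> (a \<odot>\<^bsub>?Q\<^esub> K) = a \<odot>\<^bsub>?R\<^esub> \<Phi> K" if K: "K \<in> carrier ?Q" for a K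
  proof -
    obtain c where c: "c \<in> C" "K = ?\<pi> c" using rep[OF K] by blast
    show ?thesis unfolding c(2) \<Phi>[OF c(1)]
      using pQ(6)[of c a, symmetric] pR(6)[of c a, symmetric] c CP Ccl \<Phi> by simp
  qed
  moreover have "\<Phi> (pbracket ?Q K L) = pbracket ?R (\<Phi> K) (\<Phi> L)"
    if KL: "K \<in> carrier ?Q" "L \<in> carrier ?Q" for K L
  proof -
    obtain c d where cd: "c \<in> C" "K = ?\<pi> c" "d \<in> C" "L = ?\<pi> d"
      using rep[OF KL(1)] rep[OF KL(2)] by blast
    show ?thesis unfolding cd(2,4) \<Phi>[OF cd(1)] \<Phi>[OF cd(3)]
      using pQ(7)[of c d, symmetric] pR(7)[of c d, symmetric] cd CP Ccl \<Phi> by simp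
  qed
  ultimately have "\<Phi> \<in> poisson_iso ?Q ?R" by (auto simp: poisson_iso_def ring_iso_def)
  then show ?thesis unfolding isomorphic_poisson_algebras_def
    using poisson_algebra_quot[OF P I] poisson_algebra_quot[OF C.poisson_algebra_axioms IC] by blast
qed

section \<open>Tangent vectors in charts\<close>

lemma tangent_spaceD:
  assumes "v \<in> tangent_space A x" "f \<in> smooth_functions A"
  shows "g \<in> smooth_functions A \<Longrightarrow> v (\<lambda>p. f p + g p) = v f + v g"
    "g \<in> smooth_functions A \<Longrightarrow> v (\<lambda>p. f p * g p) = f x * v g + g x * v f"
    "v (\<lambda>p. c * f p) = c * v f"
  using assms unfolding tangent_space_def by auto

lemma tangent_space_const:
  assumes A: "smooth_manifold A" and v: "v \<in> tangent_space A x"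
  shows "v (\<lambda>p. c) = 0"
proof -
  note one = smooth_functions_const[OF A, of 1]
  have "v (\<lambda>p. 1 * 1) = 1 * v (\<lambda>p. 1) + 1 * v (\<lambda>p. 1)" by (rule tangent_spaceD(2)[OF v one one])
  then have "v (\<lambda>p. 1) = 0" by simp
  then show ?thesis using tangent_spaceD(3)[OF v one, of c] by simp
qed

lemma smooth_functions_sum:
  assumes "smooth_manifold A" "\<And>i. i \<in> I \<Longrightarrow> f i \<in> smooth_functions A"
  shows "(\<lambda>x. \<Sum>i\<in>I. f i x) \<in> smooth_functions A"
  using assms(2)
  by (induction I rule: infinite_finite_induct)
    (auto intro: smooth_functions_const[OF assms(1)] smooth_functions_add[OF assms(1)])

lemma tangent_space_sum:
  assumes A: "smooth_manifold A" and v: "v \<in> tangent_space A x"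
    and f: "\<And>i. i \<in> I \<Longrightarrow> f i \<in> smooth_functions A"
  shows "v (\<lambda>x. \<Sum>i\<in>I. f i x) = (\<Sum>i\<in>I. v (f i))"
  using f
proof (induction I rule: infinite_finite_induct)
  case (insert i I)
  have "v (\<lambda>x. f i x + (\<Sum>i\<in>I. f i x)) = v (f i) + v (\<lambda>x. \<Sum>i\<in>I. f i x)"
    by (rule tangent_spaceD(1)[OF v _ smooth_functions_sum[OF A]]) (use insert in auto)
  then show ?case using insert by simp
qed (simp_all add: tangent_space_const[OF A v])

text \<open>
  Supplies enough elements of the Lie algebra to control all derivatives on the group.
\<close>

lemma chart_direction_tangent:
  assumes A: "smooth_manifold A" and c: "(U, \<phi>) \<in> A" "x \<in> U"
  shows "(\<lambda>f. if f \<in> smooth_functions A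
      then frechet_derivative (f \<circ> inv_into U \<phi>) (at (\<phi> x)) v else 0) \<in> tangent_space A x"
proof -
  note ch = chartD[OF smooth_manifold_chart[OF A c(1)]]
  have px: "\<phi> x \<in> \<phi> ` U" "inv_into U \<phi> (\<phi> x) = x" using c(2) ch(3) by (auto simp: inv_into_f_f)
  have d: "(f \<circ> inv_into U \<phi> has_derivative frechet_derivative (f \<circ> inv_into U \<phi>) (at (\<phi> x))) (at (\<phi> x))"
    if "f \<in> smooth_functions A" for f
    by (rule Ck_Suc_has_derivative[OF smooth_functionsD(2)[OF that c(1)] px(1)])
  have e: "frechet_derivative f (at p) = f'" if "(f has_derivative f') (at p)"
    for f :: "'b \<Rightarrow> real" and f' p using frechet_derivative_at[OF that] by simp
  have "frechet_derivative ((\<lambda>x. f x + g x) \<circ> inv_into U \<phi>) (at (\<phi> x)) v =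
      frechet_derivative (f \<circ> inv_into U \<phi>) (at (\<phi> x)) v + frechet_derivative (g \<circ> inv_into U \<phi>) (at (\<phi> x)) v"
    if "f \<in> smooth_functions A" "g \<in> smooth_functions A" for f g
    using e[OF has_derivative_add[OF d[OF that(1)] d[OF that(2)]]] by (simp add: o_def)
  moreover have "frechet_derivative ((\<lambda>x. f x * g x) \<circ> inv_into U \<phi>) (at (\<phi> x)) v =
      f x * frechet_derivative (g \<circ> inv_into U \<phi>) (at (\<phi> x)) v + g x * frechet_derivative (f \<circ> inv_into U \<phi>) (at (\<phi> x)) v"
    if "f \<in> smooth_functions A" "g \<in> smooth_functions A" for f g
    using e[OF has_derivative_mult[OF d[OF that(1)] d[OF that(2)]]] px(2) by (simp add: o_def mult.commute)
  moreover have "frechet_derivative ((\<lambda>x. c * f x) \<circ> inv_into U \<phi>) (at (\<phi> x)) v =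
      c * frechet_derivative (f \<circ> inv_into U \<phi>) (at (\<phi> x)) v"
    if "f \<in> smooth_functions A" for f c
    using e[OF has_derivative_mult_right[OF d[OF that], of c]] by (simp add: o_def)
  ultimately show ?thesis unfolding tangent_space_def
    using smooth_functions_add[OF A] smooth_functions_mult[OF A] smooth_functions_scale[OF A] by simp
qed

lemma tangent_map_tangent:
  assumes B: "smooth_manifold B" and F: "\<And>f. f \<in> smooth_functions B \<Longrightarrow> f \<circ> F \<in> smooth_functions A"
    and v: "v \<in> tangent_space A x"
  shows "tangent_map B F v \<in> tangent_space B (F x)"
proof -
  have F': "(\<lambda>x. f (F x)) \<in> smooth_functions A" if "f \<in> smooth_functions B" for f
    using F[OF that] by (simp add: o_def)
  show ?thesis
    unfolding tangent_space_def tangent_map_def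
    by (auto simp: o_def smooth_functions_add[OF B] smooth_functions_mult[OF B] smooth_functions_scale[OF B]
        tangent_spaceD(1)[OF v F' F'] tangent_spaceD(2)[OF v F' F'] tangent_spaceD(3)[OF v F'])
qed

text \<open>
  A function \<open>w\<close> given in the chart, made global by a bump function. For \<open>r < R\<close> the bump vanishes before the
  boundary of the larger ball is reached, so \<open>w\<close> need only be smooth on that ball.
\<close>

definition chart_cutoff :: "'m set \<Rightarrow> ('m \<Rightarrow> 'e::real_inner) \<Rightarrow> 'e \<Rightarrow> real \<Rightarrow> real \<Rightarrow> ('e \<Rightarrow> real) \<Rightarrow> 'm \<Rightarrow> real" where
  "chart_cutoff U \<phi> y0 r R w x =
     (if x \<in> U \<and> \<phi> x \<in> ball y0 R then bump y0 r (\<phi> x) * w (\<phi> x) else 0)"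

lemma chart_cutoff_smooth:
  fixes A :: "('m::{t2_space, second_countable_topology}, 'e::real_inner) chart set"
  assumes A: "smooth_manifold A" and c: "(U, \<phi>) \<in> A" and r: "0 < r" "r < R" "ball y0 R \<subseteq> \<phi> ` U"
    and w: "\<And>k. Ck_on k w (ball y0 R)"
  shows "chart_cutoff U \<phi> y0 r R w \<in> smooth_functions A"
proof -
  obtain B :: "'e set" where B: "onb B" by (rule smooth_manifold_onb[OF A])
  have "(\<lambda>x. if x \<in> U \<and> \<phi> x \<in> ball y0 R then (\<lambda>y. bump y0 r y * w y) (\<phi> x) else 0) \<in> smooth_functions A"
    by (rule smooth_extension_by_zero[OF A c open_ball r(3) _ compact_cball_onb[OF B, of y0 r]])
      (use r in \<open>auto simp: bump_zero intro!: Ck_mult Ck_bump w\<close>)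
  then show ?thesis unfolding chart_cutoff_def[abs_def] by simp
qed

text \<open>
  Write \<open>\<theta>\<close> for the bump function and \<open>a = \<phi> x\<close>. Multiplying Hadamard's expansion of \<open>u\<close> around \<open>x\<close> by
  \<open>\<theta>\<^sup>2\<close> gives an identity between global smooth functions,
  \<open>\<theta> (\<theta> u - u(x) \<theta>) = \<Sum>b. (\<theta> y\<^sub>b - a\<^sub>b \<theta>) (\<theta> q\<^sub>b)\<close>. In each product one factor vanishes at \<open>x\<close>, so the
  Leibniz rule leaves only the derivative of that factor, and one factor \<open>\<theta> x > 0\<close> cancels. The bump
  function is not required to be constant near \<open>x\<close>; this is why \<open>v \<theta>\<close> appears.
\<close>

lemma tangent_vector_in_chart:
  fixes A :: "('m::{t2_space, second_countable_topology}, 'e::real_inner) chart set" and B :: "'e set"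
  assumes A: "smooth_manifold A" and c: "(U, \<phi>) \<in> A" and r: "0 < r" "r < R" "ball y0 R \<subseteq> \<phi> ` U"
    and B: "onb B" and x: "x \<in> U" "\<phi> x \<in> ball y0 r"
    and v: "v \<in> tangent_space A x" and u: "u \<in> smooth_functions A"
  defines "ctf \<equiv> chart_cutoff U \<phi> y0 r R"
  shows "bump y0 r (\<phi> x) * v u =
    (\<Sum>b\<in>B. (v (ctf (\<lambda>y. y \<bullet> b)) - (\<phi> x \<bullet> b) * v (ctf (\<lambda>y. 1))) *
       frechet_derivative (u \<circ> inv_into U \<phi>) (at (\<phi> x)) b)"
proof -
  note ch = chartD[OF smooth_manifold_chart[OF A c]]
  define f where "f = u \<circ> inv_into U \<phi>"
  define a where "a = \<phi> x"
  have aR: "a \<in> ball y0 R" using x r unfolding a_def by auto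
  have f: "Ck_on k f (ball y0 R)" for k
    unfolding f_def by (rule Ck_subset[OF smooth_functionsD(2)[OF u c] r(3)])
  obtain q where q: "\<And>b k. Ck_on k (q b) (ball y0 R)"
    "\<And>y. y \<in> ball y0 R \<Longrightarrow> f y - f a = (\<Sum>b\<in>B. ((y - a) \<bullet> b) * q b y)"
    "\<And>b. q b a = frechet_derivative f (at a) b"
    using hadamard[OF B f aR] by metis
  define \<theta> where "\<theta> = ctf (\<lambda>y. 1)"
  define Y where "Y b = ctf (\<lambda>y. y \<bullet> b)" for b
  define \<kappa> where "\<kappa> b = ctf (q b)" for b
  have sm: "\<theta> \<in> smooth_functions A" "Y b \<in> smooth_functions A" "\<kappa> b \<in> smooth_functions A" for b
    unfolding \<theta>_def Y_def \<kappa>_def ctf_def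
    by (rule chart_cutoff_smooth[OF A c r], rule Ck_const Ck_component[OF open_ball] q(1))+
  note sa = smooth_functions_add[OF A] and smu = smooth_functions_mult[OF A]
    and ss = smooth_functions_scale[OF A]
  have at_x: "\<theta> x = bump y0 r a" "Y b x = bump y0 r a * (a \<bullet> b)"
    "\<kappa> b x = bump y0 r a * frechet_derivative f (at a) b" for b
    using x aR by (simp_all add: \<theta>_def Y_def \<kappa>_def ctf_def chart_cutoff_def a_def q(3)[unfolded a_def])
  have pos: "bump y0 r a > 0" using bump_pos x(2) unfolding a_def by blast
  have fa: "f a = u x" unfolding f_def a_def using x(1) ch(3) by (simp add: inv_into_f_f)
  define w where "w p = \<theta> p * u p + (- u x) * \<theta> p" for p
  have w: "w \<in> smooth_functions A" unfolding w_def[abs_def] by (intro sa smu ss sm u)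
  \<comment> \<open>Hadamard's expansion times \<open>\<theta>\<^sup>2\<close>; outside the chart both sides vanish.\<close>
  have id: "(\<lambda>p. \<theta> p * w p) = (\<lambda>p. \<Sum>b\<in>B. (Y b p + (- (a \<bullet> b)) * \<theta> p) * \<kappa> b p)"
  proof
    fix p
    show "\<theta> p * w p = (\<Sum>b\<in>B. (Y b p + (- (a \<bullet> b)) * \<theta> p) * \<kappa> b p)"
    proof (cases "p \<in> U \<and> \<phi> p \<in> ball y0 R")
      case True
      define y where "y = \<phi> p"
      have fy: "f y = u p" unfolding f_def y_def using True ch(3) by (simp add: inv_into_f_f)
      have v: "\<theta> p = bump y0 r y" "Y b p = bump y0 r y * (y \<bullet> b)" "\<kappa> b p = bump y0 r y * q b y" for b
        using True by (simp_all add: \<theta>_def Y_def \<kappa>_def ctf_def chart_cutoff_def y_def)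
      have "\<theta> p * w p = bump y0 r y * bump y0 r y * (f y - f a)"
        unfolding w_def v fy fa by (simp add: algebra_simps)
      also have "f y - f a = (\<Sum>b\<in>B. ((y - a) \<bullet> b) * q b y)" by (rule q(2)) (use True y_def in auto)
      also have "bump y0 r y * bump y0 r y * \<dots> = (\<Sum>b\<in>B. (Y b p + (- (a \<bullet> b)) * \<theta> p) * \<kappa> b p)"
        unfolding v sum_distrib_left by (rule sum.cong) (simp_all add: inner_diff_left algebra_simps)
      finally show ?thesis .
    next
      case False
      then have "\<theta> p = 0" "\<kappa> b p = 0" for b by (auto simp: \<theta>_def \<kappa>_def ctf_def chart_cutoff_def)
      then show ?thesis by simp
    qed
  qed
  have "v (\<lambda>p. \<theta> p * w p) = \<theta> x * v w + w x * v \<theta>" by (rule tangent_spaceD(2)[OF v sm(1) w])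
  moreover have "w x = 0" by (simp add: w_def)
  moreover have "v w = \<theta> x * v u"
    unfolding w_def[abs_def]
    using tangent_spaceD(1)[OF v smu[OF sm(1) u] ss[OF sm(1), of "- u x"]]
      tangent_spaceD(2)[OF v sm(1) u] tangent_spaceD(3)[OF v sm(1), of "- u x"] by simp
  ultimately have L: "v (\<lambda>p. \<theta> p * w p) = \<theta> x * (\<theta> x * v u)" by simp
  have Xb: "(\<lambda>p. Y b p + (- (a \<bullet> b)) * \<theta> p) \<in> smooth_functions A" for b by (intro sa ss sm)
  have "v (\<lambda>p. \<Sum>b\<in>B. (Y b p + (- (a \<bullet> b)) * \<theta> p) * \<kappa> b p) =
      (\<Sum>b\<in>B. v (\<lambda>p. (Y b p + (- (a \<bullet> b)) * \<theta> p) * \<kappa> b p))"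
    by (rule tangent_space_sum[OF A v]) (intro smu Xb sm)
  also have "\<dots> = (\<Sum>b\<in>B. \<theta> x * ((v (Y b) - (a \<bullet> b) * v \<theta>) * frechet_derivative f (at a) b))"
  proof (rule sum.cong[OF refl])
    fix b
    have "v (\<lambda>p. (Y b p + (- (a \<bullet> b)) * \<theta> p) * \<kappa> b p) =
        (Y b x + (- (a \<bullet> b)) * \<theta> x) * v (\<kappa> b) + \<kappa> b x * v (\<lambda>p. Y b p + (- (a \<bullet> b)) * \<theta> p)"
      by (rule tangent_spaceD(2)[OF v Xb sm(3)])
    also have "v (\<lambda>p. Y b p + (- (a \<bullet> b)) * \<theta> p) = v (Y b) + (- (a \<bullet> b)) * v \<theta>"
      by (simp only: tangent_spaceD(1)[OF v sm(2) ss[OF sm(1)]] tangent_spaceD(3)[OF v sm(1)])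
    finally show "v (\<lambda>p. (Y b p + (- (a \<bullet> b)) * \<theta> p) * \<kappa> b p) =
        \<theta> x * ((v (Y b) - (a \<bullet> b) * v \<theta>) * frechet_derivative f (at a) b)"
      unfolding at_x by (simp add: algebra_simps)
  qed
  finally have "\<theta> x * (\<theta> x * v u) =
      \<theta> x * (\<Sum>b\<in>B. (v (Y b) - (a \<bullet> b) * v \<theta>) * frechet_derivative f (at a) b)"
    unfolding id[symmetric] L by (simp add: sum_distrib_left)
  then have "\<theta> x * v u = (\<Sum>b\<in>B. (v (Y b) - (a \<bullet> b) * v \<theta>) * frechet_derivative f (at a) b)"
    using pos at_x(1) by simp
  then show ?thesis unfolding at_x(1) unfolding Y_def \<theta>_def a_def f_def .
qed

section \<open>Derivations along level sets\<close>

lemma C1_locally_lipschitz: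
  fixes f :: "'e::real_inner \<Rightarrow> 'b::real_normed_vector" and B :: "'e set"
  assumes B: "onb B" and W: "open W" "y0 \<in> W" and f: "Ck_on (Suc 0) f W"
  obtains r K where "r > 0" "K \<ge> 0" "cball y0 r \<subseteq> W"
    "\<And>x y. x \<in> cball y0 r \<Longrightarrow> y \<in> cball y0 r \<Longrightarrow> norm (f x - f y) \<le> K * norm (x - y)"
proof -
  define M where "M = (\<Sum>b\<in>B. norm (frechet_derivative f (at y0) b)) + 1"
  have M: "norm (frechet_derivative f (at y0) b) < M" if "b \<in> B" for b
    using member_le_sum[of b B "\<lambda>b. norm (frechet_derivative f (at y0) b)"] that onb_finite[OF B]
    by (simp add: M_def)
  have M0: "M \<ge> 0" unfolding M_def by (simp add: sum_nonneg)
  define V where "V b = {y \<in> W. norm (frechet_derivative f (at y) b) < M}" for b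
  have V: "open (V b)" for b
  proof -
    have "continuous_on W (\<lambda>y. norm (frechet_derivative f (at y) b))"
      using f by (auto intro!: continuous_on_norm)
    then have "openin (top_of_set W) (W \<inter> (\<lambda>y. norm (frechet_derivative f (at y) b)) -` {..<M})"
      by (rule continuous_openin_preimage_gen) simp
    moreover have "W \<inter> (\<lambda>y. norm (frechet_derivative f (at y) b)) -` {..<M} = V b"
      by (auto simp: V_def)
    ultimately show ?thesis using openin_open_eq[OF W(1)] by simp
  qed
  have "open (W \<inter> (\<Inter>b\<in>B. V b))" using W V onb_finite[OF B] by blast
  moreover have "y0 \<in> W \<inter> (\<Inter>b\<in>B. V b)" using W M by (auto simp: V_def)
  ultimately obtain r where r: "r > 0" "cball y0 r \<subseteq> W \<inter> (\<Inter>b\<in>B. V b)"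
    by (meson open_contains_cball)
  show thesis
  proof (rule that[OF r(1)])
    show "real (card B) * M \<ge> 0" using M0 by simp
    show "cball y0 r \<subseteq> W" using r by blast
    fix x y assume xy: "x \<in> cball y0 r" "y \<in> cball y0 r"
    have d: "(f has_derivative frechet_derivative f (at z)) (at z)" if "z \<in> cball y0 r" for z
      by (rule Ck_Suc_has_derivative[OF f]) (use that r in blast)
    show "norm (f x - f y) \<le> real (card B) * M * norm (x - y)"
    proof (rule differentiable_bound[OF convex_cball has_derivative_at_withinI[OF d] _ xy])
      fix z assume z: "z \<in> cball y0 r"
      show "onorm (frechet_derivative f (at z)) \<le> real (card B) * M"
      proof (rule onorm_bound)
        fix w
        have "norm (frechet_derivative f (at z) b) \<le> M" if "b \<in> B" for b
          using r(2) z that by (fastforce simp: V_def)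
        then show "norm (frechet_derivative f (at z) w) \<le> real (card B) * M * norm w"
          by (rule onb_norm_linear_le[OF B has_derivative_linear[OF d[OF z]]])
      qed (use M0 in simp)
    qed
  qed
qed

text \<open>
  Take an integral curve \<open>\<gamma>\<close> through \<open>z\<close> of the vector field \<open>V\<close> that \<open>D\<close> induces in a chart. The
  functions in \<open>F\<close> are constant along \<open>\<gamma>\<close>, so \<open>h\<close> vanishes along \<open>\<gamma>\<close>, and \<open>D h z\<close> is proportional to the derivative of \<open>h\<close>
  along \<open>\<gamma>\<close> at time zero. The field \<open>V\<close> represents \<open>D\<close> only up to the positive factor \<open>bump y0 r\<close>,
  which changes the speed of the curve but not the conclusion; keeping it avoids a division.
\<close>

lemma derivation_tangent_to_common_level:
  fixes A :: "('m::{t2_space, second_countable_topology}, 'e::real_inner) chart set"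
    and D :: "('m \<Rightarrow> real) \<Rightarrow> 'm \<Rightarrow> real"
  assumes A: "smooth_manifold A"
    and D: "\<And>u. u \<in> smooth_functions A \<Longrightarrow> D u \<in> smooth_functions A"
    and Dt: "\<And>x. (\<lambda>u. if u \<in> smooth_functions A then D u x else 0) \<in> tangent_space A x"
    and F: "F \<subseteq> smooth_functions A" "\<And>u. u \<in> F \<Longrightarrow> D u = (\<lambda>x. 0)"
    and h: "h \<in> smooth_functions A" "\<And>p. (\<And>u. u \<in> F \<Longrightarrow> u p = u z) \<Longrightarrow> h p = 0"
  shows "D h z = 0"
proof -
  obtain B :: "'e set" where B: "onb B" by (rule smooth_manifold_onb[OF A])
  obtain U \<phi> where c: "(U, \<phi>) \<in> A" "z \<in> U" by (rule smooth_manifold_chart_at[OF A])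
  note ch = chartD[OF smooth_manifold_chart[OF A c(1)]]
  define y0 where "y0 = \<phi> z"
  define \<psi> where "\<psi> = inv_into U \<phi>"
  have y0: "y0 \<in> \<phi> ` U" "\<psi> y0 = z" unfolding y0_def \<psi>_def using c(2) ch(3) by (auto simp: inv_into_f_f)
  obtain R where R: "R > 0" "ball y0 R \<subseteq> \<phi> ` U" using ch(2) y0(1) by (meson openE)
  define r where "r = R / 2"
  have r: "0 < r" "r < R" using R by (auto simp: r_def)
  define ctf where "ctf = chart_cutoff U \<phi> y0 r R"
  have ctf: "ctf (\<lambda>y. y \<bullet> b) \<in> smooth_functions A" "ctf (\<lambda>y. 1) \<in> smooth_functions A" for b
    unfolding ctf_def
    by (rule chart_cutoff_smooth[OF A c(1) r R(2)], rule Ck_const Ck_component[OF open_ball])+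
  \<comment> \<open>Up to the factor \<open>bump y0 r\<close>, the coefficients of \<open>D\<close> as a vector field in the chart.\<close>
  define coef where "coef b y = D (ctf (\<lambda>y. y \<bullet> b)) (\<psi> y) - (y \<bullet> b) * D (ctf (\<lambda>y. 1)) (\<psi> y)" for b y
  define V where "V y = (\<Sum>b\<in>B. coef b y *\<^sub>R b)" for y
  have Ccoef: "Ck_on k (coef b) (\<phi> ` U)" for k b
    using smooth_functionsD(2)[OF D[OF ctf(1)] c(1), of k b] smooth_functionsD(2)[OF D[OF ctf(2)] c(1), of k]
    unfolding coef_def[abs_def] \<psi>_def by (intro Ck_diff Ck_mult Ck_component ch(2)) (simp_all add: o_def)
  have CV: "Ck_on k V (ball y0 r)" for k
    unfolding V_def[abs_def]
    by (intro Ck_sum Ck_scaleR Ck_const open_ball Ck_subset[OF Ccoef]) (use r R in auto)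
  have formula: "frechet_derivative (u \<circ> \<psi>) (at y) (V y) = bump y0 r y * D u (\<psi> y)"
    and deriv: "(u \<circ> \<psi> has_derivative frechet_derivative (u \<circ> \<psi>) (at y)) (at y)"
    if u: "u \<in> smooth_functions A" and y: "y \<in> ball y0 r" for u y
  proof -
    have yU: "y \<in> \<phi> ` U" using y r R(2) by auto
    then have psi: "\<psi> y \<in> U" "\<phi> (\<psi> y) = y" unfolding \<psi>_def by (auto simp: inv_into_into f_inv_into_f)
    show d: "(u \<circ> \<psi> has_derivative frechet_derivative (u \<circ> \<psi>) (at y)) (at y)"
      unfolding \<psi>_def by (rule Ck_Suc_has_derivative[OF smooth_functionsD(2)[OF u c(1)] yU])
    have "frechet_derivative (u \<circ> \<psi>) (at y) (V y) = (\<Sum>b\<in>B. coef b y * frechet_derivative (u \<circ> \<psi>) (at y) b)"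
      unfolding V_def using has_derivative_linear[OF d] by (simp add: linear_sum linear_scale)
    also have "\<dots> = bump y0 r y * D u (\<psi> y)"
      using tangent_vector_in_chart[OF A c(1) r R(2) B psi(1) _ Dt u] y psi(2) u ctf
      unfolding coef_def ctf_def \<psi>_def by simp
    finally show "frechet_derivative (u \<circ> \<psi>) (at y) (V y) = bump y0 r y * D u (\<psi> y)" .
  qed
  obtain s K where s: "s > 0" "K \<ge> 0" "cball y0 s \<subseteq> ball y0 r"
    "\<And>x y. x \<in> cball y0 s \<Longrightarrow> y \<in> cball y0 s \<Longrightarrow> norm (V x - V y) \<le> K * norm (x - y)"
    using C1_locally_lipschitz[OF B open_ball _ CV, of y0] r(1) by auto
  obtain \<epsilon> \<gamma> where g: "\<epsilon> > 0" "\<gamma> 0 = y0" "\<And>t. t \<in> {0..\<epsilon>} \<Longrightarrow> \<gamma> t \<in> cball y0 s"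
    "\<And>t. t \<in> {0..\<epsilon>} \<Longrightarrow> (\<gamma> has_vector_derivative V (\<gamma> t)) (at t within {0..\<epsilon>})"
    using picard_lindelof[OF B s(1,2,4)] by metis
  have along: "((\<lambda>t. u (\<psi> (\<gamma> t))) has_vector_derivative bump y0 r (\<gamma> t) * D u (\<psi> (\<gamma> t))) (at t within {0..\<epsilon>})"
    if u: "u \<in> smooth_functions A" and t: "t \<in> {0..\<epsilon>}" for u t
  proof -
    have gt: "\<gamma> t \<in> ball y0 r" using g(3)[OF t] s(3) by blast
    have "((\<lambda>t. (u \<circ> \<psi>) (\<gamma> t)) has_derivative
        (\<lambda>h. frechet_derivative (u \<circ> \<psi>) (at (\<gamma> t)) (h *\<^sub>R V (\<gamma> t)))) (at t within {0..\<epsilon>})"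
      by (rule has_derivative_compose[OF g(4)[OF t, unfolded has_vector_derivative_def] deriv[OF u gt]])
    then show ?thesis
      unfolding has_vector_derivative_def
      using linear_scale[OF has_derivative_linear[OF deriv[OF u gt]]] formula[OF u gt] by simp
  qed
  have zero: "0 \<in> {0..\<epsilon>}" using g(1) by simp
  have const: "u (\<psi> (\<gamma> t)) = u z" if u: "u \<in> F" and t: "t \<in> {0..\<epsilon>}" for u t
  proof -
    have "((\<lambda>t. u (\<psi> (\<gamma> t))) has_derivative (\<lambda>h. 0)) (at t within {0..\<epsilon>})" if "t \<in> {0..\<epsilon>}" for t
      using along[of u t] u F that unfolding has_vector_derivative_def by auto
    then have "u (\<psi> (\<gamma> t)) = u (\<psi> (\<gamma> 0))"
      by (rule has_derivative_zero_unique[OF convex_closed_interval]) (use t zero in auto)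
    then show ?thesis using g(2) y0(2) by simp
  qed
  have h0: "h (\<psi> (\<gamma> t)) = 0" if "t \<in> {0..\<epsilon>}" for t
    by (rule h(2)) (use const that in blast)
  have hd: "((\<lambda>t. h (\<psi> (\<gamma> t))) has_vector_derivative 0) (at 0 within {0..\<epsilon>})"
    by (rule has_vector_derivative_transform[OF zero h0 has_vector_derivative_const])
  have "bump y0 r (\<gamma> 0) * D h (\<psi> (\<gamma> 0)) = 0"
    by (rule vector_derivative_unique_within_closed_interval[of 0 \<epsilon> 0 "\<lambda>t. h (\<psi> (\<gamma> t))"])
      (use g(1) hd along[OF h(1) zero] in \<open>simp_all add: cbox_interval\<close>)
  moreover have "bump y0 r y0 > 0" by (rule bump_pos) (use r in simp)
  ultimately show ?thesis using g(2) y0(2) by simp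
qed

text \<open>
  Vanishing derivatives make \<open>f\<close> constant on balls in charts, hence locally constant.
\<close>

lemma constant_if_chart_derivatives_zero:
  fixes A :: "('m::{t2_space, second_countable_topology}, 'e::real_inner) chart set"
  assumes A: "smooth_manifold A" and conn: "connected (UNIV :: 'm set)" and f: "f \<in> smooth_functions A"
    and d0: "\<And>U \<phi> x v. (U, \<phi>) \<in> A \<Longrightarrow> x \<in> U \<Longrightarrow>
      frechet_derivative (f \<circ> inv_into U \<phi>) (at (\<phi> x)) v = 0"
  shows "f x = f y"
proof (rule connected_local_const[OF conn UNIV_I UNIV_I], rule ballI)
  fix p :: 'm
  obtain U \<phi> where c: "(U, \<phi>) \<in> A" "p \<in> U" by (rule smooth_manifold_chart_at[OF A])
  note ch = chartD[OF smooth_manifold_chart[OF A c(1)]]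
  obtain R where R: "R > 0" "ball (\<phi> p) R \<subseteq> \<phi> ` U" using ch(2) c(2) by (meson imageI openE)
  have loc: "f p = f q" if q: "q \<in> U" "\<phi> q \<in> ball (\<phi> p) R" for q
  proof -
    have "(f \<circ> inv_into U \<phi> has_derivative (\<lambda>v. 0)) (at y within ball (\<phi> p) R)"
      if y: "y \<in> ball (\<phi> p) R" for y
    proof -
      have yU: "y \<in> \<phi> ` U" using y R by blast
      then obtain x where "x \<in> U" "y = \<phi> x" by blast
      then have "frechet_derivative (f \<circ> inv_into U \<phi>) (at y) = (\<lambda>v. 0)"
        using d0[OF c(1)] by auto
      then show ?thesis
        using Ck_Suc_has_derivative[OF smooth_functionsD(2)[OF f c(1)] yU] has_derivative_at_withinI by metis
    qed
    then have "(f \<circ> inv_into U \<phi>) (\<phi> p) = (f \<circ> inv_into U \<phi>) (\<phi> q)"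
      by (rule has_derivative_zero_unique[OF convex_ball]) (use R q in auto)
    then show ?thesis using c(2) q(1) ch(3) by (simp add: inv_into_f_f)
  qed
  have "open (U \<inter> \<phi> -` ball (\<phi> p) R)"
    by (rule chart_open_preimage[OF smooth_manifold_chart[OF A c(1)] open_ball])
  then show "\<forall>\<^sub>F q in at p within UNIV. f p = f q"
    unfolding eventually_at_topological
  proof (intro exI conjI ballI impI)
    show "p \<in> U \<inter> \<phi> -` ball (\<phi> p) R" using c(2) R(1) by simp
    show "f p = f q" if "q \<in> U \<inter> \<phi> -` ball (\<phi> p) R" for q
      by (rule loc) (use that in auto)
  qed
qed

section \<open>Reduction of a Hamiltonian action\<close>

locale hamiltonian_reduction =
  fixes A :: "('m::{t2_space, second_countable_topology}, 'f::real_inner) chart set"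
    and br :: "('m \<Rightarrow> real) \<Rightarrow> ('m \<Rightarrow> real) \<Rightarrow> ('m \<Rightarrow> real)"
    and AG :: "('g::{t2_space, second_countable_topology}, 'e::real_inner) chart set"
    and G :: "'g monoid"
    and act :: "'g \<Rightarrow> 'm \<Rightarrow> 'm"
    and J :: "'m \<Rightarrow> ((('g \<Rightarrow> real) \<Rightarrow> real) \<Rightarrow> real)"
  assumes poisson: "poisson_manifold A br"
    and lie: "lie_group AG G"
    and compact: "compact (UNIV :: 'g set)"
    and connected: "connected (UNIV :: 'g set)"
    and hamiltonian: "hamiltonian_action AG G A br act J"
    and first_class: "first_class A br (zero_level J)"
begin

abbreviation "smooth \<equiv> smooth_functions A"
abbreviation "Z \<equiv> zero_level J"
abbreviation "I \<equiv> vanishing_ideal A Z"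
abbreviation "\<gg> \<equiv> lie_algebra AG G"
abbreviation "P \<equiv> function_algebra A br"

lemma manifold: "smooth_manifold A" and P: "poisson_algebra P"
  using poisson by (simp_all add: poisson_manifold_def)

lemma lie_group_facts:
  shows AG: "smooth_manifold AG" and G: "Group.group G" and carrier_G: "carrier G = UNIV"
    and mult_smooth: "smooth_map (prod_atlas AG AG) AG (\<lambda>(g, h). g \<otimes>\<^bsub>G\<^esub> h)"
    and inv_smooth: "smooth_map AG AG (\<lambda>g. inv\<^bsub>G\<^esub> g)"
  using lie by (simp_all add: lie_group_def)

sublocale G: compact_group G
proof (intro compact_group.intro compact_group_axioms.intro G carrier_G compact)
  have "continuous_on UNIV (\<lambda>(g, h). g \<otimes>\<^bsub>G\<^esub> h)" using mult_smooth by (simp add: smooth_map_def)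
  then show "continuous_on UNIV (\<lambda>p. fst p \<otimes>\<^bsub>G\<^esub> snd p)" by (simp add: case_prod_unfold)
  show "continuous_on UNIV (\<lambda>g. inv\<^bsub>G\<^esub> g)" using inv_smooth by (simp add: smooth_map_def)
qed

lemma action: "group_action G UNIV act"
  and act_smooth: "smooth_map (prod_atlas AG A) A (\<lambda>(g, x). act g x)"
  and moment: "moment_map AG G A br act J"
  using hamiltonian by (simp_all add: hamiltonian_action_def smooth_action_def)

lemma act_mult: "act (g \<otimes>\<^bsub>G\<^esub> h) x = act g (act h x)"
  using group_action.composition_rule[OF action] by simp

lemma act_one: "act \<one>\<^bsub>G\<^esub> x = x"
  using group_action.id_eq_one[OF action] by (metis UNIV_I restrict_apply')

subsection \<open>The Poisson algebra of functions\<close>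

lemma function_algebra_simps [simp]:
  "carrier P = smooth" "f \<otimes>\<^bsub>P\<^esub> g = (\<lambda>x. f x * g x)" "f \<oplus>\<^bsub>P\<^esub> g = (\<lambda>x. f x + g x)"
  "\<one>\<^bsub>P\<^esub> = (\<lambda>x. 1)" "\<zero>\<^bsub>P\<^esub> = (\<lambda>x. 0)" "a \<odot>\<^bsub>P\<^esub> f = (\<lambda>x. a * f x)" "pbracket P = br"
  by (simp_all add: function_algebra_def)

lemma smooth_closed:
  "(\<lambda>x. c) \<in> smooth"
  "f \<in> smooth \<Longrightarrow> g \<in> smooth \<Longrightarrow> (\<lambda>x. f x + g x) \<in> smooth"
  "f \<in> smooth \<Longrightarrow> g \<in> smooth \<Longrightarrow> (\<lambda>x. f x * g x) \<in> smooth"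
  "f \<in> smooth \<Longrightarrow> (\<lambda>x. c * f x) \<in> smooth"
  using smooth_functions_const smooth_functions_add smooth_functions_mult smooth_functions_scale manifold
  by blast+

lemma br_closed: "f \<in> smooth \<Longrightarrow> g \<in> smooth \<Longrightarrow> br f g \<in> smooth"
  using poisson_algebra.bracket_closed[OF P] by simp

lemma br_antisym: "f \<in> smooth \<Longrightarrow> g \<in> smooth \<Longrightarrow> br f g = (\<lambda>x. - br g f x)"
  using poisson_algebra.bracket_antisym[OF P, of f g] poisson_algebra.smult_minus_one[OF P, of "br g f"] br_closed
  by simp

lemma br_add_left: "f \<in> smooth \<Longrightarrow> g \<in> smooth \<Longrightarrow> h \<in> smooth \<Longrightarrow>
    br (\<lambda>x. f x + g x) h = (\<lambda>x. br f h x + br g h x)"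
  using poisson_algebra.bracket_add[OF P] by simp

lemma br_scale_left: "f \<in> smooth \<Longrightarrow> g \<in> smooth \<Longrightarrow> br (\<lambda>x. c * f x) g = (\<lambda>x. c * br f g x)"
  using poisson_algebra.bracket_smult[OF P] by simp

lemma br_add_right:
  assumes "f \<in> smooth" "g \<in> smooth" "h \<in> smooth"
  shows "br h (\<lambda>x. f x + g x) = (\<lambda>x. br h f x + br h g x)"
  using br_antisym[OF assms(3) smooth_closed(2)[OF assms(1,2)]] br_add_left[OF assms]
    br_antisym[OF assms(3,1)] br_antisym[OF assms(3,2)] by simp

lemma br_scale_right:
  assumes "f \<in> smooth" "g \<in> smooth"
  shows "br g (\<lambda>x. c * f x) = (\<lambda>x. c * br g f x)"
  using br_antisym[OF assms(2) smooth_closed(4)[OF assms(1)]] br_scale_left[OF assms]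
    br_antisym[OF assms(2,1)] by simp

lemma br_mult_right: "f \<in> smooth \<Longrightarrow> g \<in> smooth \<Longrightarrow> h \<in> smooth \<Longrightarrow>
    br h (\<lambda>x. f x * g x) = (\<lambda>x. br h f x * g x + f x * br h g x)"
  using poisson_algebra.bracket_leibniz[OF P, of h f g] by simp

text \<open>
  The form used below: \<open>br f\<close> is a derivation of the bracket.
\<close>

lemma br_jacobi:
  assumes "f \<in> smooth" "g \<in> smooth" "h \<in> smooth"
  shows "br f (br g h) = (\<lambda>x. br (br f g) h x + br g (br f h) x)"
proof -
  have "(\<lambda>x. br f (br g h) x + br g (br h f) x + br h (br f g) x) = (\<lambda>x. 0)"
    using poisson_algebra.bracket_jacobi[OF P, of f g h] assms by simp
  then have "br f (br g h) x + br g (br h f) x + br h (br f g) x = 0" for x by (rule fun_cong)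
  moreover have "br g (br h f) = (\<lambda>x. - br g (br f h) x)"
    using br_antisym[OF assms(3,1)] br_scale_right[OF br_closed[OF assms(1,3)] assms(2), of "-1"] by simp
  moreover have "br h (br f g) = (\<lambda>x. - br (br f g) h x)"
    by (rule br_antisym[OF assms(3) br_closed[OF assms(1,2)]])
  ultimately have "br f (br g h) x = br (br f g) h x + br g (br f h) x" for x
    by (simp add: algebra_simps eq_neg_iff_add_eq_0)
  then show ?thesis by blast
qed

lemma br_one:
  assumes "f \<in> smooth"
  shows "br f (\<lambda>x. c) = (\<lambda>x. 0)"
proof -
  have "br f (\<lambda>x. 1 * 1) = (\<lambda>x. br f (\<lambda>x. 1) x * 1 + 1 * br f (\<lambda>x. 1) x)"
    using br_mult_right[OF smooth_closed(1) smooth_closed(1) assms, of 1 1] by simp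
  then have "br f (\<lambda>x. 1) x = 0" for x by (simp add: fun_eq_iff)
  then show ?thesis using br_scale_right[OF smooth_closed(1) assms, of c 1] by simp
qed

lemma br_tangent:
  assumes f: "f \<in> smooth"
  shows "(\<lambda>u. if u \<in> smooth then br f u x else 0) \<in> tangent_space A x"
  unfolding tangent_space_def
  using f by (simp add: smooth_closed br_add_right br_mult_right br_scale_right br_one)

subsection \<open>Moment map\<close>

lemma component_smooth: "\<xi> \<in> \<gg> \<Longrightarrow> component J \<xi> \<in> smooth"
  using moment by (simp add: moment_map_def)

lemma in_Z: "z \<in> Z \<longleftrightarrow> (\<forall>\<xi>\<in>\<gg>. component J \<xi> z = 0)"
proof
  assume "\<forall>\<xi>\<in>\<gg>. component J \<xi> z = 0"
  moreover have "J z \<xi> = 0" if "\<xi> \<notin> \<gg>" for \<xi>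
    using moment that unfolding moment_map_def lie_dual_def by blast
  ultimately have "J z \<xi> = 0" for \<xi> unfolding component_def by blast
  then show "z \<in> Z" by (auto simp: zero_level_def)
qed (auto simp: zero_level_def component_def)

lemma I_iff: "f \<in> I \<longleftrightarrow> f \<in> smooth \<and> (\<forall>z\<in>Z. f z = 0)"
  by (simp add: vanishing_ideal_def)

lemma component_in_I: "\<xi> \<in> \<gg> \<Longrightarrow> component J \<xi> \<in> I"
  using component_smooth in_Z by (auto simp: I_iff)

lemma act_Z: "z \<in> Z \<Longrightarrow> act g z \<in> Z"
  using moment by (auto simp: moment_map_def zero_level_def coAd_def)

lemma br_component:
  "\<xi> \<in> \<gg> \<Longrightarrow> f \<in> smooth \<Longrightarrow> br (component J \<xi>) f x = \<xi> (\<lambda>g. f (act (inv\<^bsub>G\<^esub> g) x))"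
  using moment unfolding moment_map_def fundamental_field_def tangent_map_def
  by (simp add: o_def)

lemma smooth_act: "f \<in> smooth \<Longrightarrow> (\<lambda>p. f (act (fst p) (snd p))) \<in> smooth_functions (prod_atlas AG A)"
  using smooth_functions_compose[OF act_smooth prod_atlas_chart[OF AG manifold] manifold]
  by (simp add: case_prod_unfold)

lemma smooth_orbit_inv:
  assumes "f \<in> smooth"
  shows "(\<lambda>g. f (act (inv\<^bsub>G\<^esub> g) x)) \<in> smooth_functions AG"
proof -
  have "(\<lambda>g. f (act g x)) \<in> smooth_functions AG"
    using smooth_functions_slice(1)[OF AG manifold smooth_act[OF assms], of x] by simp
  from smooth_functions_compose[OF inv_smooth smooth_manifold_chart[OF AG] AG this]
  show ?thesis .
qed

lemma smooth_left_translate: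
  assumes "f \<in> smooth_functions AG"
  shows "(\<lambda>g. f (h \<otimes>\<^bsub>G\<^esub> g)) \<in> smooth_functions AG"
proof -
  have "(\<lambda>p. f (fst p \<otimes>\<^bsub>G\<^esub> snd p)) \<in> smooth_functions (prod_atlas AG AG)"
    using smooth_functions_compose[OF mult_smooth prod_atlas_chart[OF AG AG] AG assms]
    by (simp add: case_prod_unfold)
  from smooth_functions_slice(2)[OF AG AG this, of h] show ?thesis by simp
qed

definition invariants :: "('m \<Rightarrow> real) set" where
  "invariants = {f \<in> smooth. \<forall>\<xi>\<in>\<gg>. br (component J \<xi>) f = (\<lambda>x. 0)}"

definition normalizer :: "('m \<Rightarrow> real) set" where
  "normalizer = {f \<in> smooth. \<forall>h\<in>I. br h f \<in> I}"

text \<open>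
  The Hamiltonian vector field of an invariant function \<open>f\<close> annihilates the components of \<open>J\<close>, whose
  common zero set is \<open>Z\<close>; so it also annihilates, at the points of \<open>Z\<close>, every function vanishing on
  \<open>Z\<close>.
\<close>

lemma invariants_normalize: "invariants \<subseteq> normalizer"
proof
  fix f assume f: "f \<in> invariants"
  then have fs: "f \<in> smooth" by (simp add: invariants_def)
  have "br h f \<in> I" if h: "h \<in> I" for h
  proof -
    have hs: "h \<in> smooth" using h by (simp add: I_iff)
    have "br f h z = 0" if z: "z \<in> Z" for z
    proof (rule derivation_tangent_to_common_level[OF manifold br_closed[OF fs] br_tangent[OF fs]])
      show "component J ` \<gg> \<subseteq> smooth" using component_smooth by blast
      show "br f u = (\<lambda>x. 0)" if "u \<in> component J ` \<gg>" for u
      proof -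
        obtain \<xi> where \<xi>: "\<xi> \<in> \<gg>" "u = component J \<xi>" using \<open>u \<in> component J ` \<gg>\<close> by blast
        then have "br u f = (\<lambda>x. 0)" using f by (simp add: invariants_def)
        then show ?thesis using br_antisym[OF fs component_smooth[OF \<xi>(1)]] \<xi>(2) by simp
      qed
      show "h \<in> smooth" by (rule hs)
      show "h p = 0" if p: "\<And>u. u \<in> component J ` \<gg> \<Longrightarrow> u p = u z" for p
      proof -
        have "component J \<xi> p = 0" if "\<xi> \<in> \<gg>" for \<xi>
          using p[of "component J \<xi>"] z in_Z that by auto
        then have "p \<in> Z" using in_Z by blast
        then show ?thesis using h by (simp add: I_iff)
      qed
    qed
    then show ?thesis using br_antisym[OF hs fs] br_closed[OF hs fs] by (simp add: I_iff)
  qed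
  then show "f \<in> normalizer" using fs by (simp add: normalizer_def)
qed

text \<open>
  The derivative of \<open>w g = f (g\<inverse> z)\<close> at \<open>h\<close> in a chart direction is moved to the identity by left translation
  with \<open>h\<inverse>\<close>. There it becomes the derivative of \<open>f\<close> along the fundamental vector field of some \<open>\<xi>\<close> at the
  point \<open>h\<inverse> z\<close>, that is \<open>{J(\<xi>), f} (h\<inverse> z)\<close>. This vanishes because \<open>h\<inverse> z \<in> Z\<close> and \<open>J(\<xi>) \<in> I\<close>.
\<close>

lemma normalizer_constant_on_orbits:
  assumes f: "f \<in> normalizer" and z: "z \<in> Z"
  shows "f (act g z) = f z"
proof -
  have fs: "f \<in> smooth" and fI: "\<And>h. h \<in> I \<Longrightarrow> br h f \<in> I" using f by (auto simp: normalizer_def)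
  define w where "w g = f (act (inv\<^bsub>G\<^esub> g) z)" for g
  have w: "w \<in> smooth_functions AG" unfolding w_def[abs_def] by (rule smooth_orbit_inv[OF fs])
  have "frechet_derivative (w \<circ> inv_into U \<phi>) (at (\<phi> h)) v = 0" if c: "(U, \<phi>) \<in> AG" "h \<in> U" for U \<phi> h v
  proof -
    define \<delta> where "\<delta> = (\<lambda>f. if f \<in> smooth_functions AG
      then frechet_derivative (f \<circ> inv_into U \<phi>) (at (\<phi> h)) v else 0)"
    \<comment> \<open>The direction \<open>v\<close> at \<open>h\<close>, moved to the identity.\<close>
    define \<xi> where "\<xi> = tangent_map AG (\<lambda>g. inv\<^bsub>G\<^esub> h \<otimes>\<^bsub>G\<^esub> g) \<delta>"
    have \<delta>: "\<delta> \<in> tangent_space AG h" unfolding \<delta>_def by (rule chart_direction_tangent[OF AG c])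
    have "\<xi> \<in> tangent_space AG (inv\<^bsub>G\<^esub> h \<otimes>\<^bsub>G\<^esub> h)"
      unfolding \<xi>_def by (rule tangent_map_tangent[OF AG _ \<delta>]) (simp add: o_def smooth_left_translate)
    then have \<xi>: "\<xi> \<in> \<gg>" by (simp add: lie_algebra_def)
    define y where "y = act (inv\<^bsub>G\<^esub> h) z"
    have y: "y \<in> Z" unfolding y_def by (rule act_Z[OF z])
    have "br (component J \<xi>) f y = 0" using fI[OF component_in_I[OF \<xi>]] y by (simp add: I_iff)
    then have "\<xi> (\<lambda>g. f (act (inv\<^bsub>G\<^esub> g) y)) = 0" using br_component[OF \<xi> fs] by simp
    then have "\<delta> (\<lambda>g. f (act (inv\<^bsub>G\<^esub> (inv\<^bsub>G\<^esub> h \<otimes>\<^bsub>G\<^esub> g)) y)) = 0"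
      unfolding \<xi>_def tangent_map_def by (simp add: smooth_orbit_inv[OF fs] o_def)
    moreover have "act (inv\<^bsub>G\<^esub> (inv\<^bsub>G\<^esub> h \<otimes>\<^bsub>G\<^esub> g)) y = act (inv\<^bsub>G\<^esub> g) z" for g
      unfolding y_def by (simp flip: act_mult add: G.inv_mult_group G.m_assoc)
    ultimately have "\<delta> w = 0" by (simp add: w_def[abs_def])
    then show ?thesis using w by (simp add: \<delta>_def)
  qed
  then have "w (inv\<^bsub>G\<^esub> g) = w \<one>\<^bsub>G\<^esub>" by (rule constant_if_chart_derivatives_zero[OF AG connected w])
  then show ?thesis by (simp add: w_def act_one)
qed

definition average :: "('m \<Rightarrow> real) \<Rightarrow> 'm \<Rightarrow> real" where
  "average f x = G.haar_mean (\<lambda>g. f (act g x))"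

lemma continuous_orbit:
  assumes "f \<in> smooth"
  shows "continuous_on UNIV (\<lambda>g. f (act g x))"
  using smooth_functionsD(1)[OF smooth_functions_slice(1)[OF AG manifold smooth_act[OF assms], of x]] by simp

lemma average_smooth:
  assumes f: "f \<in> smooth"
  shows "average f \<in> smooth"
proof (rule smooth_functionsI_charts[OF manifold])
  fix V \<psi> k assume d: "(V, \<psi>) \<in> A"
  note dh = chartD[OF smooth_manifold_chart[OF manifold d]]
  obtain B :: "'f set" where B: "onb B" by (rule smooth_manifold_onb[OF manifold])
  have "\<exists>U \<phi>. (U, \<phi>) \<in> AG \<and> s \<in> U" for s by (meson smooth_manifold_chart_at[OF AG])
  then obtain U \<phi> where c: "\<And>s. (U s, \<phi> s) \<in> AG" "\<And>s. s \<in> U s" by metis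
  note ch = chartD[OF smooth_manifold_chart[OF AG c(1)]]
  have "PCk k UNIV (\<lambda>g y. f (act g (inv_into V \<psi> y))) (\<psi> ` V)"
  proof (rule PCk_of_Ck[where U = U and \<phi> = \<phi> and Q = "\<lambda>s. \<phi> s ` U s \<times> \<psi> ` V"
        and h = "\<lambda>s p. f (act (inv_into (U s) (\<phi> s) (fst p)) (inv_into V \<psi> (snd p)))"])
    show "Ck_on k (\<lambda>p. f (act (inv_into (U s) (\<phi> s) (fst p)) (inv_into V \<psi> (snd p)))) (\<phi> s ` U s \<times> \<psi> ` V)" for s
      using smooth_prod_local[OF AG manifold smooth_act[OF f] c(1) d, where k = k] by simp
  qed (use c ch dh in \<open>auto simp: inv_into_f_f open_Times\<close>)
  from Ck_mean[OF B compact dh(2) G.haar_mean_mean_on this]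
  show "Ck_on k (average f \<circ> inv_into V \<psi>) (\<psi> ` V)" by (simp add: average_def[abs_def] o_def)
qed

text \<open>
  Right invariance of the mean makes the average constant on orbits, and a fundamental vector field
  differentiates along orbits.
\<close>

lemma average_invariant:
  assumes f: "f \<in> smooth"
  shows "average f \<in> invariants"
proof -
  have inv: "average f (act h x) = average f x" for h x
    unfolding average_def using G.haar_mean_translate[OF continuous_orbit[OF f], of h x]
    by (simp add: act_mult)
  have "br (component J \<xi>) (average f) x = 0" if \<xi>: "\<xi> \<in> \<gg>" for \<xi> x
    unfolding br_component[OF \<xi> average_smooth[OF f]] inv
    using tangent_space_const[OF AG \<xi>[unfolded lie_algebra_def]] .
  then show ?thesis using average_smooth[OF f] by (auto simp: invariants_def)
qed

lemma normalizer_average: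
  assumes f: "f \<in> normalizer"
  shows "(\<lambda>x. f x - average f x) \<in> I"
proof -
  have fs: "f \<in> smooth" using f by (simp add: normalizer_def)
  have "average f z = f z" if "z \<in> Z" for z
    unfolding average_def normalizer_constant_on_orbits[OF f that] by (rule G.haar_mean_const)
  moreover have "(\<lambda>x. f x + (-1) * average f x) \<in> smooth"
    by (intro smooth_closed fs average_smooth)
  ultimately show ?thesis by (simp add: I_iff)
qed

subsection \<open>The isomorphism\<close>

lemma I_closed:
  "I \<subseteq> smooth" "(\<lambda>x. 0) \<in> I"
  "f \<in> I \<Longrightarrow> g \<in> I \<Longrightarrow> (\<lambda>x. f x + g x) \<in> I"
  "f \<in> smooth \<Longrightarrow> g \<in> I \<Longrightarrow> (\<lambda>x. f x * g x) \<in> I"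
  "f \<in> I \<Longrightarrow> g \<in> smooth \<Longrightarrow> (\<lambda>x. f x * g x) \<in> I"
  "g \<in> I \<Longrightarrow> (\<lambda>x. c * g x) \<in> I"
  "f \<in> I \<Longrightarrow> g \<in> I \<Longrightarrow> br f g \<in> I"
  using first_class smooth_closed by (auto simp: I_iff first_class_def)

lemma normalizer_subalgebra: "poisson_subalgebra normalizer P"
proof -
  have "br f g \<in> normalizer" if f: "f \<in> normalizer" and g: "g \<in> normalizer" for f g
  proof -
    have s: "f \<in> smooth" "g \<in> smooth" using f g by (auto simp: normalizer_def)
    have "br h (br f g) \<in> I" if h: "h \<in> I" for h
    proof -
      have hs: "h \<in> smooth" using h I_closed by blast
      have hf: "br h f \<in> I" "br h g \<in> I" using f g h by (auto simp: normalizer_def)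
      then have "br (br h f) g \<in> I" "br (br h g) f \<in> I" using f g by (auto simp: normalizer_def)
      moreover have "br f (br h g) = (\<lambda>x. (-1) * br (br h g) f x)"
        using br_antisym[OF s(1), of "br h g"] br_closed hs s by simp
      ultimately show ?thesis unfolding br_jacobi[OF hs s] using I_closed(3,6) by metis
    qed
    then show ?thesis using br_closed s by (simp add: normalizer_def)
  qed
  then show ?thesis
    unfolding poisson_subalgebra_def
    using I_closed smooth_closed
    by (auto simp: normalizer_def br_one br_add_right br_mult_right br_scale_right subset_iff)
qed

lemma invariants_subalgebra: "poisson_subalgebra invariants (P\<lparr>carrier := normalizer\<rparr>)"
proof -
  have "br f g \<in> invariants" if f: "f \<in> invariants" and g: "g \<in> invariants" for f g
  proof -
    have s: "f \<in> smooth" "g \<in> smooth" using f g by (auto simp: invariants_def)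
    have "br (component J \<xi>) (br f g) = (\<lambda>x. 0)" if \<xi>: "\<xi> \<in> \<gg>" for \<xi>
    proof -
      have z: "br (component J \<xi>) f = (\<lambda>x. 0)" "br (component J \<xi>) g = (\<lambda>x. 0)"
        using f g \<xi> by (auto simp: invariants_def)
      have "br (\<lambda>x. 0) g = (\<lambda>x. 0)"
        using br_antisym[OF smooth_closed(1) s(2), of 0] br_one[OF s(2), of 0] by simp
      then show ?thesis
        unfolding br_jacobi[OF component_smooth[OF \<xi>] s] z using br_one[OF s(1), of 0] by simp
    qed
    then show ?thesis using br_closed s by (simp add: invariants_def)
  qed
  then show ?thesis
    unfolding poisson_subalgebra_def
    using invariants_normalize smooth_closed component_smooth
    by (auto simp: invariants_def br_one br_add_right br_mult_right br_scale_right)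
qed

lemma I_normalizer: "I \<subseteq> normalizer"
  using I_closed by (auto simp: normalizer_def)

lemma I_poisson_ideal: "poisson_ideal I (P\<lparr>carrier := normalizer\<rparr>)"
proof -
  have "br f g \<in> I" if f: "f \<in> normalizer" and g: "g \<in> I" for f g
  proof -
    have "br g f \<in> I" using f g by (simp add: normalizer_def)
    moreover have "br f g = (\<lambda>x. (-1) * br g f x)"
      using br_antisym[of f g] f g I_closed(1) by (auto simp: normalizer_def)
    ultimately show ?thesis using I_closed(6) by metis
  qed
  then show ?thesis unfolding poisson_ideal_def
    using I_normalizer I_closed by (auto simp: normalizer_def)
qed

text \<open>
  For \<open>h \<in> I\<close> the action on cosets is well defined because \<open>{h, I} \<subseteq> I\<close>, so a coset is invariant exactly
  when its representatives lie in the normalizer. The operations of the two quotients agree because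
  they do not refer to the carrier.
\<close>

lemma dirac_reduction_eq: "dirac_reduction A br Z = poisson_quot (P\<lparr>carrier := normalizer\<rparr>) I"
proof -
  let ?\<pi> = "\<lambda>f. I +>\<^bsub>P\<^esub> f"
  have coset: "?\<pi> f = {\<lambda>x. i x + f x | i. i \<in> I}" for f by (auto simp: a_r_coset_def')
  have absorb: "?\<pi> (\<lambda>x. i x + f x) = ?\<pi> f" if i: "i \<in> I" for i f
  proof
    show "?\<pi> (\<lambda>x. i x + f x) \<subseteq> ?\<pi> f"
    proof
      fix p assume "p \<in> ?\<pi> (\<lambda>x. i x + f x)"
      then obtain j where j: "j \<in> I" "p = (\<lambda>x. j x + (i x + f x))" unfolding coset by blast
      show "p \<in> ?\<pi> f"
        unfolding coset j(2) using I_closed(3)[OF j(1) i]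
        by (intro CollectI exI[of _ "\<lambda>x. j x + i x"]) (simp add: add.assoc)
    qed
    show "?\<pi> f \<subseteq> ?\<pi> (\<lambda>x. i x + f x)"
    proof
      fix p assume "p \<in> ?\<pi> f"
      then obtain j where j: "j \<in> I" "p = (\<lambda>x. j x + f x)" unfolding coset by blast
      show "p \<in> ?\<pi> (\<lambda>x. i x + f x)"
        unfolding coset j(2) using I_closed(3)[OF j(1) I_closed(6)[OF i, of "-1"]]
        by (intro CollectI exI[of _ "\<lambda>x. j x + (-1) * i x"]) simp
    qed
  qed
  have self: "f \<in> ?\<pi> f" for f unfolding coset using I_closed(2) by force
  have "ideal_act A br Z h (?\<pi> f) = ?\<pi> (br h f)" if h: "h \<in> I" and f: "f \<in> smooth" for h f
  proof -
    have "?\<pi> (br h F) = ?\<pi> (br h f)" if F: "F \<in> ?\<pi> f" for F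
    proof -
      obtain i where i: "i \<in> I" "F = (\<lambda>x. i x + f x)" using F unfolding coset by blast
      have s: "h \<in> smooth" "i \<in> smooth" using h i I_closed by blast+
      show ?thesis unfolding i(2) br_add_right[OF s(2) f s(1)] by (rule absorb[OF I_closed(7)[OF h i(1)]])
    qed
    then show ?thesis unfolding ideal_act_def using self by blast
  qed
  moreover have "?\<pi> f = I \<longleftrightarrow> f \<in> I" for f
  proof
    assume "f \<in> I"
    then show "?\<pi> f = I" using absorb[of f "\<lambda>x. 0"] by (simp add: coset)
  qed (use self in auto)
  ultimately have act: "ideal_act A br Z h (?\<pi> f) = I \<longleftrightarrow> br h f \<in> I" if "h \<in> I" "f \<in> smooth" for h f
    using that by simp
  have "{K \<in> a_rcosets\<^bsub>P\<^esub> I. \<forall>h\<in>I. ideal_act A br Z h K = I} = a_rcosets\<^bsub>P\<lparr>carrier := normalizer\<rparr>\<^esub> I"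
    using act by (auto simp: A_RCOSETS_def' normalizer_def a_r_coset_def')
  then show ?thesis
    unfolding dirac_reduction_def Let_def poisson_quot_def
    by (simp add: rcoset_mult_def a_r_coset_def' set_add_def' fun_eq_iff)
qed

lemma reductions_isomorphic:
  "isomorphic_poisson_algebras (dirac_reduction A br Z) (universal_reduction AG G A br J)"
proof -
  have "isomorphic_poisson_algebras (poisson_quot (P\<lparr>carrier := normalizer\<rparr>) I)
      (poisson_quot (P\<lparr>carrier := normalizer, carrier := invariants\<rparr>) (I \<inter> invariants))"
  proof (rule poisson_second_isomorphism[OF poisson_algebra_subalgebra[OF P normalizer_subalgebra]
        invariants_subalgebra I_poisson_ideal])
    fix f assume "f \<in> carrier (P\<lparr>carrier := normalizer\<rparr>)"
    then have f: "f \<in> normalizer" by simp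
    then have "average f \<in> invariants" by (intro average_invariant) (simp add: normalizer_def)
    then show "\<exists>i\<in>I. \<exists>c\<in>invariants. f = i \<oplus>\<^bsub>P\<lparr>carrier := normalizer\<rparr>\<^esub> c"
      using normalizer_average[OF f]
      by (intro bexI[of _ "\<lambda>x. f x - average f x"] bexI[of _ "average f"]) simp_all
  qed
  then show ?thesis
    by (simp add: dirac_reduction_eq universal_reduction_def invariant_algebra_def invariants_def)
qed

end

theorem proposition2p1p8:
  fixes A :: "('m::{t2_space, second_countable_topology}, 'f::real_inner) chart set"
    and br :: "('m \<Rightarrow> real) \<Rightarrow> ('m \<Rightarrow> real) \<Rightarrow> ('m \<Rightarrow> real)"
    and AG :: "('g::{t2_space, second_countable_topology}, 'e::real_inner) chart set"
    and G :: "'g monoid"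
    and act :: "'g \<Rightarrow> 'm \<Rightarrow> 'm"
    and J :: "'m \<Rightarrow> ((('g \<Rightarrow> real) \<Rightarrow> real) \<Rightarrow> real)"
  assumes "poisson_manifold A br"
    and "lie_group AG G"
    and "compact (UNIV :: 'g set)"
    and "connected (UNIV :: 'g set)"
    and "hamiltonian_action AG G A br act J"
    and "first_class A br (zero_level J)"
  shows "isomorphic_poisson_algebras
           (dirac_reduction A br (zero_level J))
           (universal_reduction AG G A br J)"
proof -
  interpret hamiltonian_reduction A br AG G act J
    using assms by (rule hamiltonian_reduction.intro)
  show ?thesis by (rule reductions_isomorphic)
qed

end
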